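(* Consider in $d=2$ the SPDE $$\mathrm{d}u=\big(\partial_1(a^{11}\partial_1u)+\partial_2(a^{22}\partial_2u)\big)\mathrm{d}t-\sin(2\pi x_1)\partial_1u\,\mathrm{d}w^1_t-\cos(2\pi x_1)\partial_1u\,\mathrm{d}w^2_t-\sin(2\pi x_2)\partial_2u\,\mathrm{d}w^3_t-\cos(2\pi x_2)\partial_2u\,\mathrm{d}w^4_t$$ on $\mathbb{T}^2$, where $a^{11},a^{22}\colon[0,T]\times\Omega\times\mathbb{T}^2\to\mathbb{R}$ are $\mathcal{P}\otimes\mathcal{B}(\mathbb{T}^2)$-measurable and such that for some $\delta\in(0,1)$, $\mathbb{P}$-a.s., $$\tfrac12+\delta\le a^{ii}(t,x)\le\tfrac12+\delta^{-1}$$ for all $i\in\{1,2\}$, $t\in[0,T]$, $x$. Let $\alpha=(\alpha^{ij})_{i,j=1}^2$ be the diffusion coefficient of the transformed equation (see context) and define $$\Lambda(t,x):=\sup_{\eta\in\mathbb{R}^2:|\eta|=1}\Big|\sum_{i,j}\eta_i\alpha^{ij}(t,x)\eta_j\Big|\ \Big/\ \inf_{\eta\in\mathbb{R}^2:|\eta|=1}\Big|\sum_{i,j}\eta_i\alpha^{ij}(t,x)\eta_j\Big|.$$ Then $\mathbb{P}(\Lambda(t,x)>k)>0$ for all $(t,x)\in(0,T]\times\mathbb{T}^2$ and $k>0$.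
   Context: $T\in(0,\infty)$; $\mathbb{T}^2$ is the two-dimensional torus of unit length, and functions on it are identified with their periodic extensions; $(\Omega,\mathcal{A},\mathbb{P})$ is a probability space with complete filtration $\mathscr{F}$; $w^1,\dots,w^4$ are independent $\mathscr{F}$-Brownian motions; $\mathcal{P}$ is the progressive $\sigma$-algebra. Diffusion coefficient of the transformed equation: for an SPDE with leading part $\mathrm{d}u=\sum_{i,j}\partial_i(a^{ij}\partial_ju)\,\mathrm{d}t+\sum_n\sum_ib^i_n\partial_iu\,\mathrm{d}w^n_t$, let $\xi$ be the stochastic flow of diffeomorphisms solving $$\mathrm{d}\xi^i_t(x)=\tfrac12\sum_n\sum_j(b^j_n\partial_jb^i_n)(t,\xi_t(x))\,\mathrm{d}t-\sum_nb^i_n(t,\xi_t(x))\,\mathrm{d}w^n_t,\qquad\xi_0(x)=x,$$ let $\psi=(D\xi)^{-1}$ be its inverse spatial Jacobian, and set $$\alpha^{ij}(t,x)=\sum_{k,l}\psi^i_k(t,x)\Big(a^{kl}(t,\xi_t(x))-\tfrac12\sum_nb^k_n(t,\xi_t(x))b^l_n(t,\xi_t(x))\Big)\psi^j_l(t,x),$$ where $\psi^i_k$ is the entry in row $i$, column $k$ of $(D\xi)^{-1}$ with $D\xi=(\partial_j\xi^i)_{i,j}$. (This is the diffusion matrix of the equation satisfied by $v(t,x)=u(t,\xi_t(x))$.) In the present example $a^{12}=a^{21}=0$ and $b_1=(-\sin(2\pi x_1),0)$, $b_2=(-\cos(2\pi x_1),0)$, $b_3=(0,-\sin(2\pi x_2))$,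 $b_4=(0,-\cos(2\pi x_2))$. *)

theory Defs
  imports "HOL-Probability.Probability"
begin

section \<open>Filtrations and Brownian motion on a finite time horizon\<close>

text \<open>
  Processes are functions \<open>X t \<omega>\<close> of time and scenario. Filtrations are indexed by all reals, as in
  the library locale, but only the times in \<open>{0..T}\<close> matter; a filtration given on \<open>{0..T}\<close> is
  extended by constants. Completeness means that \<open>F 0\<close> contains every subset of a null set of \<open>M\<close>;
  in particular \<open>M\<close> itself is then complete.
\<close>

definition complete_filtration :: "'w measure \<Rightarrow> real \<Rightarrow> (real \<Rightarrow> 'w measure) \<Rightarrow> bool" where
  "complete_filtration M T F \<longleftrightarrow>
     filtration (space M) F \<and>
     (\<forall>t\<in>{0..T}. subalgebra M (F t)) \<and>
     (\<forall>N\<in>null_sets M. \<forall>A. A \<subseteq> N \<longrightarrow> A \<in> sets (F 0))"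

definition progressive_sigma :: "'w set \<Rightarrow> real \<Rightarrow> (real \<Rightarrow> 'w measure) \<Rightarrow> (real \<times> 'w) measure" where
  "progressive_sigma \<Omega> T F =
     sigma ({0..T} \<times> \<Omega>)
       {A. A \<subseteq> {0..T} \<times> \<Omega> \<and>
           (\<forall>t\<in>{0..T}. A \<inter> ({0..t} \<times> \<Omega>) \<in> sets (restrict_space borel {0..t} \<Otimes>\<^sub>M F t))}"

definition brownian_motion ::
  "'w measure \<Rightarrow> real \<Rightarrow> (real \<Rightarrow> 'w measure) \<Rightarrow> (real \<Rightarrow> 'w \<Rightarrow> real) \<Rightarrow> bool" where
  "brownian_motion M T F W \<longleftrightarrow>
     (\<forall>t\<in>{0..T}. W t \<in> borel_measurable (F t)) \<and>
     (AE \<omega> in M. W 0 \<omega> = 0) \<and>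
     (AE \<omega> in M. continuous_on {0..T} (\<lambda>t. W t \<omega>)) \<and>
     (\<forall>s t. 0 \<le> s \<and> s < t \<and> t \<le> T \<longrightarrow>
        distributed M lborel (\<lambda>\<omega>. W t \<omega> - W s \<omega>) (\<lambda>y. ennreal (normal_density 0 (sqrt (t - s)) y)) \<and>
        prob_space.indep_set M (sets (F s))
          (sets (vimage_algebra (space M) (\<lambda>\<omega>. W t \<omega> - W s \<omega>) borel)))"

definition independent_brownian_motions ::
  "'w measure \<Rightarrow> real \<Rightarrow> (real \<Rightarrow> 'w measure) \<Rightarrow> ('n::finite \<Rightarrow> real \<Rightarrow> 'w \<Rightarrow> real) \<Rightarrow> bool" where
  "independent_brownian_motions M T F w \<longleftrightarrow>
     (\<forall>n. brownian_motion M T F (w n)) \<and>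
     prob_space.indep_vars M (\<lambda>_. Pi\<^sub>M {0..T} (\<lambda>_. borel)) (\<lambda>n \<omega>. \<lambda>t\<in>{0..T}. w n t \<omega>) UNIV"


section \<open>The Ito integral\<close>

text \<open>
  The simple process given by \<open>m\<close>, \<open>\<tau>\<close>, \<open>h\<close> is
  \<open>\<Sum>k<m. h k \<cdot> 1_{(\<tau> k, \<tau> (k+1)]}\<close>, with bounded \<open>F (\<tau> k)\<close>-measurable coefficients \<open>h k\<close>.
\<close>

definition simple_process ::
  "'w measure \<Rightarrow> real \<Rightarrow> (real \<Rightarrow> 'w measure) \<Rightarrow> nat \<Rightarrow> (nat \<Rightarrow> real) \<Rightarrow> (nat \<Rightarrow> 'w \<Rightarrow> real) \<Rightarrow> bool" where
  "simple_process M T F m \<tau> h \<longleftrightarrow>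
     \<tau> 0 = 0 \<and> \<tau> m = T \<and> (\<forall>k<m. \<tau> k < \<tau> (Suc k)) \<and>
     (\<forall>k<m. h k \<in> borel_measurable (F (\<tau> k)) \<and> (\<exists>C. \<forall>\<omega>\<in>space M. \<bar>h k \<omega>\<bar> \<le> C))"

definition simple_value ::
  "nat \<Rightarrow> (nat \<Rightarrow> real) \<Rightarrow> (nat \<Rightarrow> 'w \<Rightarrow> real) \<Rightarrow> real \<Rightarrow> 'w \<Rightarrow> real" where
  "simple_value m \<tau> h t \<omega> = (\<Sum>k<m. h k \<omega> * indicator {\<tau> k<..\<tau> (Suc k)} t)"

definition simple_integral ::
  "(real \<Rightarrow> 'w \<Rightarrow> real) \<Rightarrow> nat \<Rightarrow> (nat \<Rightarrow> real) \<Rightarrow> (nat \<Rightarrow> 'w \<Rightarrow> real) \<Rightarrow> real \<Rightarrow> 'w \<Rightarrow> real" where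
  "simple_integral W m \<tau> h t \<omega> =
     (\<Sum>k<m. h k \<omega> * (W (min t (\<tau> (Suc k))) \<omega> - W (min t (\<tau> k)) \<omega>))"

definition tendsto_zero_in_probability :: "'w measure \<Rightarrow> (nat \<Rightarrow> 'w \<Rightarrow> ennreal) \<Rightarrow> bool" where
  "tendsto_zero_in_probability M X \<longleftrightarrow>
     (\<forall>k. X k \<in> borel_measurable M) \<and>
     (\<forall>\<epsilon>>0. (\<lambda>k. measure M {\<omega>\<in>space M. X k \<omega> > ennreal \<epsilon>}) \<longlonglongrightarrow> 0)"

text \<open>
  \<open>I\<close> is (a version of) the Ito integral process \<open>t \<mapsto> \<integral>\<^sub>0\<^sup>t H dW\<close> on \<open>{0..T}\<close>: the limit, uniformly in
  time in probability, of the integrals of simple processes that converge to \<open>H\<close> in \<open>L\<^sup>2({0..T})\<close> in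
  probability. This is the usual extension of the integral to progressively measurable integrands
  with \<open>\<integral>\<^sub>0\<^sup>T H\<^sup>2 dt < \<infinity>\<close> almost surely (a property that is forced by the approximation); it determines
  \<open>I\<close> up to indistinguishability.
\<close>

definition ito_integral ::
  "'w measure \<Rightarrow> real \<Rightarrow> (real \<Rightarrow> 'w measure) \<Rightarrow> (real \<Rightarrow> 'w \<Rightarrow> real) \<Rightarrow> (real \<Rightarrow> 'w \<Rightarrow> real) \<Rightarrow>
   (real \<Rightarrow> 'w \<Rightarrow> real) \<Rightarrow> bool" where
  "ito_integral M T F W H I \<longleftrightarrow>
     (\<lambda>(t, \<omega>). H t \<omega>) \<in> borel_measurable (progressive_sigma (space M) T F) \<and>
     (\<forall>t\<in>{0..T}. I t \<in> borel_measurable (F t)) \<and>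
     (AE \<omega> in M. continuous_on {0..T} (\<lambda>t. I t \<omega>)) \<and>
     (\<exists>m \<tau> h. (\<forall>k. simple_process M T F (m k) (\<tau> k) (h k)) \<and>
        tendsto_zero_in_probability M
          (\<lambda>k \<omega>. \<integral>\<^sup>+t\<in>{0..T}. ennreal ((simple_value (m k) (\<tau> k) (h k) t \<omega> - H t \<omega>)\<^sup>2) \<partial>lborel) \<and>
        tendsto_zero_in_probability M
          (\<lambda>k \<omega>. SUP t\<in>{0..T}. ennreal \<bar>simple_integral W (m k) (\<tau> k) (h k) t \<omega> - I t \<omega>\<bar>))"


section \<open>The stochastic flow and the transformed diffusion coefficient\<close>

text \<open>
  Coefficients are written \<open>a i j t \<omega> x\<close> and \<open>b n t \<omega> x $ i\<close>. With the library's \<open>jacobian\<close>, the entry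
  \<open>jacobian f (at x) $ i $ j\<close> is the partial derivative \<open>\<partial>\<^sub>j f\<^sup>i\<close> at \<open>x\<close>.
\<close>

definition flow_drift ::
  "('n::finite \<Rightarrow> real \<Rightarrow> 'w \<Rightarrow> real^'d \<Rightarrow> real^'d) \<Rightarrow> real \<Rightarrow> 'w \<Rightarrow> real^'d::finite \<Rightarrow> 'd \<Rightarrow> real" where
  "flow_drift b t \<omega> x i =
     1/2 * (\<Sum>n\<in>UNIV. \<Sum>j\<in>UNIV. b n t \<omega> x $ j * jacobian (b n t \<omega>) (at x) $ i $ j)"

definition solves_flow_sde ::
  "'w measure \<Rightarrow> real \<Rightarrow> (real \<Rightarrow> 'w measure) \<Rightarrow> ('n::finite \<Rightarrow> real \<Rightarrow> 'w \<Rightarrow> real) \<Rightarrow>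
   ('n \<Rightarrow> real \<Rightarrow> 'w \<Rightarrow> real^'d \<Rightarrow> real^'d) \<Rightarrow> (real \<Rightarrow> 'w \<Rightarrow> real^'d::finite) \<Rightarrow> real^'d \<Rightarrow> bool" where
  "solves_flow_sde M T F w b X x \<longleftrightarrow>
     (\<forall>t\<in>{0..T}. X t \<in> borel_measurable (F t)) \<and>
     (AE \<omega> in M. continuous_on {0..T} (\<lambda>t. X t \<omega>)) \<and>
     (\<forall>i. \<exists>I. (\<forall>n. ito_integral M T F (w n) (\<lambda>t \<omega>. b n t \<omega> (X t \<omega>) $ i) (I n)) \<and>
        (AE \<omega> in M.
           set_integrable lborel {0..T} (\<lambda>s. flow_drift b s \<omega> (X s \<omega>) i) \<and>
           (\<forall>t\<in>{0..T}.
              X t \<omega> $ i = x $ i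
                + (LINT s:{0..t}|lborel. flow_drift b s \<omega> (X s \<omega>) i)
                - (\<Sum>n\<in>UNIV. I n t \<omega>))))"

definition C1_diffeomorphism :: "(real^'d \<Rightarrow> real^'d::finite) \<Rightarrow> bool" where
  "C1_diffeomorphism f \<longleftrightarrow> bij f \<and>
     f differentiable_on UNIV \<and> continuous_on UNIV (\<lambda>x. jacobian f (at x)) \<and>
     inv f differentiable_on UNIV \<and> continuous_on UNIV (\<lambda>x. jacobian (inv f) (at x))"

text \<open>
  The regularity in \<open>x\<close> that is required is \<open>C\<^sup>1\<close> only. A solution of the equation that is jointly
  continuous is unique up to indistinguishability for smooth coefficients, so that it is then the
  smooth flow.
\<close>

definition stochastic_flow ::
  "'w measure \<Rightarrow> real \<Rightarrow> (real \<Rightarrow> 'w measure) \<Rightarrow> ('n::finite \<Rightarrow> real \<Rightarrow> 'w \<Rightarrow> real) \<Rightarrow>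
   ('n \<Rightarrow> real \<Rightarrow> 'w \<Rightarrow> real^'d \<Rightarrow> real^'d) \<Rightarrow> (real \<Rightarrow> 'w \<Rightarrow> real^'d \<Rightarrow> real^'d::finite) \<Rightarrow> bool" where
  "stochastic_flow M T F w b \<xi> \<longleftrightarrow>
     (\<forall>x. solves_flow_sde M T F w b (\<lambda>t \<omega>. \<xi> t \<omega> x) x) \<and>
     (AE \<omega> in M.
        continuous_on ({0..T} \<times> UNIV) (\<lambda>(t, x). \<xi> t \<omega> x) \<and>
        continuous_on ({0..T} \<times> UNIV) (\<lambda>(t, x). jacobian (\<xi> t \<omega>) (at x)) \<and>
        (\<forall>t\<in>{0..T}. C1_diffeomorphism (\<xi> t \<omega>)))"

definition transformed_diffusion ::
  "('d \<Rightarrow> 'd \<Rightarrow> real \<Rightarrow> 'w \<Rightarrow> real^'d \<Rightarrow> real) \<Rightarrow> ('n::finite \<Rightarrow> real \<Rightarrow> 'w \<Rightarrow> real^'d \<Rightarrow> real^'d) \<Rightarrow>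
   (real \<Rightarrow> 'w \<Rightarrow> real^'d \<Rightarrow> real^'d) \<Rightarrow> real \<Rightarrow> 'w \<Rightarrow> real^'d \<Rightarrow> real^'d^'d::finite" where
  "transformed_diffusion a b \<xi> t \<omega> x =
     (let \<psi> = matrix_inv (jacobian (\<xi> t \<omega>) (at x)); y = \<xi> t \<omega> x in
      \<chi> i j. \<Sum>k\<in>UNIV. \<Sum>l\<in>UNIV.
        \<psi> $ i $ k * (a k l t \<omega> y - 1/2 * (\<Sum>n\<in>UNIV. b n t \<omega> y $ k * b n t \<omega> y $ l)) * \<psi> $ j $ l)"

definition ellipticity_ratio :: "real^'d^'d::finite \<Rightarrow> real" where
  "ellipticity_ratio A =
     (SUP \<eta>\<in>{\<eta>. norm \<eta> = 1}. \<bar>\<Sum>i\<in>UNIV. \<Sum>j\<in>UNIV. \<eta> $ i * A $ i $ j * \<eta> $ j\<bar>) /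
     (INF \<eta>\<in>{\<eta>. norm \<eta> = 1}. \<bar>\<Sum>i\<in>UNIV. \<Sum>j\<in>UNIV. \<eta> $ i * A $ i $ j * \<eta> $ j\<bar>)"


section \<open>The example on the two-dimensional torus\<close>

text \<open>
  Functions on the torus of unit length are represented by their periodic extensions.
\<close>

definition torus_periodic :: "(real^'d::finite \<Rightarrow> 'b) \<Rightarrow> bool" where
  "torus_periodic f \<longleftrightarrow> (\<forall>x j. f (x + axis j 1) = f x)"

text \<open>The noise index ranges over the four-element type, in which \<open>4 = 0\<close>.\<close>

definition trig_noise :: "4 \<Rightarrow> real \<Rightarrow> 'w \<Rightarrow> real^2 \<Rightarrow> real^2" where
  "trig_noise n t \<omega> x =
     (if n = 1 then vector [- sin (2 * pi * x $ 1), 0]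
      else if n = 2 then vector [- cos (2 * pi * x $ 1), 0]
      else if n = 3 then vector [0, - sin (2 * pi * x $ 2)]
      else vector [0, - cos (2 * pi * x $ 2)])"

end

theory Submission
  imports Defs
begin

text \<open>
  The drift of the flow vanishes for these coefficients, so each component of \<open>\<xi>\<close> solves
  \<open>dX = - \<Sum>\<^sub>n \<beta>\<^sub>n(X) dw\<^sup>n\<close> with \<open>\<beta>\<close> running through \<open>- sin (2\<pi>\<cdot>)\<close> and \<open>- cos (2\<pi>\<cdot>)\<close>. Only expectations are
  needed, so Ito's formula is replaced by Dynkin's: a second-order Taylor expansion over a short time
  step, with the stochastic integral approximated in \<open>L\<^sup>2\<close> by its integrand at the left end point.

  Applied to \<open>1 - cos (2\<pi>z)\<close>, with Gronwall, it shows that \<open>\<xi>\<^sup>i(x) - \<xi>\<^sup>i(y)\<close> is an integer whenever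
  \<open>x\<^sub>i = y\<^sub>i\<close>, so that \<open>D\<xi>\<close> is diagonal. The logarithms \<open>ln \<bar>\<partial>\<^sub>1\<xi>\<^sup>1\<bar>\<close> and \<open>ln \<bar>\<partial>\<^sub>2\<xi>\<^sup>2\<bar>\<close> formally solve
  \<open>d ln \<bar>\<partial>\<^sub>i\<xi>\<^sup>i\<bar> = - \<Sum>\<^sub>n \<beta>\<^sub>n'(\<xi>\<^sup>i) dw\<^sup>n - 2\<pi>\<^sup>2 dt\<close> with \<open>\<Sum>\<^sub>n (\<beta>\<^sub>n')\<^sup>2 = 4\<pi>\<^sup>2\<close>, so their difference \<open>D\<close> should be
  centred normal with variance \<open>8\<pi>\<^sup>2t\<close>. This is verified through the characteristic function, applying
  Dynkin's formula to \<open>cos (\<theta>D + c)\<close> with difference quotients of \<open>\<xi>\<close> and a regularised logarithm.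
  Since \<open>\<Lambda> \<ge> \<delta>\<^sup>2 exp (2D)\<close>, the ratio exceeds every bound with positive probability.
\<close>

section \<open>Brownian increments\<close>

text \<open>Of the dependence of \<open>\<xi>\<close> on x only C1 regularity is given, so no
  stochastic equation for \<open>D\<xi>\<close> is at hand. A difference quotient z with step h is
  instead a multiple of the difference of two solutions, and the addition formulas give its
  quadratic variation rate as (2 pi z)^2 times sinc(pi h z)^2: for fixed h a function of z alone, at
  most (2 pi z)^2 and asymptotic to it as h tends to 0. Multiplied by the squared first or by the
  second derivative of ln |z| it stays bounded, which replaces moment estimates on the flow.
  Dynkin's formula is proved for products u(z1) v(z2) with derivatives bounded up to order three;
  this forces the bounded function 1 - cos in place of a square, which yields integers rather than
  zero, and the regularisation of the logarithm. Both logarithms carry the same drift, so only their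
  difference is centred. The variance is the sum of 4 pi^2 t from each of the two disjoint pairs of
  motions. The factor \<open>\<delta>\<^sup>2\<close> arises because the noise removes exactly 1/2
  from each \<open>a i i\<close>, leaving numerators between \<delta> and 1/\<delta>.\<close>

locale filtered_prob_space = prob_space M for M :: "'w measure" +
  fixes T :: real and F :: "real \<Rightarrow> 'w measure"
  assumes T_pos: "0 < T" and complete_filtration: "complete_filtration M T F"
begin

lemma space_F: "space (F t) = space M"
  using complete_filtration unfolding complete_filtration_def filtration_def by auto

lemma sets_F_mono: "s \<le> t \<Longrightarrow> sets (F s) \<subseteq> sets (F t)"
  using complete_filtration unfolding complete_filtration_def filtration_def by auto

lemma sets_F_subset: "t \<in> {0..T} \<Longrightarrow> sets (F t) \<subseteq> sets M"
  using complete_filtration unfolding complete_filtration_def subalgebra_def by auto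

lemma measurable_F_mono: "f \<in> measurable (F s) N \<Longrightarrow> s \<le> t \<Longrightarrow> f \<in> measurable (F t) N"
  using sets_F_mono[of s t] by (auto simp: measurable_def space_F)

lemma measurable_F: "f \<in> measurable (F s) N \<Longrightarrow> s \<in> {0..T} \<Longrightarrow> f \<in> measurable M N"
  using sets_F_subset[of s] by (auto simp: measurable_def space_F)

lemma brownian_measurable:
  "brownian_motion M T F W \<Longrightarrow> t \<in> {0..T} \<Longrightarrow> W t \<in> borel_measurable (F t)"
  by (auto simp: brownian_motion_def)

lemma increment_measurable:
  assumes "brownian_motion M T F W" "s \<in> {0..T}" "t \<in> {0..T}"
  shows "(\<lambda>\<omega>. W t \<omega> - W s \<omega>) \<in> borel_measurable M"
  using brownian_measurable[OF assms(1,2)] brownian_measurable[OF assms(1,3)] assms(2,3)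
  by (intro borel_measurable_diff) (auto intro: measurable_F)

text \<open>The sigma-algebra generated by X is contained in \<open>F s\<close>, so the independence
  of the increment from all of \<open>F s\<close> is inherited.\<close>

lemma increment_indep:
  assumes W: "brownian_motion M T F W" and st: "0 \<le> s" "s < t" "t \<le> T"
    and X: "X \<in> borel_measurable (F s)"
  shows "indep_var borel X borel (\<lambda>\<omega>. W t \<omega> - W s \<omega>)"
proof -
  let ?D = "\<lambda>\<omega>. W t \<omega> - W s \<omega>"
  have i: "indep_set (sets (F s)) (sets (vimage_algebra (space M) ?D borel))"
    using W st by (auto simp: brownian_motion_def)
  have X': "X \<in> borel_measurable M" using X st by (intro measurable_F) auto
  have D: "?D \<in> borel_measurable M" using W st by (intro increment_measurable) auto
  have 1: "{X -` A \<inter> space M |A. A \<in> sets borel} \<subseteq> sets (F s)"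
    using X by (auto simp: measurable_def space_F)
  have "sigma_sets (space M) {X -` A \<inter> space M |A. A \<in> sets borel} \<subseteq> sets (F s)"
    using sets.sigma_sets_subset[OF 1] by (simp add: space_F)
  moreover have "sigma_sets (space M) {?D -` A \<inter> space M |A. A \<in> sets borel}
      \<subseteq> sets (vimage_algebra (space M) ?D borel)"
    by (simp add: sets_vimage_algebra)
  ultimately have "indep_set (sigma_sets (space M) {X -` A \<inter> space M |A. A \<in> sets borel})
      (sigma_sets (space M) {?D -` A \<inter> space M |A. A \<in> sets borel})"
    using i unfolding indep_set_def
    by (elim indep_sets_mono_sets) (auto split: bool.split)
  with X' D show ?thesis by (simp add: indep_var_eq)
qed

lemma increment_moments:
  assumes W: "brownian_motion M T F W" and st: "0 \<le> s" "s < t" "t \<le> T"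
  shows "integrable M (\<lambda>\<omega>. (W t \<omega> - W s \<omega>) ^ k)"
    "expectation (\<lambda>\<omega>. W t \<omega> - W s \<omega>) = 0"
    "expectation (\<lambda>\<omega>. (W t \<omega> - W s \<omega>)\<^sup>2) = t - s"
    "expectation (\<lambda>\<omega>. (W t \<omega> - W s \<omega>) ^ 4) = 3 * (t - s)\<^sup>2"
proof -
  let ?D = "\<lambda>\<omega>. W t \<omega> - W s \<omega>"
  have D: "distributed M lborel ?D (\<lambda>y. ennreal (normal_density 0 (sqrt (t - s)) y))"
    using W st by (auto simp: brownian_motion_def)
  have pos: "0 < sqrt (t - s)" using st by simp
  have *: "(\<lambda>x::real. x ^ k) \<in> borel_measurable lborel" for k by measurable
  show "integrable M (\<lambda>\<omega>. ?D \<omega> ^ k)"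
    using distributed_integrable[OF D *[of k]] integrable_normal_moment[OF pos, of 0 k] by simp
  have E: "expectation (\<lambda>\<omega>. ?D \<omega> ^ k) = (\<integral>x. normal_density 0 (sqrt (t - s)) x * x ^ k \<partial>lborel)" for k
    using distributed_integral[OF D *[of k]] by simp
  show "expectation ?D = 0"
    using normal_distributed_expectation[OF pos D] .
  show "expectation (\<lambda>\<omega>. (?D \<omega>)\<^sup>2) = t - s"
    using integral_normal_moment_even[OF pos, of 0 1] st
    by (simp add: E fact_numeral)
  show "expectation (\<lambda>\<omega>. (?D \<omega>) ^ 4) = 3 * (t - s)\<^sup>2"
    using integral_normal_moment_even[OF pos, of 0 2] st
    by (simp add: E fact_numeral field_simps power2_eq_square)
qed

lemma expectation_mult_increment:
  assumes W: "brownian_motion M T F W" and st: "0 \<le> s" "s \<le> t" "t \<le> T"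
    and X: "X \<in> borel_measurable (F s)" "integrable M X"
  shows "integrable M (\<lambda>\<omega>. X \<omega> * (W t \<omega> - W s \<omega>))"
    "expectation (\<lambda>\<omega>. X \<omega> * (W t \<omega> - W s \<omega>)) = 0"
    "integrable M (\<lambda>\<omega>. X \<omega> * (W t \<omega> - W s \<omega>)\<^sup>2)"
    "expectation (\<lambda>\<omega>. X \<omega> * (W t \<omega> - W s \<omega>)\<^sup>2) = expectation X * (t - s)"
proof -
  let ?D = "\<lambda>\<omega>. W t \<omega> - W s \<omega>"
  have "integrable M (\<lambda>\<omega>. X \<omega> * ?D \<omega>) \<and> expectation (\<lambda>\<omega>. X \<omega> * ?D \<omega>) = 0 \<and>
    integrable M (\<lambda>\<omega>. X \<omega> * (?D \<omega>)\<^sup>2) \<and> expectation (\<lambda>\<omega>. X \<omega> * (?D \<omega>)\<^sup>2) = expectation X * (t - s)"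
  \<comment> \<open>Brownian increments are specified for s < t only; at s = t the increment is 0
    and all four claims are trivial.\<close>
  proof (cases "s = t")
    case False
    then have lt: "s < t" using st by simp
    note i = increment_indep[OF W st(1) lt st(3) X(1)]
    note m = increment_moments[OF W st(1) lt st(3)]
    have i2: "indep_var borel X borel (\<lambda>\<omega>. (?D \<omega>)\<^sup>2)"
      using indep_var_compose[OF i, of "\<lambda>x. x" borel "\<lambda>x. x\<^sup>2" borel] by (simp add: comp_def)
    have D: "integrable M ?D" using m(1)[of 1] by simp
    show ?thesis
      using indep_var_integrable[OF i X(2) D] indep_var_lebesgue_integral[OF i X(2) D]
        indep_var_integrable[OF i2 X(2) m(1)] indep_var_lebesgue_integral[OF i2 X(2) m(1)] m(2,3)
      by auto
  qed auto
  then show "integrable M (\<lambda>\<omega>. X \<omega> * ?D \<omega>)" "expectation (\<lambda>\<omega>. X \<omega> * ?D \<omega>) = 0"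
    "integrable M (\<lambda>\<omega>. X \<omega> * (?D \<omega>)\<^sup>2)"
    "expectation (\<lambda>\<omega>. X \<omega> * (?D \<omega>)\<^sup>2) = expectation X * (t - s)" by auto
qed

lemma integrable_bounded:
  assumes "X \<in> borel_measurable M" "\<And>\<omega>. \<omega> \<in> space M \<Longrightarrow> \<bar>X \<omega>\<bar> \<le> (C::real)"
  shows "integrable M X"
  using assms by (intro integrable_const_bound[of _ C]) (auto simp: AE_I2)

lemma integrable_mult_L2:
  assumes "integrable M (\<lambda>\<omega>. (X \<omega>)\<^sup>2)" "integrable M (\<lambda>\<omega>. (Y \<omega>)\<^sup>2)"
    "X \<in> borel_measurable M" "Y \<in> borel_measurable M"
  shows "integrable M (\<lambda>\<omega>. X \<omega> * Y \<omega> :: real)"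
proof (rule Bochner_Integration.integrable_bound[OF Bochner_Integration.integrable_add[OF assms(1,2)]])
  have "\<bar>x * y\<bar> \<le> \<bar>x\<^sup>2 + y\<^sup>2\<bar>" for x y :: real
  proof -
    have "0 \<le> (\<bar>x\<bar> - \<bar>y\<bar>)\<^sup>2" by simp
    then have "2 * (\<bar>x\<bar> * \<bar>y\<bar>) \<le> x\<^sup>2 + y\<^sup>2" by (simp add: power2_diff)
    moreover have "0 \<le> \<bar>x\<bar> * \<bar>y\<bar>" by simp
    ultimately show ?thesis unfolding abs_mult by linarith
  qed
  then show "AE \<omega> in M. norm (X \<omega> * Y \<omega>) \<le> norm ((X \<omega>)\<^sup>2 + (Y \<omega>)\<^sup>2)" by simp
qed (use assms in measurable)

lemma integrable_L2_imp_L1: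
  assumes "integrable M (\<lambda>\<omega>. (X \<omega>)\<^sup>2)" "X \<in> borel_measurable M"
  shows "integrable M (X :: 'w \<Rightarrow> real)"
  using integrable_mult_L2[OF assms(1), of "\<lambda>_. 1"] assms(2) by simp

lemma integrable_mult_bounded:
  assumes "integrable M (X :: 'w \<Rightarrow> real)" "Y \<in> borel_measurable M" "\<And>\<omega>. \<omega> \<in> space M \<Longrightarrow> \<bar>Y \<omega>\<bar> \<le> C"
  shows "integrable M (\<lambda>\<omega>. Y \<omega> * X \<omega>)"
proof (rule Bochner_Integration.integrable_bound[of _ "\<lambda>\<omega>. C * X \<omega>"])
  show "AE \<omega> in M. norm (Y \<omega> * X \<omega>) \<le> norm (C * X \<omega>)"
    using assms(3) by (intro AE_I2) (force simp: abs_mult intro!: mult_right_mono)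
  show "integrable M (\<lambda>\<omega>. C * X \<omega>)" using assms(1) by simp
  show "(\<lambda>\<omega>. Y \<omega> * X \<omega>) \<in> borel_measurable M"
    using borel_measurable_integrable[OF assms(1)] assms(2) by measurable
qed

text \<open>Discrete Ito isometry and martingale property. Measurability of \<open>c k\<close> is
  asked only on nondegenerate steps because the lemma is applied to a grid clipped to a window:
  steps beyond the window collapse to its right end, where their coefficients are not yet known, but
  the increment there is 0.\<close>

lemma martingale_transform:
  assumes W: "brownian_motion M T F W"
    and \<sigma>: "0 \<le> \<sigma> 0" "\<And>k. k < m \<Longrightarrow> \<sigma> k \<le> \<sigma> (Suc k)" "\<sigma> m \<le> T"
    and c: "\<And>k. k < m \<Longrightarrow> \<sigma> k < \<sigma> (Suc k) \<Longrightarrow> c k \<in> borel_measurable (F (\<sigma> k))"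
      "\<And>k. k < m \<Longrightarrow> \<exists>C. \<forall>\<omega>\<in>space M. \<bar>c k \<omega>\<bar> \<le> C"
  defines "A \<equiv> \<lambda>\<omega>. \<Sum>k<m. c k \<omega> * (W (\<sigma> (Suc k)) \<omega> - W (\<sigma> k) \<omega>)"
  shows "A \<in> borel_measurable (F (\<sigma> m))" "integrable M (\<lambda>\<omega>. (A \<omega>)\<^sup>2)"
    "expectation (\<lambda>\<omega>. (A \<omega>)\<^sup>2) = (\<Sum>k<m. expectation (\<lambda>\<omega>. (c k \<omega>)\<^sup>2) * (\<sigma> (Suc k) - \<sigma> k))"
    "\<And>Y. Y \<in> borel_measurable (F (\<sigma> 0)) \<Longrightarrow> (\<exists>C. \<forall>\<omega>\<in>space M. \<bar>Y \<omega>\<bar> \<le> C) \<Longrightarrow>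
       expectation (\<lambda>\<omega>. Y \<omega> * A \<omega>) = 0"
proof -
  \<comment> \<open>The induction also carries \<open>0 \<le> \<sigma> m\<close> and
    \<open>\<sigma> 0 \<le> \<sigma> m\<close>: the new increment starts at
    \<open>\<sigma> m\<close>, and a test variable known at \<open>\<sigma> 0\<close> must be known
    there.\<close>
  have "0 \<le> \<sigma> m \<and> A \<in> borel_measurable (F (\<sigma> m)) \<and> integrable M (\<lambda>\<omega>. (A \<omega>)\<^sup>2) \<and>
    expectation (\<lambda>\<omega>. (A \<omega>)\<^sup>2) = (\<Sum>k<m. expectation (\<lambda>\<omega>. (c k \<omega>)\<^sup>2) * (\<sigma> (Suc k) - \<sigma> k)) \<and>
    (\<forall>Y. Y \<in> borel_measurable (F (\<sigma> 0)) \<longrightarrow> (\<exists>C. \<forall>\<omega>\<in>space M. \<bar>Y \<omega>\<bar> \<le> C) \<longrightarrow>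
       expectation (\<lambda>\<omega>. Y \<omega> * A \<omega>) = 0) \<and> \<sigma> 0 \<le> \<sigma> m"
    using \<sigma> c unfolding A_def
  proof (induction m)
    case 0
    then show ?case by simp
  next
    case (Suc m)
    let ?A = "\<lambda>\<omega>. \<Sum>k<m. c k \<omega> * (W (\<sigma> (Suc k)) \<omega> - W (\<sigma> k) \<omega>)"
    let ?D = "\<lambda>\<omega>. W (\<sigma> (Suc m)) \<omega> - W (\<sigma> m) \<omega>"
    have le: "\<sigma> m \<le> \<sigma> (Suc m)" "\<sigma> (Suc m) \<le> T" using Suc.prems by auto
    have IH: "0 \<le> \<sigma> m" "?A \<in> borel_measurable (F (\<sigma> m))" "integrable M (\<lambda>\<omega>. (?A \<omega>)\<^sup>2)"
      "expectation (\<lambda>\<omega>. (?A \<omega>)\<^sup>2) = (\<Sum>k<m. expectation (\<lambda>\<omega>. (c k \<omega>)\<^sup>2) * (\<sigma> (Suc k) - \<sigma> k))"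
      "\<And>Y. Y \<in> borel_measurable (F (\<sigma> 0)) \<Longrightarrow> (\<exists>C. \<forall>\<omega>\<in>space M. \<bar>Y \<omega>\<bar> \<le> C) \<Longrightarrow>
       expectation (\<lambda>\<omega>. Y \<omega> * ?A \<omega>) = 0" "\<sigma> 0 \<le> \<sigma> m"
      using Suc.IH Suc.prems le by auto
    show ?case
    proof (cases "\<sigma> m = \<sigma> (Suc m)")
      case True
      then show ?thesis using IH by simp
    next
      case False
      then have lt: "\<sigma> m < \<sigma> (Suc m)" using le by simp
      have cm: "c m \<in> borel_measurable (F (\<sigma> m))" using Suc.prems(4) lt by simp
      obtain C where C: "\<And>\<omega>. \<omega> \<in> space M \<Longrightarrow> \<bar>c m \<omega>\<bar> \<le> C" using Suc.prems(5)[of m] by auto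
      have in0: "\<sigma> m \<in> {0..T}" "\<sigma> (Suc m) \<in> {0..T}" using IH le by auto
      have cM[measurable]: "c m \<in> borel_measurable M" using measurable_F[OF cm in0(1)] .
      have AM[measurable]: "?A \<in> borel_measurable M" using measurable_F[OF IH(2) in0(1)] .
      have DM[measurable]: "?D \<in> borel_measurable M" by (rule increment_measurable[OF W in0])
      have C2: "\<bar>(c m \<omega>)\<^sup>2\<bar> \<le> C\<^sup>2" if "\<omega> \<in> space M" for \<omega>
        using C[OF that] by (simp add: abs_le_square_iff[symmetric])
      have c2: "integrable M (\<lambda>\<omega>. (c m \<omega>)\<^sup>2)"
        by (rule integrable_bounded[OF _ C2]) measurable
      have A1: "integrable M ?A" using integrable_L2_imp_L1[OF IH(3) AM] .
      have cA: "integrable M (\<lambda>\<omega>. c m \<omega> * ?A \<omega>)"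
        using integrable_mult_bounded[OF A1 cM C] .
      have m_cA: "(\<lambda>\<omega>. c m \<omega> * ?A \<omega>) \<in> borel_measurable (F (\<sigma> m))" "(\<lambda>\<omega>. (c m \<omega>)\<^sup>2) \<in> borel_measurable (F (\<sigma> m))"
        using cm IH(2) by measurable
      note E1 = expectation_mult_increment[OF W IH(1) le m_cA(1) cA]
      note E2 = expectation_mult_increment[OF W IH(1) le m_cA(2) c2]
      \<comment> \<open>The cross term is an \<open>F (\<sigma> m)\<close>-measurable factor times
        the new increment and has mean zero; in the last term the squared increment contributes its
        variance.\<close>
      have eq: "(?A \<omega> + c m \<omega> * ?D \<omega>)\<^sup>2 = (?A \<omega>)\<^sup>2 + 2 * ((c m \<omega> * ?A \<omega>) * ?D \<omega>) + (c m \<omega>)\<^sup>2 * (?D \<omega>)\<^sup>2" for \<omega>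
        by (simp add: power2_sum power_mult_distrib)
      have meas: "(\<lambda>\<omega>. ?A \<omega> + c m \<omega> * ?D \<omega>) \<in> borel_measurable (F (\<sigma> (Suc m)))"
        using measurable_F_mono[OF IH(2) le(1)] measurable_F_mono[OF cm le(1)]
          measurable_F_mono[OF brownian_measurable[OF W in0(1)] le(1)] brownian_measurable[OF W in0(2)]
        by (intro borel_measurable_add borel_measurable_times borel_measurable_diff)
      have int: "integrable M (\<lambda>\<omega>. (?A \<omega> + c m \<omega> * ?D \<omega>)\<^sup>2)"
        unfolding eq using IH(3) E1(1) E2(3) by (intro Bochner_Integration.integrable_add integrable_mult_right)
      have ex: "expectation (\<lambda>\<omega>. (?A \<omega> + c m \<omega> * ?D \<omega>)\<^sup>2)
          = expectation (\<lambda>\<omega>. (?A \<omega>)\<^sup>2) + expectation (\<lambda>\<omega>. (c m \<omega>)\<^sup>2) * (\<sigma> (Suc m) - \<sigma> m)"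
        unfolding eq using IH(3) E1(1,2) E2(3,4) by simp
      have Y: "expectation (\<lambda>\<omega>. Y \<omega> * (?A \<omega> + c m \<omega> * ?D \<omega>)) = 0"
        if Ym: "Y \<in> borel_measurable (F (\<sigma> 0))" and Yb: "\<exists>C. \<forall>\<omega>\<in>space M. \<bar>Y \<omega>\<bar> \<le> C" for Y
      proof -
        obtain K where K: "\<And>\<omega>. \<omega> \<in> space M \<Longrightarrow> \<bar>Y \<omega>\<bar> \<le> K" using Yb by auto
        have Ym': "Y \<in> borel_measurable (F (\<sigma> m))" using measurable_F_mono[OF Ym IH(6)] .
        have YM[measurable]: "Y \<in> borel_measurable M" using measurable_F[OF Ym' in0(1)] .
        have m_Yc: "(\<lambda>\<omega>. Y \<omega> * c m \<omega>) \<in> borel_measurable (F (\<sigma> m))" using Ym' cm by measurable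
        have "integrable M (c m)" by (rule integrable_bounded[OF cM C])
        then have Yc: "integrable M (\<lambda>\<omega>. Y \<omega> * c m \<omega>)"
          using integrable_mult_bounded[OF _ YM K] by blast
        note E3 = expectation_mult_increment[OF W IH(1) le m_Yc Yc]
        have "integrable M (\<lambda>\<omega>. Y \<omega> * ?A \<omega>)" using integrable_mult_bounded[OF A1 YM K] .
        then show ?thesis using E3(1,2) IH(5)[OF Ym Yb]
          by (simp add: distrib_left mult.assoc)
      qed
      show ?thesis using meas int ex Y IH lt by auto
    qed
  qed
  then show "A \<in> borel_measurable (F (\<sigma> m))" "integrable M (\<lambda>\<omega>. (A \<omega>)\<^sup>2)"
    "expectation (\<lambda>\<omega>. (A \<omega>)\<^sup>2) = (\<Sum>k<m. expectation (\<lambda>\<omega>. (c k \<omega>)\<^sup>2) * (\<sigma> (Suc k) - \<sigma> k))"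
    "\<And>Y. Y \<in> borel_measurable (F (\<sigma> 0)) \<Longrightarrow> (\<exists>C. \<forall>\<omega>\<in>space M. \<bar>Y \<omega>\<bar> \<le> C) \<Longrightarrow>
       expectation (\<lambda>\<omega>. Y \<omega> * A \<omega>) = 0" by auto
qed

end

section \<open>Convergence to zero in probability\<close>

context prob_space
begin

text \<open>Real-valued and signed, unlike \<open>tendsto_zero_in_probability\<close>, so that such
  sequences can be added and subtracted.\<close>

definition tends0_prob :: "(nat \<Rightarrow> 'a \<Rightarrow> real) \<Rightarrow> bool" where
  "tends0_prob U \<longleftrightarrow> (\<forall>k. U k \<in> borel_measurable M) \<and>
     (\<forall>\<epsilon>>0. (\<lambda>k. prob {\<omega>\<in>space M. \<bar>U k \<omega>\<bar> > \<epsilon>}) \<longlonglongrightarrow> 0)"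

lemma tends0_probD:
  assumes "tends0_prob U"
  shows "U k \<in> borel_measurable M" "0 < \<epsilon> \<Longrightarrow> (\<lambda>k. prob {\<omega>\<in>space M. \<bar>U k \<omega>\<bar> > \<epsilon>}) \<longlonglongrightarrow> 0"
  using assms by (auto simp: tends0_prob_def)

lemma tends0_prob_add:
  assumes U: "tends0_prob U" and V: "tends0_prob V"
  shows "tends0_prob (\<lambda>k \<omega>. U k \<omega> + V k \<omega>)"
  unfolding tends0_prob_def
proof (intro conjI allI impI)
  note [measurable] = tends0_probD(1)[OF U] tends0_probD(1)[OF V]
  show "(\<lambda>\<omega>. U k \<omega> + V k \<omega>) \<in> borel_measurable M" for k by measurable
  fix \<epsilon> :: real assume e: "0 < \<epsilon>"
  have le: "prob {\<omega>\<in>space M. \<bar>U k \<omega> + V k \<omega>\<bar> > \<epsilon>}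
      \<le> prob {\<omega>\<in>space M. \<bar>U k \<omega>\<bar> > \<epsilon>/2} + prob {\<omega>\<in>space M. \<bar>V k \<omega>\<bar> > \<epsilon>/2}" for k
  proof -
    have "prob {\<omega>\<in>space M. \<bar>U k \<omega> + V k \<omega>\<bar> > \<epsilon>}
      \<le> prob ({\<omega>\<in>space M. \<bar>U k \<omega>\<bar> > \<epsilon>/2} \<union> {\<omega>\<in>space M. \<bar>V k \<omega>\<bar> > \<epsilon>/2})"
      by (intro finite_measure_mono) (auto simp: abs_if split: if_splits)
    also have "\<dots> \<le> prob {\<omega>\<in>space M. \<bar>U k \<omega>\<bar> > \<epsilon>/2} + prob {\<omega>\<in>space M. \<bar>V k \<omega>\<bar> > \<epsilon>/2}"
      by (rule measure_Un_le) auto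
    finally show ?thesis .
  qed
  have "(\<lambda>k. prob {\<omega>\<in>space M. \<bar>U k \<omega>\<bar> > \<epsilon>/2} + prob {\<omega>\<in>space M. \<bar>V k \<omega>\<bar> > \<epsilon>/2}) \<longlonglongrightarrow> 0"
    using tendsto_add[OF tends0_probD(2)[OF U] tends0_probD(2)[OF V], of "\<epsilon>/2" "\<epsilon>/2"] e by simp
  then show "(\<lambda>k. prob {\<omega>\<in>space M. \<bar>U k \<omega> + V k \<omega>\<bar> > \<epsilon>}) \<longlonglongrightarrow> 0"
    by (rule Lim_null_comparison[rotated]) (use le in auto)
qed

lemma tends0_prob_minus: "tends0_prob U \<Longrightarrow> tends0_prob (\<lambda>k \<omega>. - U k \<omega>)"
  by (simp add: tends0_prob_def)

lemma tends0_prob_diff: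
  "tends0_prob U \<Longrightarrow> tends0_prob V \<Longrightarrow> tends0_prob (\<lambda>k \<omega>. U k \<omega> - V k \<omega>)"
  using tends0_prob_add[OF _ tends0_prob_minus, of U V] by simp

text \<open>Choosing \<open>r j\<close> so that the event of size above 2^-j has probability at most
  2^-j makes these probabilities summable, and Borel-Cantelli applies. The indices are not arranged
  to increase; \<open>j \<le> r j\<close> already sends them to infinity.\<close>

lemma tends0_prob_AE_subseq:
  assumes U: "tends0_prob U"
  shows "\<exists>r. (\<forall>j. j \<le> r j) \<and> (AE \<omega> in M. (\<lambda>j. U (r j) \<omega>) \<longlonglongrightarrow> 0)"
proof -
  note [measurable] = tends0_probD(1)[OF U]
  have "\<exists>k\<ge>j. prob {\<omega>\<in>space M. \<bar>U k \<omega>\<bar> > (1/2)^j} \<le> (1/2)^j" for j :: nat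
  proof -
    have "eventually (\<lambda>k. prob {\<omega>\<in>space M. \<bar>U k \<omega>\<bar> > (1/2)^j} < (1/2)^j) sequentially"
      by (rule order_tendstoD(2)[OF tends0_probD(2)[OF U]]) auto
    with eventually_ge_at_top[of j] have "eventually (\<lambda>k. k \<ge> j \<and> prob {\<omega>\<in>space M. \<bar>U k \<omega>\<bar> > (1/2)^j} < (1/2)^j) sequentially"
      by eventually_elim auto
    from eventually_happens'[OF sequentially_bot this] show ?thesis by (auto intro: less_imp_le)
  qed
  then obtain r where r: "\<And>j. j \<le> r j" "\<And>j. prob {\<omega>\<in>space M. \<bar>U (r j) \<omega>\<bar> > (1/2)^j} \<le> (1/2)^j"
    by metis
  let ?A = "\<lambda>j. {\<omega>\<in>space M. \<bar>U (r j) \<omega>\<bar> > (1/2)^j}"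
  have "AE \<omega> in M. eventually (\<lambda>j. \<omega> \<in> space M - ?A j) sequentially"
  proof (rule borel_cantelli_AE1)
    show "summable (\<lambda>j. prob (?A j))"
      by (rule summable_comparison_test'[OF summable_geometric, of "1/2" 0]) (use r in auto)
  qed (auto simp: less_top[symmetric])
  then have "AE \<omega> in M. (\<lambda>j. U (r j) \<omega>) \<longlonglongrightarrow> 0"
  proof eventually_elim
    case (elim \<omega>)
    then have "eventually (\<lambda>j. norm (U (r j) \<omega>) \<le> (1/2)^j) sequentially"
      by eventually_elim auto
    then show ?case
      by (rule Lim_null_comparison) (auto intro: LIMSEQ_realpow_zero)
  qed
  with r show ?thesis by auto
qed

text \<open>Fatou along an almost surely convergent subsequence: second-moment bounds survive limits
  in probability. The error \<open>e k\<close> leaves room for bounds that hold only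
  asymptotically.\<close>

lemma nn_integral_square_le_tends0_prob:
  assumes G[measurable]: "G \<in> borel_measurable M" and U: "tends0_prob (\<lambda>k \<omega>. S k \<omega> - G \<omega>)"
    and S[measurable]: "\<And>k. S k \<in> borel_measurable M"
    and le: "\<And>k. (\<integral>\<^sup>+\<omega>. ennreal ((S k \<omega>)\<^sup>2) \<partial>M) \<le> B + e k" and e: "e \<longlonglongrightarrow> 0"
  shows "(\<integral>\<^sup>+\<omega>. ennreal ((G \<omega>)\<^sup>2) \<partial>M) \<le> B"
proof -
  obtain r where r: "\<And>j. j \<le> r j" "AE \<omega> in M. (\<lambda>j. S (r j) \<omega> - G \<omega>) \<longlonglongrightarrow> 0"
    using tends0_prob_AE_subseq[OF U] by auto
  have rt: "filterlim r at_top sequentially"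
    by (rule filterlim_at_top_mono[OF filterlim_ident]) (simp add: r(1))
  have "(\<integral>\<^sup>+\<omega>. ennreal ((G \<omega>)\<^sup>2) \<partial>M) = (\<integral>\<^sup>+\<omega>. liminf (\<lambda>j. ennreal ((S (r j) \<omega>)\<^sup>2)) \<partial>M)"
  proof (rule nn_integral_cong_AE)
    show "AE \<omega> in M. ennreal ((G \<omega>)\<^sup>2) = liminf (\<lambda>j. ennreal ((S (r j) \<omega>)\<^sup>2))"
      using r(2)
    proof eventually_elim
      case (elim \<omega>)
      then have "(\<lambda>j. S (r j) \<omega>) \<longlonglongrightarrow> G \<omega>" by (rule LIM_zero_cancel)
      then have "(\<lambda>j. ennreal ((S (r j) \<omega>)\<^sup>2)) \<longlonglongrightarrow> ennreal ((G \<omega>)\<^sup>2)"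
        by (intro tendsto_ennrealI tendsto_power)
      then show ?case by (metis lim_imp_Liminf sequentially_bot)
    qed
  qed
  also have "\<dots> \<le> liminf (\<lambda>j. \<integral>\<^sup>+\<omega>. ennreal ((S (r j) \<omega>)\<^sup>2) \<partial>M)"
    by (rule nn_integral_liminf) measurable
  also have "\<dots> \<le> liminf (\<lambda>j. B + e (r j))"
    by (intro Liminf_mono always_eventually allI le)
  also have "\<dots> = B"
  proof -
    have "(\<lambda>j. e (r j)) \<longlonglongrightarrow> 0" using filterlim_compose[OF e rt] .
    then have "(\<lambda>j. B + e (r j)) \<longlonglongrightarrow> B + 0" by (intro tendsto_add tendsto_const)
    then show ?thesis by (metis lim_imp_Liminf sequentially_bot add_0_right)
  qed
  finally show ?thesis .
qed

text \<open>Bounded second moments give uniform integrability, which upgrades convergence in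
  probability to convergence in L1.\<close>

lemma tends0_prob_imp_L1:
  assumes U: "tends0_prob U" and int: "\<And>k. integrable M (\<lambda>\<omega>. (U k \<omega>)\<^sup>2)"
    and le: "\<And>k. expectation (\<lambda>\<omega>. (U k \<omega>)\<^sup>2) \<le> B"
  shows "(\<lambda>k. expectation (\<lambda>\<omega>. \<bar>U k \<omega>\<bar>)) \<longlonglongrightarrow> 0"
proof (rule LIMSEQ_I)
  note [measurable] = tends0_probD(1)[OF U]
  have B: "0 \<le> B" by (rule order.trans[OF _ le[of 0]]) (simp add: integral_nonneg_AE)
  fix \<epsilon> :: real assume e: "0 < \<epsilon>"
  \<comment> \<open>With this weight the square term below costs at most \<open>\<eta> * B\<close>,
    less than \<epsilon>/2, whatever k is; B + 1 avoids a zero denominator.\<close>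
  define \<eta> where "\<eta> = \<epsilon> / (2 * (B + 1))"
  have \<eta>: "0 < \<eta>" "\<eta> * B < \<epsilon>/2"
    using e B by (auto simp: \<eta>_def field_simps)
  have "eventually (\<lambda>k. prob {\<omega>\<in>space M. \<bar>U k \<omega>\<bar> > \<epsilon>/8} < \<eta> * \<epsilon> / 8) sequentially"
    by (rule order_tendstoD(2)[OF tends0_probD(2)[OF U]]) (use e \<eta> in auto)
  then obtain N where N: "\<And>k. k \<ge> N \<Longrightarrow> prob {\<omega>\<in>space M. \<bar>U k \<omega>\<bar> > \<epsilon>/8} < \<eta> * \<epsilon> / 8"
    by (auto simp: eventually_sequentially)
  have "norm (expectation (\<lambda>\<omega>. \<bar>U k \<omega>\<bar>) - 0) < \<epsilon>" if k: "k \<ge> N" for k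
  proof -
    let ?A = "{\<omega>\<in>space M. \<bar>U k \<omega>\<bar> > \<epsilon>/8}"
    \<comment> \<open>Off the event A the bound is immediate. On A, expanding the square of sqrt
      \<eta> |U| - 1 / sqrt \<eta> gives |U| \<le> \<eta> U^2 + 1/\<eta>; the large constant
      1/\<eta> is then paid for by the small probability of A.\<close>
    have pw: "\<bar>U k \<omega>\<bar> \<le> \<epsilon>/8 + (\<eta> * (U k \<omega>)\<^sup>2 + indicator ?A \<omega> / \<eta>)" if "\<omega> \<in> space M" for \<omega>
    proof (cases "\<omega> \<in> ?A")
      case True
      have "0 \<le> (sqrt \<eta> * \<bar>U k \<omega>\<bar> - 1 / sqrt \<eta>)\<^sup>2" by simp
      also have "\<dots> = \<eta> * (U k \<omega>)\<^sup>2 + 1/\<eta> - 2 * \<bar>U k \<omega>\<bar>"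
        using \<eta>(1) by (simp add: power2_diff power_mult_distrib power_divide)
      finally have "\<bar>U k \<omega>\<bar> \<le> \<eta> * (U k \<omega>)\<^sup>2 + 1/\<eta>" by linarith
      then show ?thesis using True e by simp
    next
      case False
      then have "\<bar>U k \<omega>\<bar> \<le> \<epsilon>/8" using that by auto
      moreover have "0 \<le> \<eta> * (U k \<omega>)\<^sup>2" using \<eta> by simp
      ultimately show ?thesis using False by (auto simp: indicator_def)
    qed
    have i1: "integrable M (\<lambda>\<omega>. \<eta> * (U k \<omega>)\<^sup>2)" using int[of k] by simp
    have iA: "integrable M (\<lambda>\<omega>. indicator ?A \<omega> / \<eta> :: real)"
      by (intro integrable_const_bound[of _ "1/\<eta>"]) (use \<eta> in \<open>auto intro!: AE_I2 simp: indicator_def\<close>)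
    have "expectation (\<lambda>\<omega>. \<bar>U k \<omega>\<bar>) \<le> expectation (\<lambda>\<omega>. \<epsilon>/8 + (\<eta> * (U k \<omega>)\<^sup>2 + indicator ?A \<omega> / \<eta>))"
    proof (rule integral_mono_AE')
      show "integrable M (\<lambda>\<omega>. \<epsilon>/8 + (\<eta> * (U k \<omega>)\<^sup>2 + indicator ?A \<omega> / \<eta>))"
        using i1 iA by (intro Bochner_Integration.integrable_add) simp_all
      show "AE \<omega> in M. \<bar>U k \<omega>\<bar> \<le> \<epsilon>/8 + (\<eta> * (U k \<omega>)\<^sup>2 + indicator ?A \<omega> / \<eta>)"
        by (intro AE_I2 pw)
      show "AE \<omega> in M. 0 \<le> \<epsilon>/8 + (\<eta> * (U k \<omega>)\<^sup>2 + indicator ?A \<omega> / \<eta>)"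
        by (intro AE_I2 order.trans[OF abs_ge_zero pw])
    qed
    also have "\<dots> = \<epsilon>/8 + (\<eta> * expectation (\<lambda>\<omega>. (U k \<omega>)\<^sup>2) + prob ?A / \<eta>)"
      using i1 iA by (simp add: prob_space)
    also have "\<dots> < \<epsilon>"
    proof -
      have "prob ?A / \<eta> < \<epsilon>/8" using N[OF k] \<eta> by (simp add: field_simps)
      moreover have "\<eta> * expectation (\<lambda>\<omega>. (U k \<omega>)\<^sup>2) \<le> \<eta> * B" using le \<eta> by simp
      ultimately show ?thesis using \<eta>(2) e by linarith
    qed
    finally show ?thesis by (simp add: integral_nonneg_AE)
  qed
  then show "\<exists>N. \<forall>k\<ge>N. norm (expectation (\<lambda>\<omega>. \<bar>U k \<omega>\<bar>) - 0) < \<epsilon>" by blast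
qed

end

section \<open>Simple integrals\<close>

lemma simple_process_mono:
  assumes "simple_process M T F m \<tau> h" "i \<le> j" "j \<le> m"
  shows "\<tau> i \<le> \<tau> j"
  using assms(2,3)
proof (induction j)
  case (Suc j)
  have "\<tau> j < \<tau> (Suc j)" using assms(1) Suc.prems(2) by (auto simp: simple_process_def)
  then show ?case using Suc by (cases "i = Suc j") auto
qed simp

lemma simple_process_range:
  assumes "simple_process M T F m \<tau> h" "i \<le> m"
  shows "0 \<le> \<tau> i" "\<tau> i \<le> T"
  using simple_process_mono[OF assms(1), of 0 i] simple_process_mono[OF assms(1), of i m] assms
  by (auto simp: simple_process_def)

lemma simple_value_eq:
  assumes P: "simple_process M T F m \<tau> h" and k: "k < m" "\<tau> k < t" "t \<le> \<tau> (Suc k)"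
  shows "simple_value m \<tau> g t \<omega> = g k \<omega>"
proof -
  have "simple_value m \<tau> g t \<omega> = (\<Sum>j<m. if j = k then g k \<omega> else 0)"
    unfolding simple_value_def
  proof (rule sum.cong[OF refl])
    fix j assume j: "j \<in> {..<m}"
    show "g j \<omega> * indicator {\<tau> j<..\<tau> (Suc j)} t = (if j = k then g k \<omega> else 0)"
    proof (cases j k rule: linorder_cases)
      case less
      then have "\<tau> (Suc j) \<le> \<tau> k" using simple_process_mono[OF P, of "Suc j" k] k by simp
      then show ?thesis using less k by auto
    next
      case greater
      then have "\<tau> (Suc k) \<le> \<tau> j" using simple_process_mono[OF P, of "Suc k" j] j by simp
      then show ?thesis using greater k by auto
    qed (use k in auto)
  qed
  then show ?thesis using k by simp
qed

lemma simple_process_cover: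
  assumes P: "simple_process M T F m \<tau> h" and t: "0 < t" "t \<le> T"
  shows "\<exists>k<m. \<tau> k < t \<and> t \<le> \<tau> (Suc k)"
proof -
  have *: "t \<le> \<tau> j \<Longrightarrow> j \<le> m \<Longrightarrow> \<exists>k<j. \<tau> k < t \<and> t \<le> \<tau> (Suc k)" for j
  proof (induction j)
    case 0
    then show ?case using P t by (auto simp: simple_process_def)
  next
    case (Suc j)
    then show ?case by (cases "t \<le> \<tau> j") (auto intro: less_SucI)
  qed
  show ?thesis using *[of m] P t by (auto simp: simple_process_def)
qed

lemma simple_value_measurable [measurable]:
  "(\<lambda>t. simple_value m \<tau> h t \<omega>) \<in> borel_measurable borel"
  unfolding simple_value_def by measurable

text \<open>Projection onto [s, r], in three roles: restricting a time grid to a window, truncating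
  coefficients to [-C, C], and extending a process from [0, T] to all real times.\<close>

definition clip :: "real \<Rightarrow> real \<Rightarrow> real \<Rightarrow> real" where
  "clip s r x = max s (min r x)"

lemma clip_interval: "s \<le> r \<Longrightarrow> {clip s r a<..clip s r b} = {s<..r} \<inter> {a<..b}"
  by (auto simp: clip_def max_def min_def split: if_splits)

text \<open>The clipped grid runs from s to r, so the increments of W over it telescope and the
  constant y can be subtracted from each coefficient.\<close>

lemma simple_integral_shift:
  assumes P: "simple_process M T F m \<tau> h" and sr: "0 \<le> s" "s \<le> r" "r \<le> T"
  shows "simple_integral W m \<tau> g r \<omega> - simple_integral W m \<tau> g s \<omega> - y * (W r \<omega> - W s \<omega>)
    = (\<Sum>k<m. (g k \<omega> - y) * (W (clip s r (\<tau> (Suc k))) \<omega> - W (clip s r (\<tau> k)) \<omega>))"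
proof -
  have c: "W (min r x) \<omega> - W (min s x) \<omega> = W (clip s r x) \<omega> - W s \<omega>" for x
    using sr by (auto simp: clip_def max_def min_def)
  have "simple_integral W m \<tau> g r \<omega> - simple_integral W m \<tau> g s \<omega>
      = (\<Sum>k<m. g k \<omega> * (W (clip s r (\<tau> (Suc k))) \<omega> - W (clip s r (\<tau> k)) \<omega>))"
    unfolding simple_integral_def sum_subtractf[symmetric]
  proof (rule sum.cong[OF refl])
    fix k
    show "g k \<omega> * (W (min r (\<tau> (Suc k))) \<omega> - W (min r (\<tau> k)) \<omega>) -
         g k \<omega> * (W (min s (\<tau> (Suc k))) \<omega> - W (min s (\<tau> k)) \<omega>) =
         g k \<omega> * (W (clip s r (\<tau> (Suc k))) \<omega> - W (clip s r (\<tau> k)) \<omega>)"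
      using c[of "\<tau> (Suc k)"] c[of "\<tau> k"] by (simp add: right_diff_distrib[symmetric])
  qed
  moreover have "(\<Sum>k<m. W (clip s r (\<tau> (Suc k))) \<omega> - W (clip s r (\<tau> k)) \<omega>) = W r \<omega> - W s \<omega>"
  proof -
    have "clip s r (\<tau> m) = r" "clip s r (\<tau> 0) = s"
      using P sr by (auto simp: clip_def simple_process_def)
    then show ?thesis using sum_lessThan_telescope[of "\<lambda>k. W (clip s r (\<tau> k)) \<omega>" m] by simp
  qed
  ultimately show ?thesis
    by (simp add: left_diff_distrib sum_subtractf sum_distrib_left[symmetric])
qed

lemma nn_integral_simple_value:
  assumes P: "simple_process M T F m \<tau> h" and sr: "0 \<le> s" "s \<le> r" "r \<le> T"
  shows "(\<integral>\<^sup>+t\<in>{s..r}. ennreal ((simple_value m \<tau> g t \<omega> - y)\<^sup>2) \<partial>lborel)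
    = ennreal (\<Sum>k<m. (g k \<omega> - y)\<^sup>2 * (clip s r (\<tau> (Suc k)) - clip s r (\<tau> k)))"
proof -
  have mono: "clip s r (\<tau> k) \<le> clip s r (\<tau> (Suc k))" if "k < m" for k
    using simple_process_mono[OF P, of k "Suc k"] that by (auto simp: clip_def)
  have "(\<integral>\<^sup>+t\<in>{s..r}. ennreal ((simple_value m \<tau> g t \<omega> - y)\<^sup>2) \<partial>lborel)
    = (\<integral>\<^sup>+t. (\<Sum>k<m. ennreal ((g k \<omega> - y)\<^sup>2) * indicator {clip s r (\<tau> k)<..clip s r (\<tau> (Suc k))} t) \<partial>lborel)"
  proof (rule nn_integral_cong_AE)
    \<comment> \<open>The closed window and the left-open steps of the clipped grid differ only at t
      = s.\<close>
    have "AE t in lborel. t \<noteq> s" by (rule AE_lborel_singleton)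
    then show "AE t in lborel. ennreal ((simple_value m \<tau> g t \<omega> - y)\<^sup>2) * indicator {s..r} t =
       (\<Sum>k<m. ennreal ((g k \<omega> - y)\<^sup>2) * indicator {clip s r (\<tau> k)<..clip s r (\<tau> (Suc k))} t)"
    proof eventually_elim
      case (elim t)
      show ?case
      proof (cases "t \<in> {s<..r}")
        case True
        then obtain k where k: "k < m" "\<tau> k < t" "t \<le> \<tau> (Suc k)"
          using simple_process_cover[OF P, of t] sr by auto
        have "(\<Sum>j<m. ennreal ((g j \<omega> - y)\<^sup>2) * indicator {clip s r (\<tau> j)<..clip s r (\<tau> (Suc j))} t)
          = (\<Sum>j<m. if j = k then ennreal ((g k \<omega> - y)\<^sup>2) else 0)"
        proof (rule sum.cong[OF refl])
          fix j assume j: "j \<in> {..<m}"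
          have "t \<in> {\<tau> j<..\<tau> (Suc j)} \<longleftrightarrow> j = k"
          proof (cases j k rule: linorder_cases)
            case less
            then have "\<tau> (Suc j) \<le> \<tau> k" using simple_process_mono[OF P, of "Suc j" k] k by simp
            then show ?thesis using less k by auto
          next
            case greater
            then have "\<tau> (Suc k) \<le> \<tau> j" using simple_process_mono[OF P, of "Suc k" j] j by simp
            then show ?thesis using greater k by auto
          qed (use k in auto)
          then show "ennreal ((g j \<omega> - y)\<^sup>2) * indicator {clip s r (\<tau> j)<..clip s r (\<tau> (Suc j))} t
            = (if j = k then ennreal ((g k \<omega> - y)\<^sup>2) else 0)"
            using True by (simp add: clip_interval[OF sr(2)] indicator_def)
        qed
        then show ?thesis using simple_value_eq[OF P k, of g \<omega>] k True by simp
      next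
        case False
        then have "t \<notin> {s..r}" using elim by auto
        moreover have "t \<notin> {clip s r (\<tau> k)<..clip s r (\<tau> (Suc k))}" for k
          using False unfolding clip_interval[OF sr(2)] by blast
        ultimately show ?thesis by simp
      qed
    qed
  qed
  also have "\<dots> = (\<Sum>k<m. ennreal ((g k \<omega> - y)\<^sup>2) * ennreal (clip s r (\<tau> (Suc k)) - clip s r (\<tau> k)))"
    by (subst nn_integral_sum) (auto intro!: sum.cong simp: nn_integral_cmult_indicator mono)
  also have "\<dots> = ennreal (\<Sum>k<m. (g k \<omega> - y)\<^sup>2 * (clip s r (\<tau> (Suc k)) - clip s r (\<tau> k)))"
    by (subst sum_ennreal[symmetric]) (auto intro!: sum.cong simp: ennreal_mult mono)
  finally show ?thesis .
qed

context filtered_prob_space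
begin

text \<open>Y is known at s, so subtracting Y times the increment of W leaves a martingale transform
  on the grid clipped to [s, r]. This is how a stochastic integral is compared with its integrand
  frozen at the left end point.\<close>

lemma simple_integral_isometry:
  assumes W: "brownian_motion M T F W" and P: "simple_process M T F m \<tau> h"
    and sr: "0 \<le> s" "s \<le> r" "r \<le> T"
    and Y: "Y \<in> borel_measurable (F s)" "\<exists>C. \<forall>\<omega>\<in>space M. \<bar>Y \<omega>\<bar> \<le> C"
  defines "S \<equiv> simple_integral W m \<tau> h"
  defines "A \<equiv> \<lambda>\<omega>. S r \<omega> - S s \<omega> - Y \<omega> * (W r \<omega> - W s \<omega>)"
  shows "A \<in> borel_measurable (F r)" "integrable M (\<lambda>\<omega>. (A \<omega>)\<^sup>2)"
    "(\<integral>\<^sup>+\<omega>. ennreal ((A \<omega>)\<^sup>2) \<partial>M)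
      = (\<integral>\<^sup>+\<omega>. (\<integral>\<^sup>+t\<in>{s..r}. ennreal ((simple_value m \<tau> h t \<omega> - Y \<omega>)\<^sup>2) \<partial>lborel) \<partial>M)"
    "\<And>X. X \<in> borel_measurable (F s) \<Longrightarrow> (\<exists>C. \<forall>\<omega>\<in>space M. \<bar>X \<omega>\<bar> \<le> C) \<Longrightarrow>
       expectation (\<lambda>\<omega>. X \<omega> * A \<omega>) = 0"
proof -
  define \<sigma> where "\<sigma> k = clip s r (\<tau> k)" for k
  define c where "c k \<omega> = h k \<omega> - Y \<omega>" for k \<omega>
  have A: "A = (\<lambda>\<omega>. \<Sum>k<m. c k \<omega> * (W (\<sigma> (Suc k)) \<omega> - W (\<sigma> k) \<omega>))"
    unfolding A_def S_def \<sigma>_def c_def using simple_integral_shift[OF P sr, of W h] by auto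
  have \<sigma>0: "\<sigma> 0 = s" and \<sigma>m: "\<sigma> m = r" using P sr by (auto simp: \<sigma>_def clip_def simple_process_def)
  have mono: "\<sigma> k \<le> \<sigma> (Suc k)" if "k < m" for k
    using simple_process_mono[OF P, of k "Suc k"] that by (auto simp: clip_def \<sigma>_def)
  have cb: "\<exists>C. \<forall>\<omega>\<in>space M. \<bar>c k \<omega>\<bar> \<le> C" if k: "k < m" for k
  proof -
    obtain C D where "\<forall>\<omega>\<in>space M. \<bar>h k \<omega>\<bar> \<le> C" "\<forall>\<omega>\<in>space M. \<bar>Y \<omega>\<bar> \<le> D"
      using P Y(2) k by (auto simp: simple_process_def)
    then have "\<forall>\<omega>\<in>space M. \<bar>c k \<omega>\<bar> \<le> C + D" unfolding c_def by (auto intro: order.trans[OF abs_triangle_ineq4] add_mono)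
    then show ?thesis by blast
  qed
  \<comment> \<open>A clipped step that is nondegenerate starts before r, so its start is the
    maximum of s and \<open>\<tau> k\<close>; there both \<open>h k\<close> and Y are known.\<close>
  have cm: "c k \<in> borel_measurable (F (\<sigma> k))" if k: "k < m" "\<sigma> k < \<sigma> (Suc k)" for k
  proof -
    have "\<tau> k \<le> \<sigma> k" "s \<le> \<sigma> k" using k sr
      by (auto simp: \<sigma>_def clip_def max_def min_def split: if_splits)
    then show ?thesis unfolding c_def
      using P k Y(1) by (intro borel_measurable_diff) (auto simp: simple_process_def intro: measurable_F_mono)
  qed
  have cM: "c k \<in> borel_measurable M" if k: "k < m" for k
  proof -
    have "h k \<in> borel_measurable M" using P k simple_process_range[OF P, of k]
      by (auto simp: simple_process_def intro!: measurable_F[of _ "\<tau> k"])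
    moreover have "Y \<in> borel_measurable M" using measurable_F[OF Y(1)] sr by auto
    ultimately show ?thesis unfolding c_def by measurable
  qed
  note mt = martingale_transform[OF W, of \<sigma> m c]
  have "0 \<le> \<sigma> 0" "\<sigma> m \<le> T" using \<sigma>0 \<sigma>m sr by auto
  note mt = mt[OF this(1) mono this(2) cm cb]
  show "A \<in> borel_measurable (F r)" "integrable M (\<lambda>\<omega>. (A \<omega>)\<^sup>2)"
    "\<And>X. X \<in> borel_measurable (F s) \<Longrightarrow> (\<exists>C. \<forall>\<omega>\<in>space M. \<bar>X \<omega>\<bar> \<le> C) \<Longrightarrow>
       expectation (\<lambda>\<omega>. X \<omega> * A \<omega>) = 0"
    using mt(1,2,4) unfolding \<sigma>0 \<sigma>m A by auto
  have ci: "integrable M (\<lambda>\<omega>. (c k \<omega>)\<^sup>2)" if k: "k < m" for k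
  proof -
    obtain C where C: "\<And>\<omega>. \<omega> \<in> space M \<Longrightarrow> \<bar>c k \<omega>\<bar> \<le> C" using cb[OF k] by auto
    have "\<bar>(c k \<omega>)\<^sup>2\<bar> \<le> C\<^sup>2" if "\<omega> \<in> space M" for \<omega>
      using C[OF that] by (simp add: abs_le_square_iff[symmetric])
    then show ?thesis using cM[OF k] by (intro integrable_bounded[of _ "C\<^sup>2"]) auto
  qed
  have "(\<integral>\<^sup>+\<omega>. ennreal ((A \<omega>)\<^sup>2) \<partial>M) = ennreal (expectation (\<lambda>\<omega>. (A \<omega>)\<^sup>2))"
    using mt(2) unfolding A by (intro nn_integral_eq_integral) auto
  also have "\<dots> = ennreal (expectation (\<lambda>\<omega>. \<Sum>k<m. (c k \<omega>)\<^sup>2 * (\<sigma> (Suc k) - \<sigma> k)))"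
    using ci unfolding A by (simp add: mt(3))
  also have "\<dots> = (\<integral>\<^sup>+\<omega>. ennreal (\<Sum>k<m. (c k \<omega>)\<^sup>2 * (\<sigma> (Suc k) - \<sigma> k)) \<partial>M)"
    using ci mono by (intro nn_integral_eq_integral[symmetric]) (auto intro!: AE_I2 sum_nonneg)
  also have "\<dots> = (\<integral>\<^sup>+\<omega>. (\<integral>\<^sup>+t\<in>{s..r}. ennreal ((simple_value m \<tau> h t \<omega> - Y \<omega>)\<^sup>2) \<partial>lborel) \<partial>M)"
    unfolding c_def \<sigma>_def by (simp add: nn_integral_simple_value[OF P sr])
  finally show "(\<integral>\<^sup>+\<omega>. ennreal ((A \<omega>)\<^sup>2) \<partial>M)
      = (\<integral>\<^sup>+\<omega>. (\<integral>\<^sup>+t\<in>{s..r}. ennreal ((simple_value m \<tau> h t \<omega> - Y \<omega>)\<^sup>2) \<partial>lborel) \<partial>M)" .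
qed

end

lemma square_diff_le: "(x - z)\<^sup>2 \<le> 2 * (x - y)\<^sup>2 + 2 * (y - z)\<^sup>2" for x y z :: real
proof -
  have "0 \<le> ((x - y) - (y - z))\<^sup>2" by simp
  then show ?thesis by (simp add: power2_eq_square algebra_simps)
qed

section \<open>Ito integrals of bounded processes\<close>

context filtered_prob_space
begin

lemma simple_integral_measurable:
  assumes W: "brownian_motion M T F W" and P: "simple_process M T F m \<tau> h" and t: "t \<in> {0..T}"
  shows "simple_integral W m \<tau> h t \<in> borel_measurable M"
proof -
  have "h k \<in> borel_measurable M" if "k < m" for k
    using P that simple_process_range[OF P, of k]
    by (auto simp: simple_process_def intro!: measurable_F[of _ "\<tau> k"])
  moreover have "W (min t (\<tau> k)) \<in> borel_measurable M" if "k \<le> m" for k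
    using brownian_measurable[OF W, of "min t (\<tau> k)"] simple_process_range[OF P that] t
    by (intro measurable_F[of _ "min t (\<tau> k)"]) auto
  ultimately show ?thesis
    unfolding simple_integral_def by (intro borel_measurable_sum borel_measurable_times borel_measurable_diff) auto
qed

lemma simple_integral_0:
  assumes "simple_process M T F m \<tau> h" shows "simple_integral W m \<tau> g 0 \<omega> = 0"
proof -
  have "min 0 (\<tau> k) = 0" if "k \<le> m" for k using simple_process_range[OF assms that] by auto
  then show ?thesis unfolding simple_integral_def by simp
qed

text \<open>Lenglart's inequality for simple integrands: switch the integrand off before its
  quadratic integral exceeds \<delta>, apply the isometry and Markov's inequality to the stopped
  integral, and charge the first term on the right with the event that something was switched
  off.\<close>

lemma prob_simple_integral_le:
  assumes W: "brownian_motion M T F W" and P: "simple_process M T F m \<tau> g" and t: "t \<in> {0..T}"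
    and \<delta>: "0 \<le> \<delta>" and \<epsilon>: "0 < \<epsilon>"
  shows "prob {\<omega>\<in>space M. \<bar>simple_integral W m \<tau> g t \<omega>\<bar> > \<epsilon>}
    \<le> prob {\<omega>\<in>space M. (\<integral>\<^sup>+t\<in>{0..T}. ennreal ((simple_value m \<tau> g t \<omega>)\<^sup>2) \<partial>lborel) > ennreal \<delta>} + \<delta> / \<epsilon>\<^sup>2"
proof -
  define Q where "Q k \<omega> = (\<Sum>j<k. (g j \<omega>)\<^sup>2 * (\<tau> (Suc j) - \<tau> j))" for k \<omega>
  \<comment> \<open>The test uses \<open>Q (Suc k)\<close>, so the step about to be made is already
    counted; this keeps the stopped sum below \<delta> without overshoot. It is still known at
    \<open>\<tau> k\<close>, as it involves only \<open>g 0\<close> up to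
    \<open>g k\<close>.\<close>
  define g' where "g' k \<omega> = (if Q (Suc k) \<omega> \<le> \<delta> then g k \<omega> else 0)" for k \<omega>
  have lt: "\<tau> k < \<tau> (Suc k)" if "k < m" for k using P that by (auto simp: simple_process_def)
  have gm: "g j \<in> borel_measurable (F (\<tau> k))" if "j \<le> k" "k < m" for j k
    using P that simple_process_mono[OF P, of j k]
    by (auto simp: simple_process_def intro!: measurable_F_mono[of "g j" "\<tau> j" _ "\<tau> k"])
  have Qm: "Q (Suc k) \<in> borel_measurable (F (\<tau> k))" if "k < m" for k
    unfolding Q_def using gm that by (intro borel_measurable_sum borel_measurable_times borel_measurable_power) auto
  have P': "simple_process M T F m \<tau> g'"
  proof -
    have "g' k \<in> borel_measurable (F (\<tau> k))" if "k < m" for k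
      unfolding g'_def using Qm[OF that] gm[OF _ that, of k] by measurable
    moreover have "\<exists>C. \<forall>\<omega>\<in>space M. \<bar>g' k \<omega>\<bar> \<le> C" if k: "k < m" for k
    proof -
      obtain C where C: "\<forall>\<omega>\<in>space M. \<bar>g k \<omega>\<bar> \<le> C" using P k by (auto simp: simple_process_def)
      show ?thesis
        by (rule exI[of _ "\<bar>C\<bar>"]) (use C in \<open>force simp: g'_def\<close>)
    qed
    ultimately show ?thesis using P by (auto simp: simple_process_def)
  qed
  have Qmono: "Q j \<omega> \<le> Q k \<omega>" if "j \<le> k" "k \<le> m" for j k \<omega>
    unfolding Q_def by (rule sum_mono2) (use that in \<open>auto intro!: mult_nonneg_nonneg less_imp_le[OF lt]\<close>)
  have Q': "(\<Sum>j<k. (g' j \<omega>)\<^sup>2 * (\<tau> (Suc j) - \<tau> j)) \<le> \<delta>" if "k \<le> m" for k \<omega>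
    using that
  proof (induction k)
    case (Suc k)
    show ?case
    proof (cases "Q (Suc k) \<omega> \<le> \<delta>")
      case True
      have "g' j \<omega> = g j \<omega>" if "j < Suc k" for j
        using Qmono[of "Suc j" "Suc k" \<omega>] that Suc.prems True by (auto simp: g'_def)
      then have "(\<Sum>j<Suc k. (g' j \<omega>)\<^sup>2 * (\<tau> (Suc j) - \<tau> j)) = Q (Suc k) \<omega>"
        unfolding Q_def by (intro sum.cong) auto
      then show ?thesis using True by simp
    next
      case False
      then show ?thesis using Suc by (simp add: g'_def)
    qed
  qed (use \<delta> in simp)
  have clipT: "clip 0 T (\<tau> k) = \<tau> k" if "k \<le> m" for k
    using simple_process_range[OF P that] by (auto simp: clip_def)
  have int_sq: "(\<integral>\<^sup>+t\<in>{0..T}. ennreal ((simple_value m \<tau> f t \<omega>)\<^sup>2) \<partial>lborel)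
      = ennreal (\<Sum>j<m. (f j \<omega>)\<^sup>2 * (\<tau> (Suc j) - \<tau> j))" for f :: "nat \<Rightarrow> 'w \<Rightarrow> real" and \<omega>
    using nn_integral_simple_value[OF P, of 0 T f \<omega> 0] T_pos clipT
    by (auto intro!: arg_cong[where f=ennreal] sum.cong)
  let ?S = "simple_integral W m \<tau> g t" and ?S' = "simple_integral W m \<tau> g' t"
  have t': "0 \<le> t" "t \<le> T" using t by auto
  have [measurable]: "?S \<in> borel_measurable M" "?S' \<in> borel_measurable M"
    using simple_integral_measurable[OF W P t] simple_integral_measurable[OF W P' t] .
  have iso: "integrable M (\<lambda>\<omega>. (?S' \<omega>)\<^sup>2)"
    "(\<integral>\<^sup>+\<omega>. ennreal ((?S' \<omega>)\<^sup>2) \<partial>M)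
      = (\<integral>\<^sup>+\<omega>. (\<integral>\<^sup>+u\<in>{0..t}. ennreal ((simple_value m \<tau> g' u \<omega>)\<^sup>2) \<partial>lborel) \<partial>M)"
    using simple_integral_isometry(2,3)[OF W P' order.refl t', of "\<lambda>_. 0"]
    by (auto simp: simple_integral_0[OF P'])
  have "(\<integral>\<^sup>+\<omega>. ennreal ((?S' \<omega>)\<^sup>2) \<partial>M) \<le> (\<integral>\<^sup>+\<omega>. ennreal \<delta> \<partial>M)"
    unfolding iso(2)
  proof (rule nn_integral_mono)
    fix \<omega>
    have "(\<integral>\<^sup>+u\<in>{0..t}. ennreal ((simple_value m \<tau> g' u \<omega>)\<^sup>2) \<partial>lborel)
      \<le> (\<integral>\<^sup>+u\<in>{0..T}. ennreal ((simple_value m \<tau> g' u \<omega>)\<^sup>2) \<partial>lborel)"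
      by (rule nn_integral_mono) (use t' in \<open>auto simp: indicator_def\<close>)
    also have "\<dots> \<le> ennreal \<delta>" unfolding int_sq using Q'[of m \<omega>] by (intro ennreal_leI) simp
    finally show "(\<integral>\<^sup>+u\<in>{0..t}. ennreal ((simple_value m \<tau> g' u \<omega>)\<^sup>2) \<partial>lborel) \<le> ennreal \<delta>" .
  qed
  then have E: "expectation (\<lambda>\<omega>. (?S' \<omega>)\<^sup>2) \<le> \<delta>"
    using iso(1) \<delta> by (subst (asm) nn_integral_eq_integral) (auto simp: emeasure_space_1)
  let ?A = "{\<omega>\<in>space M. (\<integral>\<^sup>+t\<in>{0..T}. ennreal ((simple_value m \<tau> g t \<omega>)\<^sup>2) \<partial>lborel) > ennreal \<delta>}"
  let ?B = "{\<omega>\<in>space M. (?S' \<omega>)\<^sup>2 \<ge> \<epsilon>\<^sup>2}"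
  have A: "?A = {\<omega>\<in>space M. Q m \<omega> > \<delta>}"
    unfolding int_sq Q_def[symmetric] using \<delta> by (auto simp: ennreal_less_iff)
  have [measurable]: "g k \<in> borel_measurable M" if "k < m" for k
    using gm[OF _ that, of k] simple_process_range[OF P, of k] that by (intro measurable_F[of _ "\<tau> k"]) auto
  have [measurable]: "Q m \<in> borel_measurable M"
    unfolding Q_def by measurable
  \<comment> \<open>If \<open>Q m \<omega> \<le> \<delta>\<close>, monotonicity of Q shows that no
    coefficient was switched off, and the two integrals agree.\<close>
  have "{\<omega>\<in>space M. \<bar>?S \<omega>\<bar> > \<epsilon>} \<subseteq> ?A \<union> ?B"
  proof
    fix \<omega> assume w: "\<omega> \<in> {\<omega>\<in>space M. \<bar>?S \<omega>\<bar> > \<epsilon>}"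
    show "\<omega> \<in> ?A \<union> ?B"
    proof (cases "Q m \<omega> > \<delta>")
      case True
      then show ?thesis using w unfolding A by auto
    next
      case False
      have "g' j \<omega> = g j \<omega>" if "j < m" for j
        using Qmono[of "Suc j" m \<omega>] that False by (auto simp: g'_def)
      then have "?S' \<omega> = ?S \<omega>" unfolding simple_integral_def by (intro sum.cong) auto
      then have "\<epsilon>\<^sup>2 \<le> \<bar>?S' \<omega>\<bar>\<^sup>2" using w \<epsilon> by (intro power_mono) auto
      then show ?thesis using w by auto
    qed
  qed
  then have "prob {\<omega>\<in>space M. \<bar>?S \<omega>\<bar> > \<epsilon>} \<le> prob (?A \<union> ?B)"
    unfolding A by (intro finite_measure_mono) auto
  also have "\<dots> \<le> prob ?A + prob ?B" unfolding A by (rule measure_Un_le) auto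
  also have "prob ?B \<le> expectation (\<lambda>\<omega>. (?S' \<omega>)\<^sup>2) / \<epsilon>\<^sup>2"
    using iso(1) \<epsilon> by (intro integral_Markov_inequality_measure[where A="{}"]) auto
  also have "\<dots> \<le> \<delta> / \<epsilon>\<^sup>2" using E by (intro divide_right_mono) auto
  finally show ?thesis by simp
qed

section \<open>Progressive and joint measurability\<close>

lemma sets_progressive_sigma:
  "sets (progressive_sigma (space M) T F) \<subseteq> sets (restrict_space borel {0..T} \<Otimes>\<^sub>M F T)"
  "space (progressive_sigma (space M) T F) = space (restrict_space borel {0..T} \<Otimes>\<^sub>M F T)"
proof -
  let ?\<G> = "{A. A \<subseteq> {0..T} \<times> space M \<and>
           (\<forall>t\<in>{0..T}. A \<inter> ({0..t} \<times> space M) \<in> sets (restrict_space borel {0..t} \<Otimes>\<^sub>M F t))}"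
  let ?N = "restrict_space borel {0..T} \<Otimes>\<^sub>M F T"
  have sp: "space ?N = {0..T} \<times> space M" by (simp add: space_pair_measure space_restrict_space space_F)
  have G: "?\<G> \<subseteq> Pow ({0..T} \<times> space M)" by auto
  have "?\<G> \<subseteq> sets ?N"
  proof
    fix A assume "A \<in> ?\<G>"
    then have "A \<inter> ({0..T} \<times> space M) \<in> sets ?N" "A \<subseteq> {0..T} \<times> space M" using T_pos by auto
    then show "A \<in> sets ?N" by (simp add: Int_absorb2)
  qed
  then have "sigma_sets ({0..T} \<times> space M) ?\<G> \<subseteq> sets ?N"
    using sets.sigma_sets_subset[of ?\<G> ?N] sp by simp
  then show "sets (progressive_sigma (space M) T F) \<subseteq> sets ?N"
    unfolding progressive_sigma_def using sets_measure_of[OF G] by simp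
  show "space (progressive_sigma (space M) T F) = space ?N"
    unfolding progressive_sigma_def sp using G by (simp add: space_measure_of)
qed

lemma measurable_identity_F: "(\<lambda>\<omega>. \<omega>) \<in> measurable M (F T)"
  using sets_F_subset[of T] T_pos sets.sets_into_space
  by (intro measurableI) (auto simp: space_F Int_absorb2 vimage_def subset_eq)

text \<open>Clipping time to [0, T] trades the restricted product space for
  \<open>borel \<Otimes>\<^sub>M M\<close>, on which integrals in time and in \<omega> can be
  interchanged.\<close>

lemma progressive_measurable:
  assumes H: "(\<lambda>(t, \<omega>). H t \<omega>) \<in> borel_measurable (progressive_sigma (space M) T F)"
  shows "(\<lambda>(t, \<omega>). H (clip 0 T t) \<omega>) \<in> borel_measurable (borel \<Otimes>\<^sub>M M)"
proof -
  let ?N = "restrict_space borel {0..T} \<Otimes>\<^sub>M F T"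
  have H': "(\<lambda>(t, \<omega>). H t \<omega>) \<in> borel_measurable ?N"
    using H sets_progressive_sigma by (auto simp: measurable_def)
  have 1: "snd \<in> measurable (borel \<Otimes>\<^sub>M M) (F T)"
    using measurable_compose[OF measurable_snd measurable_identity_F] by auto
  have 2: "(\<lambda>p. clip 0 T (fst p)) \<in> measurable (borel \<Otimes>\<^sub>M M) (restrict_space borel {0..T})"
    using T_pos unfolding clip_def by (intro measurable_restrict_space2) auto
  have "(\<lambda>p. (clip 0 T (fst p), snd p)) \<in> measurable (borel \<Otimes>\<^sub>M M) ?N"
    using 1 2 by (intro measurable_Pair)
  from measurable_compose[OF this H'] show ?thesis
    by (simp add: case_prod_beta)
qed

lemma simple_value_0: "simple_process M T F m \<tau> h \<Longrightarrow> simple_value m \<tau> g 0 \<omega> = 0"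
  using simple_process_range(1) unfolding simple_value_def
  by (intro sum.neutral) (force simp: indicator_def not_less)

lemma simple_value_joint_measurable:
  assumes P: "simple_process M T F m \<tau> h"
  shows "(\<lambda>(t, \<omega>). simple_value m \<tau> h t \<omega>) \<in> borel_measurable (borel \<Otimes>\<^sub>M M)"
proof -
  have [measurable]: "h k \<in> borel_measurable M" if "k < m" for k
    using P that simple_process_range[OF P, of k]
    by (auto simp: simple_process_def intro!: measurable_F[of _ "\<tau> k"])
  show ?thesis unfolding simple_value_def split_beta' by measurable
qed

lemma ito_integral_measurable:
  "ito_integral M T F W H I \<Longrightarrow> t \<in> {0..T} \<Longrightarrow> I t \<in> borel_measurable (F t)"
  by (auto simp: ito_integral_def)

text \<open>The definition of the integral provides integrands converging only in probability. For a
  bounded integrand H they can be truncated at its bound C: the truncated ones converge in mean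
  square, and the integral of the part cut off tends to 0 in probability by
  \<open>prob_simple_integral_le\<close>.\<close>

lemma ito_integral_approx:
  assumes W: "brownian_motion M T F W" and I: "ito_integral M T F W H I"
    and C: "\<And>t \<omega>. t \<in> {0..T} \<Longrightarrow> \<omega> \<in> space M \<Longrightarrow> \<bar>H t \<omega>\<bar> \<le> C"
  obtains m \<tau> c where "\<And>k. simple_process M T F (m k) (\<tau> k) (c k)"
    "\<And>k t \<omega>. t \<in> {0..T} \<Longrightarrow> \<bar>simple_value (m k) (\<tau> k) (c k) t \<omega>\<bar> \<le> C"
    "\<And>t. t \<in> {0..T} \<Longrightarrow> tends0_prob (\<lambda>k \<omega>. simple_integral W (m k) (\<tau> k) (c k) t \<omega> - I t \<omega>)"
    "(\<lambda>k. \<integral>\<^sup>+\<omega>. (\<integral>\<^sup>+t\<in>{0..T}. ennreal ((simple_value (m k) (\<tau> k) (c k) t \<omega> - H t \<omega>)\<^sup>2) \<partial>lborel) \<partial>M) \<longlonglongrightarrow> 0"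
proof -
  have C0: "0 \<le> C"
  proof -
    obtain \<omega> where "\<omega> \<in> space M" using not_empty by auto
    from C[OF _ this, of 0] T_pos show ?thesis by force
  qed
  obtain m \<tau> h where P: "\<And>k. simple_process M T F (m k) (\<tau> k) (h k)"
    and V: "tendsto_zero_in_probability M
          (\<lambda>k \<omega>. \<integral>\<^sup>+t\<in>{0..T}. ennreal ((simple_value (m k) (\<tau> k) (h k) t \<omega> - H t \<omega>)\<^sup>2) \<partial>lborel)"
    and SI: "tendsto_zero_in_probability M
          (\<lambda>k \<omega>. SUP t\<in>{0..T}. ennreal \<bar>simple_integral W (m k) (\<tau> k) (h k) t \<omega> - I t \<omega>\<bar>)"
    using I unfolding ito_integral_def by blast
  define V' where "V' k \<omega> = (\<integral>\<^sup>+t\<in>{0..T}. ennreal ((simple_value (m k) (\<tau> k) (h k) t \<omega> - H t \<omega>)\<^sup>2) \<partial>lborel)" for k \<omega>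
  have Vm[measurable]: "V' k \<in> borel_measurable M" for k
    using V unfolding tendsto_zero_in_probability_def V'_def[abs_def] by auto
  have Vt: "(\<lambda>k. prob {\<omega>\<in>space M. V' k \<omega> > ennreal \<epsilon>}) \<longlonglongrightarrow> 0" if "0 < \<epsilon>" for \<epsilon>
    using V that unfolding tendsto_zero_in_probability_def V'_def[abs_def] by auto
  \<comment> \<open>c is the truncated coefficient and g, below, the part cut off; both are again
    simple processes on the same grid.\<close>
  define c where "c k j \<omega> = clip (- C) C (h k j \<omega>)" for k j \<omega>
  define g where "g k j \<omega> = h k j \<omega> - c k j \<omega>" for k j \<omega>
  have cC: "\<bar>clip (- C) C x\<bar> \<le> C" for x using C0 by (auto simp: clip_def)
  \<comment> \<open>For y in [-C, C] truncation brings x no further from y, and the amount cut off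
    is at most the distance from x to y. With y the value of H, both errors are controlled by the
    original one.\<close>
  have clip1: "\<bar>clip (- C) C x - y\<bar> \<le> \<bar>x - y\<bar>" "\<bar>x - clip (- C) C x\<bar> \<le> \<bar>x - y\<bar>" if "\<bar>y\<bar> \<le> C" for x y
    using that by (auto simp: clip_def max_def min_def)
  have Pc: "simple_process M T F (m k) (\<tau> k) (c k)" for k
  proof -
    have "c k j \<in> borel_measurable (F (\<tau> k j))" if "j < m k" for j
      using P[of k] that unfolding c_def clip_def by (auto simp: simple_process_def)
    moreover have "\<exists>D. \<forall>\<omega>\<in>space M. \<bar>c k j \<omega>\<bar> \<le> D" for j using cC unfolding c_def by blast
    ultimately show ?thesis using P[of k] by (auto simp: simple_process_def)
  qed
  have Pg: "simple_process M T F (m k) (\<tau> k) (g k)" for k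
  proof -
    have "g k j \<in> borel_measurable (F (\<tau> k j))" if "j < m k" for j
      using P[of k] Pc[of k] that unfolding g_def by (intro borel_measurable_diff) (auto simp: simple_process_def)
    moreover have "\<exists>D. \<forall>\<omega>\<in>space M. \<bar>g k j \<omega>\<bar> \<le> D" if j: "j < m k" for j
    proof -
      obtain D where D: "\<forall>\<omega>\<in>space M. \<bar>h k j \<omega>\<bar> \<le> D" using P[of k] j by (auto simp: simple_process_def)
      have "\<bar>g k j \<omega>\<bar> \<le> D + C" if "\<omega> \<in> space M" for \<omega>
        using D that cC[of "h k j \<omega>"] unfolding g_def c_def by force
      then show ?thesis by blast
    qed
    ultimately show ?thesis using P[of k] by (auto simp: simple_process_def)
  qed
  have svc: "simple_value (m k) (\<tau> k) (c k) t \<omega> = clip (- C) C (simple_value (m k) (\<tau> k) (h k) t \<omega>)"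
    if t: "t \<in> {0..T}" for k t \<omega>
  \<comment> \<open>At t = 0 no left-open step is active, and both sides are 0 because C is
    nonnegative.\<close>
  proof (cases "t = 0")
    case True
    then show ?thesis using C0 by (simp add: clip_def simple_value_0[OF P])
  next
    case False
    then obtain j where "j < m k" "\<tau> k j < t" "t \<le> \<tau> k (Suc j)"
      using simple_process_cover[OF P, of t k] t by auto
    then show ?thesis by (simp add: c_def simple_value_eq[OF P])
  qed
  have svg: "simple_value (m k) (\<tau> k) (g k) t \<omega>
      = simple_value (m k) (\<tau> k) (h k) t \<omega> - simple_value (m k) (\<tau> k) (c k) t \<omega>" for k t \<omega>
    by (simp add: simple_value_def g_def left_diff_distrib sum_subtractf)
  have sig: "simple_integral W (m k) (\<tau> k) (g k) t \<omega>
      = simple_integral W (m k) (\<tau> k) (h k) t \<omega> - simple_integral W (m k) (\<tau> k) (c k) t \<omega>" for k t \<omega>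
    by (simp add: simple_integral_def g_def left_diff_distrib sum_subtractf)
  have gV: "(\<integral>\<^sup>+t\<in>{0..T}. ennreal ((simple_value (m k) (\<tau> k) (g k) t \<omega>)\<^sup>2) \<partial>lborel) \<le> V' k \<omega>"
    if w: "\<omega> \<in> space M" for k \<omega>
    unfolding V'_def
  proof (rule nn_integral_mono)
    fix t
    show "ennreal ((simple_value (m k) (\<tau> k) (g k) t \<omega>)\<^sup>2) * indicator {0..T} t
      \<le> ennreal ((simple_value (m k) (\<tau> k) (h k) t \<omega> - H t \<omega>)\<^sup>2) * indicator {0..T} t"
      using clip1(2)[OF C[OF _ w]] by (auto simp: indicator_def svg svc abs_le_square_iff intro!: ennreal_leI)
  qed
  \<comment> \<open>The first bound tends to 0 in probability, the second is a constant; together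
    they give convergence of the means.\<close>
  have cV: "(\<integral>\<^sup>+t\<in>{0..T}. ennreal ((simple_value (m k) (\<tau> k) (c k) t \<omega> - H t \<omega>)\<^sup>2) \<partial>lborel)
      \<le> min (V' k \<omega>) (ennreal ((2 * C)\<^sup>2 * T))" if w: "\<omega> \<in> space M" for k \<omega>
  proof (rule min.boundedI)
    show "(\<integral>\<^sup>+t\<in>{0..T}. ennreal ((simple_value (m k) (\<tau> k) (c k) t \<omega> - H t \<omega>)\<^sup>2) \<partial>lborel) \<le> V' k \<omega>"
      unfolding V'_def
    proof (rule nn_integral_mono)
      fix t
      show "ennreal ((simple_value (m k) (\<tau> k) (c k) t \<omega> - H t \<omega>)\<^sup>2) * indicator {0..T} t
        \<le> ennreal ((simple_value (m k) (\<tau> k) (h k) t \<omega> - H t \<omega>)\<^sup>2) * indicator {0..T} t"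
        using clip1(1)[OF C[OF _ w]] by (auto simp: indicator_def svc abs_le_square_iff intro!: ennreal_leI)
    qed
    have "(\<integral>\<^sup>+t\<in>{0..T}. ennreal ((simple_value (m k) (\<tau> k) (c k) t \<omega> - H t \<omega>)\<^sup>2) \<partial>lborel)
        \<le> (\<integral>\<^sup>+t. ennreal ((2 * C)\<^sup>2) * indicator {0..T} t \<partial>lborel)"
    proof (rule nn_integral_mono)
      fix t
      have "(simple_value (m k) (\<tau> k) (c k) t \<omega> - H t \<omega>)\<^sup>2 \<le> (2 * C)\<^sup>2" if t: "t \<in> {0..T}"
        using cC[of "simple_value (m k) (\<tau> k) (h k) t \<omega>"] C[OF t w] C0
        unfolding svc[OF t] abs_le_square_iff[symmetric] by linarith
      then show "ennreal ((simple_value (m k) (\<tau> k) (c k) t \<omega> - H t \<omega>)\<^sup>2) * indicator {0..T} t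
        \<le> ennreal ((2 * C)\<^sup>2) * indicator {0..T} t"
        by (auto simp: indicator_def intro!: ennreal_leI)
    qed
    also have "\<dots> = ennreal ((2 * C)\<^sup>2 * T)"
      using T_pos by (simp add: nn_integral_cmult_indicator ennreal_mult del: power_mult_distrib)
    finally show "(\<integral>\<^sup>+t\<in>{0..T}. ennreal ((simple_value (m k) (\<tau> k) (c k) t \<omega> - H t \<omega>)\<^sup>2) \<partial>lborel)
        \<le> ennreal ((2 * C)\<^sup>2 * T)" .
  qed
  have g0: "tends0_prob (\<lambda>k. simple_integral W (m k) (\<tau> k) (g k) t)" if t: "t \<in> {0..T}" for t
    unfolding tends0_prob_def
  proof (intro conjI allI impI)
    show "simple_integral W (m k) (\<tau> k) (g k) t \<in> borel_measurable M" for k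
      by (rule simple_integral_measurable[OF W Pg t])
    fix \<epsilon> :: real assume e: "0 < \<epsilon>"
    show "(\<lambda>k. prob {\<omega>\<in>space M. \<bar>simple_integral W (m k) (\<tau> k) (g k) t \<omega>\<bar> > \<epsilon>}) \<longlonglongrightarrow> 0"
    proof (rule LIMSEQ_I)
      fix \<eta> :: real assume n: "0 < \<eta>"
      \<comment> \<open>Makes the Markov term \<open>\<delta> / \<epsilon>\<^sup>2\<close> equal to
        \<eta>/2; the other half is left for the probability that V' exceeds \<delta>.\<close>
      define \<delta> where "\<delta> = \<epsilon>\<^sup>2 * \<eta> / 2"
      have d: "0 < \<delta>" "\<delta> / \<epsilon>\<^sup>2 = \<eta>/2" using e n by (auto simp: \<delta>_def)
      have "eventually (\<lambda>k. prob {\<omega>\<in>space M. V' k \<omega> > ennreal \<delta>} < \<eta>/2) sequentially"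
        by (rule order_tendstoD(2)[OF Vt]) (use d n in auto)
      then obtain N where N: "\<And>k. k \<ge> N \<Longrightarrow> prob {\<omega>\<in>space M. V' k \<omega> > ennreal \<delta>} < \<eta>/2"
        by (auto simp: eventually_sequentially)
      have "prob {\<omega>\<in>space M. \<bar>simple_integral W (m k) (\<tau> k) (g k) t \<omega>\<bar> > \<epsilon>} < \<eta>" if "k \<ge> N" for k
      proof -
        have "prob {\<omega>\<in>space M. \<bar>simple_integral W (m k) (\<tau> k) (g k) t \<omega>\<bar> > \<epsilon>}
          \<le> prob {\<omega>\<in>space M. (\<integral>\<^sup>+t\<in>{0..T}. ennreal ((simple_value (m k) (\<tau> k) (g k) t \<omega>)\<^sup>2) \<partial>lborel) > ennreal \<delta>} + \<delta> / \<epsilon>\<^sup>2"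
          by (rule prob_simple_integral_le[OF W Pg t _ e]) (use d in simp)
        also have "prob {\<omega>\<in>space M. (\<integral>\<^sup>+t\<in>{0..T}. ennreal ((simple_value (m k) (\<tau> k) (g k) t \<omega>)\<^sup>2) \<partial>lborel) > ennreal \<delta>}
            \<le> prob {\<omega>\<in>space M. V' k \<omega> > ennreal \<delta>}"
          by (rule finite_measure_mono) (auto intro: less_le_trans[OF _ gV])
        finally show ?thesis using N[OF that] d by linarith
      qed
      then show "\<exists>N. \<forall>k\<ge>N. norm (prob {\<omega>\<in>space M. \<bar>simple_integral W (m k) (\<tau> k) (g k) t \<omega>\<bar> > \<epsilon>} - 0) < \<eta>"
        by auto
    qed
  qed
  have h0: "tends0_prob (\<lambda>k \<omega>. simple_integral W (m k) (\<tau> k) (h k) t \<omega> - I t \<omega>)" if t: "t \<in> {0..T}" for t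
    unfolding tends0_prob_def
  proof (intro conjI allI impI)
    show "(\<lambda>\<omega>. simple_integral W (m k) (\<tau> k) (h k) t \<omega> - I t \<omega>) \<in> borel_measurable M" for k
      by (intro borel_measurable_diff simple_integral_measurable[OF W P t] measurable_F[OF ito_integral_measurable[OF I t] t])
    fix \<epsilon> :: real assume e: "0 < \<epsilon>"
    let ?X = "\<lambda>k \<omega>. SUP t\<in>{0..T}. ennreal \<bar>simple_integral W (m k) (\<tau> k) (h k) t \<omega> - I t \<omega>\<bar>"
    have Xt: "(\<lambda>k. prob {\<omega>\<in>space M. ?X k \<omega> > ennreal \<epsilon>}) \<longlonglongrightarrow> 0"
      and Xm: "\<And>k. ?X k \<in> borel_measurable M"
      using SI e unfolding tendsto_zero_in_probability_def by blast+
    have "prob {\<omega>\<in>space M. \<bar>simple_integral W (m k) (\<tau> k) (h k) t \<omega> - I t \<omega>\<bar> > \<epsilon>}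
        \<le> prob {\<omega>\<in>space M. ?X k \<omega> > ennreal \<epsilon>}" for k
    proof (rule finite_measure_mono)
      show "{\<omega>\<in>space M. ?X k \<omega> > ennreal \<epsilon>} \<in> events" using Xm[of k] by measurable
      show "{\<omega>\<in>space M. \<bar>simple_integral W (m k) (\<tau> k) (h k) t \<omega> - I t \<omega>\<bar> > \<epsilon>}
        \<subseteq> {\<omega>\<in>space M. ?X k \<omega> > ennreal \<epsilon>}"
      proof (intro subsetI CollectI conjI)
        fix \<omega> assume w: "\<omega> \<in> {\<omega>\<in>space M. \<bar>simple_integral W (m k) (\<tau> k) (h k) t \<omega> - I t \<omega>\<bar> > \<epsilon>}"
        then show "\<omega> \<in> space M" by simp
        have "ennreal \<epsilon> < ennreal \<bar>simple_integral W (m k) (\<tau> k) (h k) t \<omega> - I t \<omega>\<bar>"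
          using w e by (intro ennreal_lessI) auto
        also have "\<dots> \<le> ?X k \<omega>" using t by (intro SUP_upper)
        finally show "ennreal \<epsilon> < ?X k \<omega>" .
      qed
    qed
    with Xt show "(\<lambda>k. prob {\<omega>\<in>space M. \<bar>simple_integral W (m k) (\<tau> k) (h k) t \<omega> - I t \<omega>\<bar> > \<epsilon>}) \<longlonglongrightarrow> 0"
      by (intro Lim_null_comparison[OF always_eventually Xt]) auto
  qed
  show thesis
  proof (rule that[OF Pc])
    show "\<bar>simple_value (m k) (\<tau> k) (c k) t \<omega>\<bar> \<le> C" if "t \<in> {0..T}" for k t \<omega>
      using cC svc[OF that] by simp
    show "tends0_prob (\<lambda>k \<omega>. simple_integral W (m k) (\<tau> k) (c k) t \<omega> - I t \<omega>)" if "t \<in> {0..T}" for t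
      using tends0_prob_diff[OF h0[OF that] g0[OF that]] by (simp add: sig)
    show "(\<lambda>k. \<integral>\<^sup>+\<omega>. (\<integral>\<^sup>+t\<in>{0..T}. ennreal ((simple_value (m k) (\<tau> k) (c k) t \<omega> - H t \<omega>)\<^sup>2) \<partial>lborel) \<partial>M) \<longlonglongrightarrow> 0"
      (is "?e \<longlonglongrightarrow> 0")
    proof (rule order_tendstoI)
      fix a :: ennreal assume "0 < a"
      then obtain b where b: "0 < b" "b < a" using dense by blast
      then have "b < top" using less_top order.strict_trans by (metis top.not_eq_extremum not_less_iff_gr_or_eq)
      then obtain \<epsilon> where \<epsilon>: "b = ennreal \<epsilon>" "0 < \<epsilon>" using b by (cases b) auto
      define K where "K = (2 * C)\<^sup>2 * T"
      have K: "0 \<le> K" using T_pos by (simp add: K_def)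
      \<comment> \<open>Where V' is at most \<epsilon>/2 the error is at most \<epsilon>/2;
        elsewhere it is at most K, and this threshold makes K times the exceptional probability
        smaller than \<epsilon>/2.\<close>
      have "eventually (\<lambda>k. prob {\<omega>\<in>space M. V' k \<omega> > ennreal (\<epsilon>/2)} < \<epsilon> / (2 * (K + 1))) sequentially"
        by (rule order_tendstoD(2)[OF Vt]) (use \<epsilon> K in auto)
      then show "eventually (\<lambda>k. ?e k < a) sequentially"
      proof eventually_elim
        case (elim k)
        let ?A = "{\<omega>\<in>space M. V' k \<omega> > ennreal (\<epsilon>/2)}"
        have "?e k \<le> (\<integral>\<^sup>+\<omega>. ennreal (\<epsilon>/2) + ennreal K * indicator ?A \<omega> \<partial>M)"
        proof (rule nn_integral_mono)
          fix \<omega> assume w: "\<omega> \<in> space M"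
          show "(\<integral>\<^sup>+t\<in>{0..T}. ennreal ((simple_value (m k) (\<tau> k) (c k) t \<omega> - H t \<omega>)\<^sup>2) \<partial>lborel)
            \<le> ennreal (\<epsilon>/2) + ennreal K * indicator ?A \<omega>"
          proof (cases "\<omega> \<in> ?A")
            case True
            then show ?thesis using cV[OF w, of k] unfolding K_def[symmetric]
              by (simp add: add_increasing)
          next
            case False
            then have "V' k \<omega> \<le> ennreal (\<epsilon>/2)" using w by (auto simp: not_less)
            then show ?thesis using order.trans[OF cV[OF w, of k] min.coboundedI1] False by simp
          qed
        qed
        also have "\<dots> = ennreal (\<epsilon>/2 + K * prob ?A)"
          using \<epsilon> K by (subst nn_integral_add) (auto simp: nn_integral_cmult_indicator emeasure_eq_measure prob_space ennreal_mult)
        also have "\<dots> < ennreal \<epsilon>"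
        proof -
          have "K * prob ?A \<le> K * (\<epsilon> / (2 * (K + 1)))" using elim K by (intro mult_left_mono) auto
          also have "\<dots> < \<epsilon>/2" using \<epsilon> K by (simp add: field_simps)
          finally show ?thesis using \<epsilon> by (intro ennreal_lessI) auto
        qed
        finally show ?case using b \<epsilon> by (auto intro: order.strict_trans)
      qed
    qed simp
  qed
qed

lemma clip_eq: "t \<in> {s..r} \<Longrightarrow> clip s r t = t"
  by (auto simp: clip_def)

lemma ito_integral_joint_measurable:
  assumes "ito_integral M T F W H I"
  shows "(\<lambda>(t, \<omega>). H (clip 0 T t) \<omega>) \<in> borel_measurable (borel \<Otimes>\<^sub>M M)"
  using assms by (intro progressive_measurable) (simp add: ito_integral_def)

text \<open>Clipping time changes nothing on [s, r] inside [0, T], but makes the integrand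
  measurable on the whole product.\<close>

lemma nn_integral_square_diff_measurable:
  assumes I: "ito_integral M T F W H I" and sr: "0 \<le> s" "r \<le> T"
    and Y: "(\<lambda>(t, \<omega>). Y t \<omega>) \<in> borel_measurable (borel \<Otimes>\<^sub>M M)"
  shows "(\<lambda>\<omega>. \<integral>\<^sup>+t\<in>{s..r}. ennreal ((Y t \<omega> - H t \<omega>)\<^sup>2) \<partial>lborel) \<in> borel_measurable M"
    "\<omega> \<in> space M \<Longrightarrow> (\<lambda>t. ennreal ((Y t \<omega> - H t \<omega>)\<^sup>2) * indicator {s..r} t) \<in> borel_measurable lborel"
proof -
  note [measurable] = ito_integral_joint_measurable[OF I] Y
  have eq: "ennreal ((Y t \<omega> - H t \<omega>)\<^sup>2) * indicator {s..r} t
    = ennreal ((Y t \<omega> - H (clip 0 T t) \<omega>)\<^sup>2) * indicator {s..r} t" for t \<omega>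
    using sr by (auto simp: indicator_def clip_def)
  have "(\<lambda>(t, \<omega>). ennreal ((Y t \<omega> - H (clip 0 T t) \<omega>)\<^sup>2) * indicator {s..r} t)
      \<in> borel_measurable (borel \<Otimes>\<^sub>M M)" by measurable
  then have *: "(\<lambda>(t, \<omega>). ennreal ((Y t \<omega> - H (clip 0 T t) \<omega>)\<^sup>2) * indicator {s..r} t)
      \<in> borel_measurable (lborel \<Otimes>\<^sub>M M)"
    by (simp cong: measurable_cong_sets sets_pair_measure_cong)
  have "(\<lambda>(\<omega>, t). ennreal ((Y t \<omega> - H (clip 0 T t) \<omega>)\<^sup>2) * indicator {s..r} t)
      \<in> borel_measurable (M \<Otimes>\<^sub>M lborel)"
    using measurable_compose[OF measurable_pair_swap' *] by (simp add: split_beta')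
  then show "(\<lambda>\<omega>. \<integral>\<^sup>+t\<in>{s..r}. ennreal ((Y t \<omega> - H t \<omega>)\<^sup>2) \<partial>lborel) \<in> borel_measurable M"
    unfolding eq by (rule lborel.borel_measurable_nn_integral)
  show "(\<lambda>t. ennreal ((Y t \<omega> - H t \<omega>)\<^sup>2) * indicator {s..r} t) \<in> borel_measurable lborel"
    if "\<omega> \<in> space M"
    unfolding eq using measurable_compose[OF measurable_Pair1'[OF that] *[THEN measurable_compose[OF measurable_pair_swap']]]
      measurable_compose[OF measurable_Pair2'[OF that] *] by simp
qed

text \<open>The factor 2 costs nothing below and spares the exact isometry.\<close>

lemma ito_integral_L2:
  assumes W: "brownian_motion M T F W" and I: "ito_integral M T F W H I"
    and C: "\<And>t \<omega>. t \<in> {0..T} \<Longrightarrow> \<omega> \<in> space M \<Longrightarrow> \<bar>H t \<omega>\<bar> \<le> C"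
    and sr: "0 \<le> s" "s \<le> r" "r \<le> T"
    and Y: "Y \<in> borel_measurable (F s)" "\<exists>C. \<forall>\<omega>\<in>space M. \<bar>Y \<omega>\<bar> \<le> C"
  shows "(\<integral>\<^sup>+\<omega>. ennreal ((I r \<omega> - I s \<omega> - Y \<omega> * (W r \<omega> - W s \<omega>))\<^sup>2) \<partial>M)
      \<le> 2 * (\<integral>\<^sup>+\<omega>. (\<integral>\<^sup>+t\<in>{s..r}. ennreal ((H t \<omega> - Y \<omega>)\<^sup>2) \<partial>lborel) \<partial>M)"
    "expectation (\<lambda>\<omega>. Y \<omega> * (I r \<omega> - I s \<omega>)) = 0"
    "AE \<omega> in M. I 0 \<omega> = 0"
proof -
  obtain m \<tau> c where P: "\<And>k. simple_process M T F (m k) (\<tau> k) (c k)"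
    and cC: "\<And>k t \<omega>. t \<in> {0..T} \<Longrightarrow> \<bar>simple_value (m k) (\<tau> k) (c k) t \<omega>\<bar> \<le> C"
    and lim: "\<And>t. t \<in> {0..T} \<Longrightarrow> tends0_prob (\<lambda>k \<omega>. simple_integral W (m k) (\<tau> k) (c k) t \<omega> - I t \<omega>)"
    and e0: "(\<lambda>k. \<integral>\<^sup>+\<omega>. (\<integral>\<^sup>+t\<in>{0..T}. ennreal ((simple_value (m k) (\<tau> k) (c k) t \<omega> - H t \<omega>)\<^sup>2) \<partial>lborel) \<partial>M) \<longlonglongrightarrow> 0"
    using ito_integral_approx[OF W I C] by blast
  define S where "S k = simple_integral W (m k) (\<tau> k) (c k)" for k
  define v where "v k = simple_value (m k) (\<tau> k) (c k)" for k
  have in0: "s \<in> {0..T}" "r \<in> {0..T}" "0 \<in> {0..T}" using sr by auto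
  have YM[measurable]: "Y \<in> borel_measurable M" using measurable_F[OF Y(1) in0(1)] .
  have [measurable]: "I t \<in> borel_measurable M" "S k t \<in> borel_measurable M" "W t \<in> borel_measurable M"
    if "t \<in> {0..T}" for t k
    using measurable_F[OF ito_integral_measurable[OF I that] that]
      simple_integral_measurable[OF W P that] measurable_F[OF brownian_measurable[OF W that] that]
    by (auto simp: S_def)
  note [measurable] = in0
  have U: "tends0_prob (\<lambda>k \<omega>. (S k r \<omega> - S k s \<omega>) - (I r \<omega> - I s \<omega>))"
  proof -
    have "(\<lambda>k \<omega>. (S k r \<omega> - S k s \<omega>) - (I r \<omega> - I s \<omega>)) = (\<lambda>k \<omega>. (S k r \<omega> - I r \<omega>) - (S k s \<omega> - I s \<omega>))"
      by (auto simp: fun_eq_iff)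
    then show ?thesis using tends0_prob_diff[OF lim[OF in0(2)] lim[OF in0(1)]] unfolding S_def by simp
  qed
  have vm: "(\<lambda>(t, \<omega>). v k t \<omega>) \<in> borel_measurable (borel \<Otimes>\<^sub>M M)" for k
    unfolding v_def by (rule simple_value_joint_measurable[OF P])
  \<comment> \<open>Formulated for arbitrary Z because it is used twice: with Z = Y for the claim,
    and with Z = 0 to bound the second moment of the increment.\<close>
  have bound: "(\<integral>\<^sup>+\<omega>. ennreal ((I r \<omega> - I s \<omega> - Z \<omega> * (W r \<omega> - W s \<omega>))\<^sup>2) \<partial>M)
      \<le> 2 * (\<integral>\<^sup>+\<omega>. (\<integral>\<^sup>+t\<in>{s..r}. ennreal ((H t \<omega> - Z \<omega>)\<^sup>2) \<partial>lborel) \<partial>M)"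
    if Z: "Z \<in> borel_measurable (F s)" "\<exists>C. \<forall>\<omega>\<in>space M. \<bar>Z \<omega>\<bar> \<le> C" for Z
  proof (rule nn_integral_square_le_tends0_prob)
    have ZM[measurable]: "Z \<in> borel_measurable M" using measurable_F[OF Z(1) in0(1)] .
    let ?S = "\<lambda>k \<omega>. S k r \<omega> - S k s \<omega> - Z \<omega> * (W r \<omega> - W s \<omega>)"
    let ?e = "\<lambda>k. \<integral>\<^sup>+\<omega>. (\<integral>\<^sup>+t\<in>{0..T}. ennreal ((v k t \<omega> - H t \<omega>)\<^sup>2) \<partial>lborel) \<partial>M"
    show "(\<lambda>\<omega>. I r \<omega> - I s \<omega> - Z \<omega> * (W r \<omega> - W s \<omega>)) \<in> borel_measurable M" by measurable
    show "tends0_prob (\<lambda>k \<omega>. ?S k \<omega> - (I r \<omega> - I s \<omega> - Z \<omega> * (W r \<omega> - W s \<omega>)))"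
    proof -
      have "(\<lambda>k \<omega>. ?S k \<omega> - (I r \<omega> - I s \<omega> - Z \<omega> * (W r \<omega> - W s \<omega>)))
        = (\<lambda>k \<omega>. (S k r \<omega> - S k s \<omega>) - (I r \<omega> - I s \<omega>))"
        by (auto simp: fun_eq_iff)
      then show ?thesis using U by simp
    qed
    show "?S k \<in> borel_measurable M" for k by measurable
    show "(\<lambda>k. 2 * ?e k) \<longlonglongrightarrow> 0"
      using ennreal_tendsto_cmult[OF _ e0, of 2] by (simp add: v_def)
    fix k
    have "(\<integral>\<^sup>+\<omega>. ennreal ((?S k \<omega>)\<^sup>2) \<partial>M) = (\<integral>\<^sup>+\<omega>. (\<integral>\<^sup>+t\<in>{s..r}. ennreal ((v k t \<omega> - Z \<omega>)\<^sup>2) \<partial>lborel) \<partial>M)"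
      unfolding S_def v_def by (rule simple_integral_isometry(3)[OF W P sr Z])
    \<comment> \<open>H is inserted between the simple value and Z by \<open>square_diff_le\<close>.
      This separates the claimed bound, with its factor 2, from an approximation error that vanishes
      with k.\<close>
    also have "\<dots> \<le> (\<integral>\<^sup>+\<omega>. 2 * (\<integral>\<^sup>+t\<in>{s..r}. ennreal ((Z \<omega> - H t \<omega>)\<^sup>2) \<partial>lborel)
        + 2 * (\<integral>\<^sup>+t\<in>{0..T}. ennreal ((v k t \<omega> - H t \<omega>)\<^sup>2) \<partial>lborel) \<partial>M)"
    proof (rule nn_integral_mono)
      fix \<omega> assume w: "\<omega> \<in> space M"
      have m1: "(\<lambda>t. ennreal ((Z \<omega> - H t \<omega>)\<^sup>2) * indicator {s..r} t) \<in> borel_measurable lborel"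
        by (rule nn_integral_square_diff_measurable(2)[OF I sr(1,3) _ w]) measurable
      have m2: "(\<lambda>t. ennreal ((v k t \<omega> - H t \<omega>)\<^sup>2) * indicator {0..T} t) \<in> borel_measurable lborel"
        by (rule nn_integral_square_diff_measurable(2)[OF I _ _ vm w]) simp_all
      have "(\<integral>\<^sup>+t\<in>{s..r}. ennreal ((v k t \<omega> - Z \<omega>)\<^sup>2) \<partial>lborel)
        \<le> (\<integral>\<^sup>+t. 2 * (ennreal ((Z \<omega> - H t \<omega>)\<^sup>2) * indicator {s..r} t)
          + 2 * (ennreal ((v k t \<omega> - H t \<omega>)\<^sup>2) * indicator {0..T} t) \<partial>lborel)"
      proof (rule nn_integral_mono)
        fix t
        have "ennreal ((v k t \<omega> - Z \<omega>)\<^sup>2) \<le> ennreal (2 * (Z \<omega> - H t \<omega>)\<^sup>2 + 2 * (v k t \<omega> - H t \<omega>)\<^sup>2)"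
          using square_diff_le[of "v k t \<omega>" "Z \<omega>" "H t \<omega>"]
          by (intro ennreal_leI) (simp add: power2_commute[of "H t \<omega>" "Z \<omega>"])
        also have "\<dots> = 2 * ennreal ((Z \<omega> - H t \<omega>)\<^sup>2) + 2 * ennreal ((v k t \<omega> - H t \<omega>)\<^sup>2)"
          by (simp add: ennreal_mult)
        finally show "ennreal ((v k t \<omega> - Z \<omega>)\<^sup>2) * indicator {s..r} t
          \<le> 2 * (ennreal ((Z \<omega> - H t \<omega>)\<^sup>2) * indicator {s..r} t)
          + 2 * (ennreal ((v k t \<omega> - H t \<omega>)\<^sup>2) * indicator {0..T} t)"
          using sr by (auto simp: indicator_def)
      qed
      also have "\<dots> = 2 * (\<integral>\<^sup>+t\<in>{s..r}. ennreal ((Z \<omega> - H t \<omega>)\<^sup>2) \<partial>lborel)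
        + 2 * (\<integral>\<^sup>+t\<in>{0..T}. ennreal ((v k t \<omega> - H t \<omega>)\<^sup>2) \<partial>lborel)"
        using m1 m2 by (subst nn_integral_add) (auto simp: nn_integral_cmult)
      finally show "(\<integral>\<^sup>+t\<in>{s..r}. ennreal ((v k t \<omega> - Z \<omega>)\<^sup>2) \<partial>lborel)
        \<le> 2 * (\<integral>\<^sup>+t\<in>{s..r}. ennreal ((Z \<omega> - H t \<omega>)\<^sup>2) \<partial>lborel)
        + 2 * (\<integral>\<^sup>+t\<in>{0..T}. ennreal ((v k t \<omega> - H t \<omega>)\<^sup>2) \<partial>lborel)" .
    qed
    also have "\<dots> = 2 * (\<integral>\<^sup>+\<omega>. (\<integral>\<^sup>+t\<in>{s..r}. ennreal ((Z \<omega> - H t \<omega>)\<^sup>2) \<partial>lborel) \<partial>M) + 2 * ?e k"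
    proof -
      have "(\<lambda>\<omega>. \<integral>\<^sup>+t\<in>{s..r}. ennreal ((Z \<omega> - H t \<omega>)\<^sup>2) \<partial>lborel) \<in> borel_measurable M"
        by (rule nn_integral_square_diff_measurable(1)[OF I sr(1,3)]) measurable
      moreover have "(\<lambda>\<omega>. \<integral>\<^sup>+t\<in>{0..T}. ennreal ((v k t \<omega> - H t \<omega>)\<^sup>2) \<partial>lborel) \<in> borel_measurable M"
        by (rule nn_integral_square_diff_measurable(1)[OF I _ _ vm]) simp_all
      ultimately show ?thesis by (subst nn_integral_add) (auto simp: nn_integral_cmult)
    qed
    also have "(\<integral>\<^sup>+\<omega>. (\<integral>\<^sup>+t\<in>{s..r}. ennreal ((Z \<omega> - H t \<omega>)\<^sup>2) \<partial>lborel) \<partial>M)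
      = (\<integral>\<^sup>+\<omega>. (\<integral>\<^sup>+t\<in>{s..r}. ennreal ((H t \<omega> - Z \<omega>)\<^sup>2) \<partial>lborel) \<partial>M)"
      by (simp add: power2_commute)
    finally show "(\<integral>\<^sup>+\<omega>. ennreal ((?S k \<omega>)\<^sup>2) \<partial>M)
      \<le> 2 * (\<integral>\<^sup>+\<omega>. (\<integral>\<^sup>+t\<in>{s..r}. ennreal ((H t \<omega> - Z \<omega>)\<^sup>2) \<partial>lborel) \<partial>M) + 2 * ?e k" .
  qed
  show "(\<integral>\<^sup>+\<omega>. ennreal ((I r \<omega> - I s \<omega> - Y \<omega> * (W r \<omega> - W s \<omega>))\<^sup>2) \<partial>M)
      \<le> 2 * (\<integral>\<^sup>+\<omega>. (\<integral>\<^sup>+t\<in>{s..r}. ennreal ((H t \<omega> - Y \<omega>)\<^sup>2) \<partial>lborel) \<partial>M)"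
    by (rule bound[OF Y])
  define K where "K = C\<^sup>2 * T"
  have K0: "0 \<le> K" using T_pos by (simp add: K_def)
  have const: "(\<integral>\<^sup>+\<omega>. (\<integral>\<^sup>+t\<in>{s..r}. ennreal ((G t \<omega>)\<^sup>2) \<partial>lborel) \<partial>M) \<le> ennreal K"
    if G: "\<And>t \<omega>. t \<in> {0..T} \<Longrightarrow> \<omega> \<in> space M \<Longrightarrow> \<bar>G t \<omega>\<bar> \<le> C" for G
  proof -
    have "(\<integral>\<^sup>+\<omega>. (\<integral>\<^sup>+t\<in>{s..r}. ennreal ((G t \<omega>)\<^sup>2) \<partial>lborel) \<partial>M) \<le> (\<integral>\<^sup>+\<omega>. ennreal K \<partial>M)"
    proof (rule nn_integral_mono)
      fix \<omega> assume w: "\<omega> \<in> space M"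
      have "(\<integral>\<^sup>+t\<in>{s..r}. ennreal ((G t \<omega>)\<^sup>2) \<partial>lborel) \<le> (\<integral>\<^sup>+t. ennreal (C\<^sup>2) * indicator {0..T} t \<partial>lborel)"
      proof (rule nn_integral_mono)
        fix t
        show "ennreal ((G t \<omega>)\<^sup>2) * indicator {s..r} t \<le> ennreal (C\<^sup>2) * indicator {0..T} t"
          using G[OF _ w, of t] sr by (auto simp: indicator_def intro!: ennreal_leI abs_le_square_iff[THEN iffD1])
      qed
      also have "\<dots> = ennreal K" using T_pos by (simp add: nn_integral_cmult_indicator K_def ennreal_mult)
      finally show "(\<integral>\<^sup>+t\<in>{s..r}. ennreal ((G t \<omega>)\<^sup>2) \<partial>lborel) \<le> ennreal K" .
    qed
    then show ?thesis by (simp add: emeasure_space_1)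
  qed
  have I2: "(\<integral>\<^sup>+\<omega>. ennreal ((I r \<omega> - I s \<omega>)\<^sup>2) \<partial>M) \<le> ennreal (2 * K)"
  proof -
    have "(\<integral>\<^sup>+\<omega>. ennreal ((I r \<omega> - I s \<omega>)\<^sup>2) \<partial>M) \<le> 2 * (\<integral>\<^sup>+\<omega>. (\<integral>\<^sup>+t\<in>{s..r}. ennreal ((H t \<omega>)\<^sup>2) \<partial>lborel) \<partial>M)"
      using bound[of "\<lambda>_. 0"] by auto
    also have "\<dots> \<le> 2 * ennreal K" by (intro mult_left_mono const C) auto
    also have "\<dots> = ennreal (2 * K)" using K0 by (simp add: ennreal_mult)
    finally show ?thesis .
  qed
  have Ii: "integrable M (\<lambda>\<omega>. (I r \<omega> - I s \<omega>)\<^sup>2)"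
    by (rule integrableI_bounded) (use I2 in \<open>auto intro: le_less_trans\<close>)
  have IE: "expectation (\<lambda>\<omega>. (I r \<omega> - I s \<omega>)\<^sup>2) \<le> 2 * K"
    using I2 K0 by (subst (asm) nn_integral_eq_integral[OF Ii]) auto
  have S0: "(\<lambda>\<omega>. S k r \<omega> - S k s \<omega> - 0 * (W r \<omega> - W s \<omega>)) = (\<lambda>\<omega>. S k r \<omega> - S k s \<omega>)" for k by simp
  have z: "(\<lambda>_. 0) \<in> borel_measurable (F s)" "\<exists>C. \<forall>\<omega>\<in>space M. \<bar>(0::real)\<bar> \<le> C" by auto
  note iso = simple_integral_isometry[OF W P sr z, folded S_def v_def, unfolded S0]
  have Si: "integrable M (\<lambda>\<omega>. (S k r \<omega> - S k s \<omega>)\<^sup>2)" for k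
    using iso(2)[of k] by simp
  have SE: "expectation (\<lambda>\<omega>. (S k r \<omega> - S k s \<omega>)\<^sup>2) \<le> K" for k
  proof -
    have "(\<integral>\<^sup>+\<omega>. ennreal ((S k r \<omega> - S k s \<omega>)\<^sup>2) \<partial>M) \<le> ennreal K"
      using iso(3)[of k] const[of "v k"] cC by (auto simp: v_def)
    then show ?thesis using K0 by (subst (asm) nn_integral_eq_integral[OF Si]) auto
  qed
  let ?U = "\<lambda>k \<omega>. (S k r \<omega> - S k s \<omega>) - (I r \<omega> - I s \<omega>)"
  have Ub: "(?U k \<omega>)\<^sup>2 \<le> 2 * (S k r \<omega> - S k s \<omega>)\<^sup>2 + 2 * (I r \<omega> - I s \<omega>)\<^sup>2" for k \<omega>
    using square_diff_le[of "S k r \<omega> - S k s \<omega>" "I r \<omega> - I s \<omega>" 0] by (simp only: diff_0 diff_0_right power2_minus)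
  have Ui: "integrable M (\<lambda>\<omega>. (?U k \<omega>)\<^sup>2)" for k
    by (rule Bochner_Integration.integrable_bound[of _ "\<lambda>\<omega>. 2 * (S k r \<omega> - S k s \<omega>)\<^sup>2 + 2 * (I r \<omega> - I s \<omega>)\<^sup>2"])
       (use Si Ii Ub in \<open>auto intro!: AE_I2\<close>)
  have UE: "expectation (\<lambda>\<omega>. (?U k \<omega>)\<^sup>2) \<le> 6 * K" for k
  proof -
    have "expectation (\<lambda>\<omega>. (?U k \<omega>)\<^sup>2)
        \<le> expectation (\<lambda>\<omega>. 2 * (S k r \<omega> - S k s \<omega>)\<^sup>2 + 2 * (I r \<omega> - I s \<omega>)\<^sup>2)"
      using Si Ii by (intro integral_mono Ui Ub) auto
    also have "\<dots> = 2 * expectation (\<lambda>\<omega>. (S k r \<omega> - S k s \<omega>)\<^sup>2) + 2 * expectation (\<lambda>\<omega>. (I r \<omega> - I s \<omega>)\<^sup>2)"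
      using Si Ii by simp
    also have "\<dots> \<le> 6 * K" using IE SE[of k] by simp
    finally show ?thesis .
  qed
  note L1 = tends0_prob_imp_L1[OF U Ui UE]
  obtain D where D: "\<And>\<omega>. \<omega> \<in> space M \<Longrightarrow> \<bar>Y \<omega>\<bar> \<le> D" using Y(2) by auto
  have D0: "0 \<le> D" using D not_empty by force
  \<comment> \<open>The simple integrals are orthogonal to Y, so only the approximation error
    remains, and its L1 norm tends to 0.\<close>
  have "\<bar>expectation (\<lambda>\<omega>. Y \<omega> * (I r \<omega> - I s \<omega>))\<bar> \<le> D * expectation (\<lambda>\<omega>. \<bar>?U k \<omega>\<bar>)" for k
  proof -
    have iS: "integrable M (\<lambda>\<omega>. S k r \<omega> - S k s \<omega>)" "integrable M (\<lambda>\<omega>. I r \<omega> - I s \<omega>)" "integrable M (?U k)"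
      using integrable_L2_imp_L1[OF Si] integrable_L2_imp_L1[OF Ii] integrable_L2_imp_L1[OF Ui] by auto
    note YS = integrable_mult_bounded[OF iS(1) YM D] integrable_mult_bounded[OF iS(2) YM D]
      integrable_mult_bounded[OF iS(3) YM D]
    have "expectation (\<lambda>\<omega>. Y \<omega> * (I r \<omega> - I s \<omega>)) = expectation (\<lambda>\<omega>. Y \<omega> * (S k r \<omega> - S k s \<omega>)) - expectation (\<lambda>\<omega>. Y \<omega> * ?U k \<omega>)"
      using YS by (simp add: right_diff_distrib[of "Y _" "S k r _ - S k s _"])
    also have "expectation (\<lambda>\<omega>. Y \<omega> * (S k r \<omega> - S k s \<omega>)) = 0"
      using iso(4)[OF Y] by simp
    finally have "\<bar>expectation (\<lambda>\<omega>. Y \<omega> * (I r \<omega> - I s \<omega>))\<bar> = \<bar>expectation (\<lambda>\<omega>. Y \<omega> * ?U k \<omega>)\<bar>" by simp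
    also have "\<dots> \<le> expectation (\<lambda>\<omega>. \<bar>Y \<omega> * ?U k \<omega>\<bar>)" using integral_abs_bound .
    also have "\<dots> \<le> expectation (\<lambda>\<omega>. D * \<bar>?U k \<omega>\<bar>)"
      by (rule integral_mono[OF integrable_abs[OF YS(3)] integrable_mult_right[OF integrable_abs[OF iS(3)]]])
         (use D in \<open>auto simp: abs_mult intro!: mult_right_mono\<close>)
    finally show ?thesis by simp
  qed
  then have "\<bar>expectation (\<lambda>\<omega>. Y \<omega> * (I r \<omega> - I s \<omega>))\<bar> \<le> D * 0"
    by (intro LIMSEQ_le_const[OF tendsto_mult[OF tendsto_const L1]]) auto
  then show "expectation (\<lambda>\<omega>. Y \<omega> * (I r \<omega> - I s \<omega>)) = 0" by simp
  \<comment> \<open>Simple integrals vanish at time 0, so this sequence does not depend on k and can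
    tend to 0 only if \<open>I 0\<close> vanishes almost surely.\<close>
  have "tends0_prob (\<lambda>k \<omega>. - I 0 \<omega>)" using lim[OF in0(3)] by (simp add: simple_integral_0[OF P])
  then obtain q where "AE \<omega> in M. (\<lambda>j::nat. - I 0 \<omega>) \<longlonglongrightarrow> 0"
    using tends0_prob_AE_subseq by blast
  then show "AE \<omega> in M. I 0 \<omega> = 0"
    by eventually_elim (auto simp: LIMSEQ_const_iff)
qed

end

section \<open>Second-order expansions\<close>

lemma (in prob_space) indep_vars_imp_indep_var:
  assumes "indep_vars N X I" "i \<in> I" "j \<in> I" "i \<noteq> j"
  shows "indep_var (N i) (X i) (N j) (X j)"
  unfolding indep_var_eq indep_sets2_eq
proof (intro conjI ballI)
  let ?S = "\<lambda>i. sigma_sets (space M) {X i -` A \<inter> space M |A. A \<in> sets (N i)}"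
  have rv: "\<And>i. i \<in> I \<Longrightarrow> random_variable (N i) (X i)" and ind: "indep_sets ?S I"
    using assms(1) unfolding indep_vars_def by auto
  show "random_variable (N i) (X i)" "random_variable (N j) (X j)" using rv assms by auto
  show "?S i \<subseteq> events" "?S j \<subseteq> events" using ind assms unfolding indep_sets_def by auto
  fix a b assume ab: "a \<in> ?S i" "b \<in> ?S j"
  have "prob (\<Inter>k\<in>{i, j}. (if k = i then a else b)) = (\<Prod>k\<in>{i, j}. prob (if k = i then a else b))"
    by (rule indep_setsD[OF ind]) (use assms ab in auto)
  then show "prob (a \<inter> b) = prob a * prob b" using assms(4) by (simp add: Int_commute)
qed

lemma (in prob_space) expectation_square_le:
  assumes "integrable M X" "integrable M (\<lambda>x. (X x)\<^sup>2)"
  shows "(expectation X)\<^sup>2 \<le> expectation (\<lambda>x. (X x)\<^sup>2 :: real)"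
  using variance_eq[OF assms] variance_positive[of X] by simp

lemma integral_sum_sum:
  fixes X :: "'i \<Rightarrow> 'j \<Rightarrow> 'a \<Rightarrow> real"
  assumes "\<And>j k. j \<in> J \<Longrightarrow> k \<in> K \<Longrightarrow> integrable N (X j k)"
  shows "integral\<^sup>L N (\<lambda>\<omega>. \<Sum>j\<in>J. \<Sum>k\<in>K. X j k \<omega>) = (\<Sum>j\<in>J. \<Sum>k\<in>K. integral\<^sup>L N (X j k))"
proof -
  have "integral\<^sup>L N (\<lambda>\<omega>. \<Sum>j\<in>J. \<Sum>k\<in>K. X j k \<omega>) = (\<Sum>j\<in>J. integral\<^sup>L N (\<lambda>\<omega>. \<Sum>k\<in>K. X j k \<omega>))"
    using assms by (intro Bochner_Integration.integral_sum Bochner_Integration.integrable_sum)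
  also have "\<dots> = (\<Sum>j\<in>J. \<Sum>k\<in>K. integral\<^sup>L N (X j k))"
    using assms by (intro sum.cong refl Bochner_Integration.integral_sum)
  finally show ?thesis .
qed

section \<open>Several Brownian motions and mixed moments of their increments\<close>

locale brownian_system = filtered_prob_space M T F for M :: "'w measure" and T and F +
  fixes w :: "'n::finite \<Rightarrow> real \<Rightarrow> 'w \<Rightarrow> real"
  assumes indep_brownian: "independent_brownian_motions M T F w"
begin

lemma brownian: "brownian_motion M T F (w n)"
  using indep_brownian by (auto simp: independent_brownian_motions_def)

lemma w_measurable: "t \<in> {0..T} \<Longrightarrow> w n t \<in> borel_measurable (F t)"
  using brownian_measurable[OF brownian] .

lemma w_increment_moments:
  assumes "0 \<le> s" "s \<le> r" "r \<le> T"
  shows "integrable M (\<lambda>\<omega>. w n r \<omega> - w n s \<omega>)"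
    "integrable M (\<lambda>\<omega>. (w n r \<omega> - w n s \<omega>)\<^sup>2)"
    "integrable M (\<lambda>\<omega>. (w n r \<omega> - w n s \<omega>) ^ 4)"
    "expectation (\<lambda>\<omega>. (w n r \<omega> - w n s \<omega>)\<^sup>2) = r - s"
    "expectation (\<lambda>\<omega>. (w n r \<omega> - w n s \<omega>) ^ 4) = 3 * (r - s)\<^sup>2"
proof -
  have "integrable M (\<lambda>\<omega>. (w n r \<omega> - w n s \<omega>) ^ 1) \<and>
    integrable M (\<lambda>\<omega>. (w n r \<omega> - w n s \<omega>)\<^sup>2) \<and>
    integrable M (\<lambda>\<omega>. (w n r \<omega> - w n s \<omega>) ^ 4) \<and>
    expectation (\<lambda>\<omega>. (w n r \<omega> - w n s \<omega>)\<^sup>2) = r - s \<and>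
    expectation (\<lambda>\<omega>. (w n r \<omega> - w n s \<omega>) ^ 4) = 3 * (r - s)\<^sup>2"
  proof (cases "s = r")
    case False
    then have "s < r" using assms by simp
    note increment_moments[OF brownian[of n] assms(1) this assms(3)]
    then show ?thesis by blast
  qed simp
  then show "integrable M (\<lambda>\<omega>. w n r \<omega> - w n s \<omega>)"
    "integrable M (\<lambda>\<omega>. (w n r \<omega> - w n s \<omega>)\<^sup>2)"
    "integrable M (\<lambda>\<omega>. (w n r \<omega> - w n s \<omega>) ^ 4)"
    "expectation (\<lambda>\<omega>. (w n r \<omega> - w n s \<omega>)\<^sup>2) = r - s"
    "expectation (\<lambda>\<omega>. (w n r \<omega> - w n s \<omega>) ^ 4) = 3 * (r - s)\<^sup>2" by simp_all
qed

lemma indep_functionals: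
  assumes "n \<noteq> m" "f \<in> borel_measurable (Pi\<^sub>M {0..T} (\<lambda>_. borel))" "g \<in> borel_measurable (Pi\<^sub>M {0..T} (\<lambda>_. borel))"
  shows "indep_var borel (\<lambda>\<omega>. f (\<lambda>t\<in>{0..T}. w n t \<omega>) :: real) borel (\<lambda>\<omega>. g (\<lambda>t\<in>{0..T}. w m t \<omega>) :: real)"
proof -
  have "indep_vars (\<lambda>_. Pi\<^sub>M {0..T} (\<lambda>_. borel)) (\<lambda>n \<omega>. \<lambda>t\<in>{0..T}. w n t \<omega>) UNIV"
    using indep_brownian by (simp add: independent_brownian_motions_def)
  from indep_vars_imp_indep_var[OF this, of n m]
  have "indep_var (Pi\<^sub>M {0..T} (\<lambda>_. borel)) (\<lambda>\<omega>. \<lambda>t\<in>{0..T}. w n t \<omega>) (Pi\<^sub>M {0..T} (\<lambda>_. borel)) (\<lambda>\<omega>. \<lambda>t\<in>{0..T}. w m t \<omega>)"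
    using assms(1) by simp
  from indep_var_compose[OF this assms(2,3)] show ?thesis by (simp add: comp_def)
qed

text \<open>For different steps the later increment is centred and independent of the earlier one,
  which belongs to its past; by symmetry the earlier index may be taken to be j.\<close>

lemma expectation_increments_same:
  assumes u: "0 \<le> u 0" "\<And>i. u i \<le> u (Suc i)" "u N \<le> T" and jk: "j < N" "k < N"
  shows "integrable M (\<lambda>\<omega>. (w n (u (Suc j)) \<omega> - w n (u j) \<omega>) * (w n (u (Suc k)) \<omega> - w n (u k) \<omega>))"
    "expectation (\<lambda>\<omega>. (w n (u (Suc j)) \<omega> - w n (u j) \<omega>) * (w n (u (Suc k)) \<omega> - w n (u k) \<omega>))
      = (if j = k then u (Suc j) - u j else 0)"
proof -
  let ?P = "\<lambda>j k. integrable M (\<lambda>\<omega>. (w n (u (Suc j)) \<omega> - w n (u j) \<omega>) * (w n (u (Suc k)) \<omega> - w n (u k) \<omega>)) \<and>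
    expectation (\<lambda>\<omega>. (w n (u (Suc j)) \<omega> - w n (u j) \<omega>) * (w n (u (Suc k)) \<omega> - w n (u k) \<omega>))
      = (if j = k then u (Suc j) - u j else 0)"
  have mono: "u i \<le> u j" if "i \<le> j" for i j using u(2) that by (rule lift_Suc_mono_le)
  have rng: "u i \<in> {0..T}" if "i \<le> N" for i using mono[of 0 i] mono[of i N] u that by auto
  have pos: "0 \<le> u k" "u k \<le> u (Suc k)" "u (Suc k) \<le> T" if "k < N" for k
    using rng[of k] rng[of "Suc k"] u(2)[of k] that by auto
  have le: "?P j k" if "j \<le> k" "k < N" for j k
  proof (cases "j = k")
    case True
    then show ?thesis using w_increment_moments(2,4)[OF pos[OF \<open>k < N\<close>], of n] by (simp add: power2_eq_square)
  next
    case False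
    then have jk: "Suc j \<le> k" using that by auto
    then have "j < N" using that by simp
    then have i0: "integrable M (\<lambda>\<omega>. w n (u (Suc j)) \<omega> - w n (u j) \<omega>)"
      using w_increment_moments(1)[OF pos] by blast
    have m0: "(\<lambda>\<omega>. w n (u (Suc j)) \<omega> - w n (u j) \<omega>) \<in> borel_measurable (F (u k))"
    proof -
      have "w n (u j) \<in> borel_measurable (F (u k))" "w n (u (Suc j)) \<in> borel_measurable (F (u k))"
        using jk that mono[of j k] mono[OF jk] rng[of j] rng[of "Suc j"]
        by (auto intro!: measurable_F_mono[OF w_measurable])
      then show ?thesis by measurable
    qed
    have "k < N" using that by simp
    from expectation_mult_increment(1,2)[OF brownian pos[OF this] m0 i0, of n] show ?thesis
      using False by simp
  qed
  have "?P j k"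
  proof (cases "j \<le> k")
    case True
    then show ?thesis using le jk by auto
  next
    case False
    then have "?P k j" using le[of k j] jk by auto
    then show ?thesis using False by (auto simp: mult.commute)
  qed
  then show "integrable M (\<lambda>\<omega>. (w n (u (Suc j)) \<omega> - w n (u j) \<omega>) * (w n (u (Suc k)) \<omega> - w n (u k) \<omega>))"
    "expectation (\<lambda>\<omega>. (w n (u (Suc j)) \<omega> - w n (u j) \<omega>) * (w n (u (Suc k)) \<omega> - w n (u k) \<omega>))
      = (if j = k then u (Suc j) - u j else 0)" by auto
qed

lemma integrable_increment_products:
  assumes "0 \<le> s" "s \<le> r" "r \<le> T" "n \<noteq> m" "0 \<le> s'" "s' \<le> r'" "r' \<le> T"
  shows "integrable M (\<lambda>\<omega>. (w n r \<omega> - w n s \<omega>)\<^sup>2)"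
    "integrable M (\<lambda>\<omega>. (w n r \<omega> - w n s \<omega>) * (w m r' \<omega> - w m s' \<omega>))"
proof -
  show "integrable M (\<lambda>\<omega>. (w n r \<omega> - w n s \<omega>)\<^sup>2)" using w_increment_moments(2)[OF assms(1-3)] .
  show "integrable M (\<lambda>\<omega>. (w n r \<omega> - w n s \<omega>) * (w m r' \<omega> - w m s' \<omega>))"
    using assms by (intro integrable_mult_L2 increment_measurable[OF brownian] w_increment_moments(2)) auto
qed

text \<open>
  The hypotheses only say that each single motion is independent of the past, not that the vector of
  motions is. Orthogonality of the increments given the past is recovered from the independence of
  the paths, because the quadratic covariation along fine partitions vanishes.
\<close>

lemma expectation_mult_increments:
  assumes sr: "0 \<le> s" "s \<le> r" "r \<le> T" and nm: "n \<noteq> m"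
    and Y: "Y \<in> borel_measurable (F s)" "\<And>\<omega>. \<omega> \<in> space M \<Longrightarrow> \<bar>Y \<omega>\<bar> \<le> D"
  shows "expectation (\<lambda>\<omega>. Y \<omega> * ((w n r \<omega> - w n s \<omega>) * (w m r \<omega> - w m s \<omega>))) = 0" (is "?E = 0")
proof -
  have YM[measurable]: "Y \<in> borel_measurable M" using measurable_F[OF Y(1)] sr by auto
  \<comment> \<open>With N + 1 equal steps, \<open>?E\<close> is the mean of Y times the discrete
    covariation, whose second moment is (N + 1) ((r - s) / (N + 1))^2. Only then is N sent to
    infinity.\<close>
  have "?E\<^sup>2 \<le> D\<^sup>2 * (r - s)\<^sup>2 / real (Suc N)" for N
  proof -
    define u where "u j = s + real j * ((r - s) / real (Suc N))" for j
    have u0: "u 0 = s" and uN: "u (Suc N) = r" by (simp_all add: u_def)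
    have uS: "u (Suc j) - u j = (r - s) / real (Suc N)" for j by (simp add: u_def distrib_right add_divide_distrib)
    have up: "u j \<le> u (Suc j)" for j
    proof -
      have "0 \<le> (r - s) / real (Suc N)" using sr by simp
      then show ?thesis using uS[of j] by linarith
    qed
    have mono: "u i \<le> u j" if "i \<le> j" for i j using up that by (rule lift_Suc_mono_le)
    have rng: "u i \<in> {0..T}" "s \<le> u i" if "i \<le> Suc N" for i
      using mono[of 0 i] mono[of i "Suc N"] u0 uN sr that by auto
    let ?a = "\<lambda>j \<omega>. w n (u (Suc j)) \<omega> - w n (u j) \<omega>" and ?b = "\<lambda>j \<omega>. w m (u (Suc j)) \<omega> - w m (u j) \<omega>"
    let ?A = "\<lambda>j \<omega>. w n (u j) \<omega> - w n s \<omega>" and ?B = "\<lambda>j \<omega>. w m (u j) \<omega> - w m s \<omega>"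
    let ?S = "\<lambda>\<omega>. \<Sum>j<Suc N. ?a j \<omega> * ?b j \<omega>"
    have am: "?a j \<in> borel_measurable M" "?b j \<in> borel_measurable M" if "j < Suc N" for j
      using increment_measurable[OF brownian rng(1) rng(1), of j "Suc j"] that by auto
    have iab: "integrable M (\<lambda>\<omega>. ?a j \<omega> * ?b k \<omega>)" if "j < Suc N" "k < Suc N" for j k
      using that rng[of j] rng[of "Suc j"] rng[of k] rng[of "Suc k"] up nm
      by (intro integrable_increment_products(2)) auto
    \<comment> \<open>The last factor is an increment of one motion after \<open>u j\<close> and all
      else is known at \<open>u j\<close>; independence of that single motion from the past
      suffices, even when p and q differ.\<close>
    have mart: "integrable M (\<lambda>\<omega>. (Y \<omega> * (w p (u j) \<omega> - w p s \<omega>)) * (w q (u (Suc j)) \<omega> - w q (u j) \<omega>)) \<and>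
      expectation (\<lambda>\<omega>. (Y \<omega> * (w p (u j) \<omega> - w p s \<omega>)) * (w q (u (Suc j)) \<omega> - w q (u j) \<omega>)) = 0"
      if j: "j < Suc N" for j p q
    proof -
      have "integrable M (\<lambda>\<omega>. w p (u j) \<omega> - w p s \<omega>)"
        using w_increment_moments(1)[OF sr(1)] rng[of j] j by simp
      then have i: "integrable M (\<lambda>\<omega>. Y \<omega> * (w p (u j) \<omega> - w p s \<omega>))"
        using integrable_mult_bounded[OF _ YM Y(2)] by simp
      have "w p s \<in> borel_measurable (F (u j))" "w p (u j) \<in> borel_measurable (F (u j))" "Y \<in> borel_measurable (F (u j))"
        using rng[of j] j sr
        by (auto intro: measurable_F_mono[OF w_measurable[of s p]] w_measurable measurable_F_mono[OF Y(1)])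
      then have "(\<lambda>\<omega>. Y \<omega> * (w p (u j) \<omega> - w p s \<omega>)) \<in> borel_measurable (F (u j))" by measurable
      moreover have "0 \<le> u j" "u (Suc j) \<le> T" using rng[of j] rng[of "Suc j"] j by auto
      ultimately show ?thesis using expectation_mult_increment(1,2)[OF brownian _ up[of j] _ _ i, of q] by simp
    qed
    \<comment> \<open>Discrete product rule: two martingale sums plus the discrete
      covariation.\<close>
    have prod: "?A k \<omega> * ?B k \<omega> = (\<Sum>j<k. ?A j \<omega> * ?b j \<omega>) + (\<Sum>j<k. ?B j \<omega> * ?a j \<omega>) + (\<Sum>j<k. ?a j \<omega> * ?b j \<omega>)" for k \<omega>
    proof (induction k)
      case 0
      then show ?case by (simp add: u0)
    next
      case (Suc k)
      have "?A (Suc k) \<omega> * ?B (Suc k) \<omega> = ?A k \<omega> * ?B k \<omega> + ?A k \<omega> * ?b k \<omega> + ?B k \<omega> * ?a k \<omega> + ?a k \<omega> * ?b k \<omega>"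
        by (simp add: algebra_simps)
      then show ?case using Suc by simp
    qed
    have YS: "Y \<omega> * ((w n r \<omega> - w n s \<omega>) * (w m r \<omega> - w m s \<omega>))
      = (\<Sum>j<Suc N. (Y \<omega> * ?A j \<omega>) * ?b j \<omega>) + (\<Sum>j<Suc N. (Y \<omega> * ?B j \<omega>) * ?a j \<omega>) + Y \<omega> * ?S \<omega>" for \<omega>
      using prod[of "Suc N" \<omega>] unfolding uN
      by (simp only: distrib_left sum_distrib_left mult.assoc)
    have iS: "integrable M ?S" using iab by (intro Bochner_Integration.integrable_sum) auto
    have iYS: "integrable M (\<lambda>\<omega>. Y \<omega> * ?S \<omega>)" using integrable_mult_bounded[OF iS YM Y(2)] .
    have E: "?E = expectation (\<lambda>\<omega>. Y \<omega> * ?S \<omega>)"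
    proof -
      have i2: "integrable M (\<lambda>\<omega>. \<Sum>j<Suc N. (Y \<omega> * ?A j \<omega>) * ?b j \<omega>)"
        "integrable M (\<lambda>\<omega>. \<Sum>j<Suc N. (Y \<omega> * ?B j \<omega>) * ?a j \<omega>)"
        using mart by (auto intro!: Bochner_Integration.integrable_sum)
      have "?E = expectation (\<lambda>\<omega>. \<Sum>j<Suc N. (Y \<omega> * ?A j \<omega>) * ?b j \<omega>)
          + expectation (\<lambda>\<omega>. \<Sum>j<Suc N. (Y \<omega> * ?B j \<omega>) * ?a j \<omega>) + expectation (\<lambda>\<omega>. Y \<omega> * ?S \<omega>)"
        unfolding YS Bochner_Integration.integral_add[OF Bochner_Integration.integrable_add[OF i2] iYS]
          Bochner_Integration.integral_add[OF i2] ..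
      also have "\<dots> = (\<Sum>j<Suc N. expectation (\<lambda>\<omega>. (Y \<omega> * ?A j \<omega>) * ?b j \<omega>))
          + (\<Sum>j<Suc N. expectation (\<lambda>\<omega>. (Y \<omega> * ?B j \<omega>) * ?a j \<omega>)) + expectation (\<lambda>\<omega>. Y \<omega> * ?S \<omega>)"
        using mart by (intro arg_cong2[where f="(+)"] Bochner_Integration.integral_sum refl) auto
      also have "\<dots> = expectation (\<lambda>\<omega>. Y \<omega> * ?S \<omega>)" using mart by simp
      finally show ?thesis .
    qed
    \<comment> \<open>Independence of the two paths enters here. Regrouped by motion, the fourfold
      product has factors that are functionals of different paths, and each factor has mean zero
      unless j = k.\<close>
    have xx: "integrable M (\<lambda>\<omega>. (?a j \<omega> * ?b j \<omega>) * (?a k \<omega> * ?b k \<omega>)) \<and>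
      expectation (\<lambda>\<omega>. (?a j \<omega> * ?b j \<omega>) * (?a k \<omega> * ?b k \<omega>)) = (if j = k then ((r - s) / real (Suc N))\<^sup>2 else 0)"
      if jk: "j < Suc N" "k < Suc N" for j k
    proof -
      let ?f = "\<lambda>p. (p (u (Suc j)) - p (u j)) * (p (u (Suc k)) - p (u k)) :: real"
      have fm: "?f \<in> borel_measurable (Pi\<^sub>M {0..T} (\<lambda>_. borel))"
        using rng[of j] rng[of "Suc j"] rng[of k] rng[of "Suc k"] jk
        by (intro borel_measurable_times borel_measurable_diff measurable_component_singleton) auto
      have res: "(\<lambda>\<omega>. ?f (\<lambda>t\<in>{0..T}. w p t \<omega>)) = (\<lambda>\<omega>. (w p (u (Suc j)) \<omega> - w p (u j) \<omega>) * (w p (u (Suc k)) \<omega> - w p (u k) \<omega>))" for p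
        using rng[of j] rng[of "Suc j"] rng[of k] rng[of "Suc k"] jk by auto
      have ind: "indep_var borel (\<lambda>\<omega>. ?a j \<omega> * ?a k \<omega>) borel (\<lambda>\<omega>. ?b j \<omega> * ?b k \<omega>)"
        using indep_functionals[OF nm fm fm] unfolding res .
      have u0': "0 \<le> u 0" "u (Suc N) \<le> T" using u0 uN sr by auto
      note Ea = expectation_increments_same[OF u0'(1) up u0'(2) jk, of n]
      note Eb = expectation_increments_same[OF u0'(1) up u0'(2) jk, of m]
      have "(\<lambda>\<omega>. (?a j \<omega> * ?b j \<omega>) * (?a k \<omega> * ?b k \<omega>)) = (\<lambda>\<omega>. (?a j \<omega> * ?a k \<omega>) * (?b j \<omega> * ?b k \<omega>))"
        by (auto simp: mult_ac)
      then show ?thesis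
        using indep_var_integrable[OF ind Ea(1) Eb(1)] indep_var_lebesgue_integral[OF ind Ea(1) Eb(1)] Ea(2) Eb(2)
        by (auto simp: uS power2_eq_square)
    qed
    have S2: "(?S \<omega>)\<^sup>2 = (\<Sum>j<Suc N. \<Sum>k<Suc N. (?a j \<omega> * ?b j \<omega>) * (?a k \<omega> * ?b k \<omega>))" for \<omega>
      unfolding power2_eq_square sum_product ..
    have iS2: "integrable M (\<lambda>\<omega>. (?S \<omega>)\<^sup>2)"
      unfolding S2 by (intro Bochner_Integration.integrable_sum) (use xx in auto)
    have "expectation (\<lambda>\<omega>. (?S \<omega>)\<^sup>2) = (\<Sum>j<Suc N. \<Sum>k<Suc N. if j = k then ((r - s) / real (Suc N))\<^sup>2 else 0)"
      unfolding S2 by (subst integral_sum_sum) (use xx in \<open>auto intro!: sum.cong\<close>)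
    also have "\<dots> = real (Suc N) * ((r - s) / real (Suc N))\<^sup>2"
      by (subst sum.delta') auto
    also have "\<dots> = (r - s)\<^sup>2 / real (Suc N)"
    proof -
      have "x * (d / x)\<^sup>2 = d\<^sup>2 / x" if "0 < x" for x d :: real using that by (simp add: power2_eq_square)
      from this[of "real (Suc N)" "r - s"] show ?thesis by simp
    qed
    finally have ES: "expectation (\<lambda>\<omega>. (?S \<omega>)\<^sup>2) = (r - s)\<^sup>2 / real (Suc N)" .
    have Sm[measurable]: "?S \<in> borel_measurable M" using borel_measurable_integrable[OF iS] .
    have le: "(Y \<omega> * ?S \<omega>)\<^sup>2 \<le> D\<^sup>2 * (?S \<omega>)\<^sup>2" if "\<omega> \<in> space M" for \<omega>
      unfolding power_mult_distrib using Y(2)[OF that]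
      by (intro mult_right_mono) (auto intro: abs_le_square_iff[THEN iffD1])
    have iYS2: "integrable M (\<lambda>\<omega>. (Y \<omega> * ?S \<omega>)\<^sup>2)"
    proof (rule Bochner_Integration.integrable_bound)
      show "integrable M (\<lambda>\<omega>. D\<^sup>2 * (?S \<omega>)\<^sup>2)" using iS2 by (rule integrable_mult_right)
      show "AE \<omega> in M. norm ((Y \<omega> * ?S \<omega>)\<^sup>2) \<le> norm (D\<^sup>2 * (?S \<omega>)\<^sup>2)"
        using le by (intro AE_I2) simp
    qed measurable
    have "?E\<^sup>2 \<le> expectation (\<lambda>\<omega>. (Y \<omega> * ?S \<omega>)\<^sup>2)" unfolding E by (rule expectation_square_le[OF iYS iYS2])
    also have "\<dots> \<le> expectation (\<lambda>\<omega>. D\<^sup>2 * (?S \<omega>)\<^sup>2)"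
      by (rule integral_mono[OF iYS2 integrable_mult_right[OF iS2]]) (use le in auto)
    also have "\<dots> = D\<^sup>2 * (r - s)\<^sup>2 / real (Suc N)" using ES by simp
    finally show ?thesis .
  qed
  moreover have "(\<lambda>N. D\<^sup>2 * (r - s)\<^sup>2 / real (Suc N)) \<longlonglongrightarrow> 0"
    using tendsto_mult[OF tendsto_const[of "D\<^sup>2 * (r - s)\<^sup>2"] LIMSEQ_inverse_real_of_nat] by (simp add: field_simps)
  ultimately have "?E\<^sup>2 \<le> 0" by (intro LIMSEQ_le_const) auto
  then show ?thesis by simp
qed


section \<open>Scalar Ito processes with bounded coefficients\<close>

definition ito_remainder :: "(real \<Rightarrow> 'w \<Rightarrow> real) \<Rightarrow> ('n \<Rightarrow> real \<Rightarrow> 'w \<Rightarrow> real) \<Rightarrow> real \<Rightarrow> real \<Rightarrow> 'w \<Rightarrow> real" where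
  "ito_remainder Z K s r \<omega> = Z r \<omega> - Z s \<omega> - (\<Sum>n\<in>UNIV. K n s \<omega> * (w n r \<omega> - w n s \<omega>))"

text \<open>Encodes dZ = \<Sum> K dw through the properties that a short-time Taylor expansion uses,
  all of which survive differences and scalings. Freezing K at s costs O(r - s) in L2, against sqrt
  (r - s) for the main part. This cost is of the same order as the generator term, so the martingale
  property is recorded separately: it is what removes the first-order Taylor term exactly.\<close>

definition ito_expansion :: "(real \<Rightarrow> 'w \<Rightarrow> real) \<Rightarrow> ('n \<Rightarrow> real \<Rightarrow> 'w \<Rightarrow> real) \<Rightarrow> bool" where
  "ito_expansion Z K \<longleftrightarrow>
     (\<forall>t\<in>{0..T}. Z t \<in> borel_measurable (F t)) \<and>
     (\<forall>n. \<forall>t\<in>{0..T}. K n t \<in> borel_measurable (F t)) \<and>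
     (\<exists>C. \<forall>n. \<forall>t\<in>{0..T}. \<forall>\<omega>\<in>space M. \<bar>K n t \<omega>\<bar> \<le> C) \<and>
     (\<exists>C. \<forall>s r. 0 \<le> s \<longrightarrow> s \<le> r \<longrightarrow> r \<le> T \<longrightarrow>
        integrable M (\<lambda>\<omega>. (ito_remainder Z K s r \<omega>)\<^sup>2) \<and>
        expectation (\<lambda>\<omega>. (ito_remainder Z K s r \<omega>)\<^sup>2) \<le> C * (r - s)\<^sup>2) \<and>
     (\<forall>s r Y. 0 \<le> s \<longrightarrow> s \<le> r \<longrightarrow> r \<le> T \<longrightarrow> Y \<in> borel_measurable (F s) \<longrightarrow>
        (\<exists>C. \<forall>\<omega>\<in>space M. \<bar>Y \<omega>\<bar> \<le> C) \<longrightarrow> expectation (\<lambda>\<omega>. Y \<omega> * (Z r \<omega> - Z s \<omega>)) = 0)"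

lemma ito_expansion_measurable:
  assumes "ito_expansion Z K" "t \<in> {0..T}"
  shows "Z t \<in> borel_measurable (F t)" "K n t \<in> borel_measurable (F t)"
    "Z t \<in> borel_measurable M" "K n t \<in> borel_measurable M"
proof -
  show 1: "Z t \<in> borel_measurable (F t)" "K n t \<in> borel_measurable (F t)"
    using assms unfolding ito_expansion_def by blast+
  show "Z t \<in> borel_measurable M" "K n t \<in> borel_measurable M"
    using measurable_F[OF 1(1) assms(2)] measurable_F[OF 1(2) assms(2)] .
qed

lemma ito_expansion_bounded:
  assumes "ito_expansion Z K"
  shows "\<exists>C\<ge>0. \<forall>n t \<omega>. t \<in> {0..T} \<longrightarrow> \<omega> \<in> space M \<longrightarrow> \<bar>K n t \<omega>\<bar> \<le> C"
proof -
  obtain C where C: "\<forall>n. \<forall>t\<in>{0..T}. \<forall>\<omega>\<in>space M. \<bar>K n t \<omega>\<bar> \<le> C"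
    using assms[unfolded ito_expansion_def, THEN conjunct2, THEN conjunct2, THEN conjunct1] ..
  have "\<bar>K n t \<omega>\<bar> \<le> max 0 C" if "t \<in> {0..T}" "\<omega> \<in> space M" for n t \<omega>
    using C that by (auto intro: max.coboundedI2)
  then show ?thesis by (intro exI[of _ "max 0 C"]) simp
qed

lemma ito_expansion_remainder:
  assumes "ito_expansion Z K"
  shows "\<exists>C\<ge>0. \<forall>s r. 0 \<le> s \<longrightarrow> s \<le> r \<longrightarrow> r \<le> T \<longrightarrow>
        integrable M (\<lambda>\<omega>. (ito_remainder Z K s r \<omega>)\<^sup>2) \<and>
        expectation (\<lambda>\<omega>. (ito_remainder Z K s r \<omega>)\<^sup>2) \<le> C * (r - s)\<^sup>2"
proof -
  obtain C where C: "\<forall>s r. 0 \<le> s \<longrightarrow> s \<le> r \<longrightarrow> r \<le> T \<longrightarrow>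
        integrable M (\<lambda>\<omega>. (ito_remainder Z K s r \<omega>)\<^sup>2) \<and>
        expectation (\<lambda>\<omega>. (ito_remainder Z K s r \<omega>)\<^sup>2) \<le> C * (r - s)\<^sup>2"
    using assms[unfolded ito_expansion_def, THEN conjunct2, THEN conjunct2, THEN conjunct2, THEN conjunct1] ..
  have le: "C * (r - s)\<^sup>2 \<le> max 0 C * (r - s)\<^sup>2" for s r :: real by (intro mult_right_mono) auto
  show ?thesis
    by (intro exI[of _ "max 0 C"] conjI allI impI) (use C in \<open>auto intro: order.trans[OF _ le]\<close>)
qed

lemma ito_expansion_martingale:
  assumes "ito_expansion Z K" "0 \<le> s" "s \<le> r" "r \<le> T" "Y \<in> borel_measurable (F s)"
    "\<And>\<omega>. \<omega> \<in> space M \<Longrightarrow> \<bar>Y \<omega>\<bar> \<le> C"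
  shows "expectation (\<lambda>\<omega>. Y \<omega> * (Z r \<omega> - Z s \<omega>)) = 0"
  using assms unfolding ito_expansion_def by blast

lemma ito_remainder_measurable:
  assumes "ito_expansion Z K" "0 \<le> s" "s \<le> r" "r \<le> T"
  shows "ito_remainder Z K s r \<in> borel_measurable M"
proof -
  have "s \<in> {0..T}" "r \<in> {0..T}" using assms by auto
  note m = ito_expansion_measurable(3,4)[OF assms(1)] measurable_F[OF w_measurable]
  show ?thesis unfolding ito_remainder_def[abs_def]
    using m \<open>s \<in> {0..T}\<close> \<open>r \<in> {0..T}\<close>
    by (intro borel_measurable_diff borel_measurable_sum borel_measurable_times) auto
qed

lemma ito_main_part_integrable:
  assumes Z: "ito_expansion Z K" and sr: "0 \<le> s" "s \<le> r" "r \<le> T"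
  shows "integrable M (\<lambda>\<omega>. (\<Sum>n\<in>UNIV. K n s \<omega> * (w n r \<omega> - w n s \<omega>))\<^sup>2)"
    "(\<lambda>\<omega>. \<Sum>n\<in>UNIV. K n s \<omega> * (w n r \<omega> - w n s \<omega>)) \<in> borel_measurable M"
proof -
  have s: "s \<in> {0..T}" "r \<in> {0..T}" using sr by auto
  obtain C where C: "0 \<le> C" "\<And>n t \<omega>. t \<in> {0..T} \<Longrightarrow> \<omega> \<in> space M \<Longrightarrow> \<bar>K n t \<omega>\<bar> \<le> C"
    using ito_expansion_bounded[OF Z] by blast
  have m: "(\<lambda>\<omega>. K n s \<omega> * (w n r \<omega> - w n s \<omega>)) \<in> borel_measurable M" for n
    using ito_expansion_measurable(4)[OF Z s(1), of n] increment_measurable[OF brownian s, of n] by measurable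
  show m': "(\<lambda>\<omega>. \<Sum>n\<in>UNIV. K n s \<omega> * (w n r \<omega> - w n s \<omega>)) \<in> borel_measurable M"
    using m by (intro borel_measurable_sum)
  have i: "integrable M (\<lambda>\<omega>. (K n s \<omega> * (w n r \<omega> - w n s \<omega>))\<^sup>2)" for n
  proof (rule Bochner_Integration.integrable_bound)
    show "integrable M (\<lambda>\<omega>. C\<^sup>2 * (w n r \<omega> - w n s \<omega>)\<^sup>2)"
      using w_increment_moments(2)[OF sr] by simp
    show "AE \<omega> in M. norm ((K n s \<omega> * (w n r \<omega> - w n s \<omega>))\<^sup>2) \<le> norm (C\<^sup>2 * (w n r \<omega> - w n s \<omega>)\<^sup>2)"
    proof (rule AE_I2)
      fix \<omega> assume "\<omega> \<in> space M"
      then have "(K n s \<omega>)\<^sup>2 \<le> C\<^sup>2" using C(1) C(2)[OF s(1), of \<omega> n] by (intro abs_le_square_iff[THEN iffD1]) simp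
      then show "norm ((K n s \<omega> * (w n r \<omega> - w n s \<omega>))\<^sup>2) \<le> norm (C\<^sup>2 * (w n r \<omega> - w n s \<omega>)\<^sup>2)"
        unfolding power_mult_distrib by (simp add: mult_right_mono del: power_mono_iff)
    qed
  qed (rule borel_measurable_power[OF m])
  show "integrable M (\<lambda>\<omega>. (\<Sum>n\<in>UNIV. K n s \<omega> * (w n r \<omega> - w n s \<omega>))\<^sup>2)"
  proof (rule Bochner_Integration.integrable_bound)
    show "integrable M (\<lambda>\<omega>. (\<Sum>n\<in>UNIV. (K n s \<omega> * (w n r \<omega> - w n s \<omega>))\<^sup>2) * real CARD('n))"
      using i by (intro integrable_mult_left Bochner_Integration.integrable_sum) auto
    show "AE \<omega> in M. norm ((\<Sum>n\<in>UNIV. K n s \<omega> * (w n r \<omega> - w n s \<omega>))\<^sup>2)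
      \<le> norm ((\<Sum>n\<in>UNIV. (K n s \<omega> * (w n r \<omega> - w n s \<omega>))\<^sup>2) * real CARD('n))"
    proof (rule AE_I2)
      fix \<omega>
      show "norm ((\<Sum>n\<in>UNIV. K n s \<omega> * (w n r \<omega> - w n s \<omega>))\<^sup>2)
        \<le> norm ((\<Sum>n\<in>UNIV. (K n s \<omega> * (w n r \<omega> - w n s \<omega>))\<^sup>2) * real CARD('n))"
        unfolding real_norm_def abs_of_nonneg[OF zero_le_power2]
        by (rule order.trans[OF sum_squared_le_sum_of_squares abs_ge_self])
    qed
  qed (rule borel_measurable_power[OF m'])
qed

lemma ito_expansion_increment_integrable:
  assumes Z: "ito_expansion Z K" and sr: "0 \<le> s" "s \<le> r" "r \<le> T"
  shows "integrable M (\<lambda>\<omega>. Z r \<omega> - Z s \<omega>)"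
proof -
  obtain C where "0 \<le> C" and C: "\<And>s r. 0 \<le> s \<Longrightarrow> s \<le> r \<Longrightarrow> r \<le> T \<Longrightarrow> integrable M (\<lambda>\<omega>. (ito_remainder Z K s r \<omega>)\<^sup>2)"
    and "\<And>s r. 0 \<le> s \<Longrightarrow> s \<le> r \<Longrightarrow> r \<le> T \<Longrightarrow> expectation (\<lambda>\<omega>. (ito_remainder Z K s r \<omega>)\<^sup>2) \<le> C * (r - s)\<^sup>2"
    using ito_expansion_remainder[OF Z] by blast
  have "integrable M (\<lambda>\<omega>. ito_remainder Z K s r \<omega> + (\<Sum>n\<in>UNIV. K n s \<omega> * (w n r \<omega> - w n s \<omega>)))"
    using integrable_L2_imp_L1[OF C[OF sr] ito_remainder_measurable[OF Z sr]]
      integrable_L2_imp_L1[OF ito_main_part_integrable[OF Z sr]] by (rule Bochner_Integration.integrable_add)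
  then show ?thesis by (simp add: ito_remainder_def)
qed

text \<open>Remainders subtract, and (p - q)^2 \<le> 2 p^2 + 2 q^2 preserves their order. Through
  this closure Dynkin's formula becomes available for the distance between two solutions.\<close>

lemma ito_expansion_diff:
  assumes Z: "ito_expansion Z K" and Z': "ito_expansion Z' K'"
  shows "ito_expansion (\<lambda>t \<omega>. Z t \<omega> - Z' t \<omega>) (\<lambda>n t \<omega>. K n t \<omega> - K' n t \<omega>)"
proof -
  obtain C where "0 \<le> C" and C: "\<And>n t \<omega>. t \<in> {0..T} \<Longrightarrow> \<omega> \<in> space M \<Longrightarrow> \<bar>K n t \<omega>\<bar> \<le> C"
    using ito_expansion_bounded[OF Z] by blast
  obtain C' where "0 \<le> C'" and C': "\<And>n t \<omega>. t \<in> {0..T} \<Longrightarrow> \<omega> \<in> space M \<Longrightarrow> \<bar>K' n t \<omega>\<bar> \<le> C'"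
    using ito_expansion_bounded[OF Z'] by blast
  obtain D where "0 \<le> D" and D: "\<And>s r. 0 \<le> s \<Longrightarrow> s \<le> r \<Longrightarrow> r \<le> T \<Longrightarrow> integrable M (\<lambda>\<omega>. (ito_remainder Z K s r \<omega>)\<^sup>2)"
    "\<And>s r. 0 \<le> s \<Longrightarrow> s \<le> r \<Longrightarrow> r \<le> T \<Longrightarrow> expectation (\<lambda>\<omega>. (ito_remainder Z K s r \<omega>)\<^sup>2) \<le> D * (r - s)\<^sup>2"
    using ito_expansion_remainder[OF Z] by blast
  obtain D' where "0 \<le> D'" and D': "\<And>s r. 0 \<le> s \<Longrightarrow> s \<le> r \<Longrightarrow> r \<le> T \<Longrightarrow> integrable M (\<lambda>\<omega>. (ito_remainder Z' K' s r \<omega>)\<^sup>2)"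
    "\<And>s r. 0 \<le> s \<Longrightarrow> s \<le> r \<Longrightarrow> r \<le> T \<Longrightarrow> expectation (\<lambda>\<omega>. (ito_remainder Z' K' s r \<omega>)\<^sup>2) \<le> D' * (r - s)\<^sup>2"
    using ito_expansion_remainder[OF Z'] by blast
  let ?Z = "\<lambda>t \<omega>. Z t \<omega> - Z' t \<omega>" and ?K = "\<lambda>n t \<omega>. K n t \<omega> - K' n t \<omega>"
  have R: "ito_remainder ?Z ?K s r \<omega> = ito_remainder Z K s r \<omega> - ito_remainder Z' K' s r \<omega>" for s r \<omega>
    by (simp add: ito_remainder_def left_diff_distrib sum_subtractf)
  have rem: "integrable M (\<lambda>\<omega>. (ito_remainder ?Z ?K s r \<omega>)\<^sup>2) \<and>
      expectation (\<lambda>\<omega>. (ito_remainder ?Z ?K s r \<omega>)\<^sup>2) \<le> (2 * D + 2 * D') * (r - s)\<^sup>2"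
    if sr: "0 \<le> s" "s \<le> r" "r \<le> T" for s r
  proof -
    have b: "(ito_remainder ?Z ?K s r \<omega>)\<^sup>2 \<le> 2 * (ito_remainder Z K s r \<omega>)\<^sup>2 + 2 * (ito_remainder Z' K' s r \<omega>)\<^sup>2" for \<omega>
      using square_diff_le[of "ito_remainder Z K s r \<omega>" "ito_remainder Z' K' s r \<omega>" 0] unfolding R
      by (simp only: diff_0 diff_0_right power2_minus)
    have i2: "integrable M (\<lambda>\<omega>. 2 * (ito_remainder Z K s r \<omega>)\<^sup>2 + 2 * (ito_remainder Z' K' s r \<omega>)\<^sup>2)"
      using D(1)[OF sr] D'(1)[OF sr] by simp
    have i: "integrable M (\<lambda>\<omega>. (ito_remainder ?Z ?K s r \<omega>)\<^sup>2)"
    proof (rule Bochner_Integration.integrable_bound[OF i2])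
      show "(\<lambda>\<omega>. (ito_remainder ?Z ?K s r \<omega>)\<^sup>2) \<in> borel_measurable M"
        unfolding R using ito_remainder_measurable[OF Z sr] ito_remainder_measurable[OF Z' sr] by measurable
    qed (use b in \<open>auto intro!: AE_I2\<close>)
    have "expectation (\<lambda>\<omega>. (ito_remainder ?Z ?K s r \<omega>)\<^sup>2)
        \<le> 2 * expectation (\<lambda>\<omega>. (ito_remainder Z K s r \<omega>)\<^sup>2) + 2 * expectation (\<lambda>\<omega>. (ito_remainder Z' K' s r \<omega>)\<^sup>2)"
      using integral_mono[OF i i2 b] D(1)[OF sr] D'(1)[OF sr] by simp
    also have "\<dots> \<le> (2 * D + 2 * D') * (r - s)\<^sup>2" using D(2)[OF sr] D'(2)[OF sr] by (simp add: distrib_right)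
    finally show ?thesis using i by simp
  qed
  have mart: "expectation (\<lambda>\<omega>. Y \<omega> * (?Z r \<omega> - ?Z s \<omega>)) = 0"
    if sr: "0 \<le> s" "s \<le> r" "r \<le> T" and Y: "Y \<in> borel_measurable (F s)" "\<exists>C. \<forall>\<omega>\<in>space M. \<bar>Y \<omega>\<bar> \<le> C" for s r Y
  proof -
    obtain E where E: "\<And>\<omega>. \<omega> \<in> space M \<Longrightarrow> \<bar>Y \<omega>\<bar> \<le> E" using Y(2) by auto
    have YM: "Y \<in> borel_measurable M" using measurable_F[OF Y(1)] sr by auto
    have "expectation (\<lambda>\<omega>. Y \<omega> * (?Z r \<omega> - ?Z s \<omega>))
      = expectation (\<lambda>\<omega>. Y \<omega> * (Z r \<omega> - Z s \<omega>) - Y \<omega> * (Z' r \<omega> - Z' s \<omega>))"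
      by (simp add: algebra_simps)
    also have "\<dots> = expectation (\<lambda>\<omega>. Y \<omega> * (Z r \<omega> - Z s \<omega>)) - expectation (\<lambda>\<omega>. Y \<omega> * (Z' r \<omega> - Z' s \<omega>))"
      by (intro Bochner_Integration.integral_diff integrable_mult_bounded[OF _ YM E] ito_expansion_increment_integrable[OF Z sr]
          ito_expansion_increment_integrable[OF Z' sr])
    also have "\<dots> = 0"
      using ito_expansion_martingale[OF Z sr Y(1) E] ito_expansion_martingale[OF Z' sr Y(1) E] by simp
    finally show ?thesis .
  qed
  have bd: "\<bar>?K n t \<omega>\<bar> \<le> C + C'" if "t \<in> {0..T}" "\<omega> \<in> space M" for n t \<omega>
    using C[OF that, of n] C'[OF that, of n] by linarith
  show ?thesis unfolding ito_expansion_def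
    using ito_expansion_measurable(1,2)[OF Z] ito_expansion_measurable(1,2)[OF Z'] bd rem mart
    by (intro conjI ballI allI impI borel_measurable_diff) blast+
qed

lemma ito_expansion_scale:
  assumes Z: "ito_expansion Z K"
  shows "ito_expansion (\<lambda>t \<omega>. c * Z t \<omega>) (\<lambda>n t \<omega>. c * K n t \<omega>)"
proof -
  obtain C where "0 \<le> C" and C: "\<And>n t \<omega>. t \<in> {0..T} \<Longrightarrow> \<omega> \<in> space M \<Longrightarrow> \<bar>K n t \<omega>\<bar> \<le> C"
    using ito_expansion_bounded[OF Z] by blast
  obtain D where "0 \<le> D" and D: "\<And>s r. 0 \<le> s \<Longrightarrow> s \<le> r \<Longrightarrow> r \<le> T \<Longrightarrow> integrable M (\<lambda>\<omega>. (ito_remainder Z K s r \<omega>)\<^sup>2)"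
    "\<And>s r. 0 \<le> s \<Longrightarrow> s \<le> r \<Longrightarrow> r \<le> T \<Longrightarrow> expectation (\<lambda>\<omega>. (ito_remainder Z K s r \<omega>)\<^sup>2) \<le> D * (r - s)\<^sup>2"
    using ito_expansion_remainder[OF Z] by blast
  have R: "ito_remainder (\<lambda>t \<omega>. c * Z t \<omega>) (\<lambda>n t \<omega>. c * K n t \<omega>) s r \<omega> = c * ito_remainder Z K s r \<omega>" for s r \<omega>
    by (simp add: ito_remainder_def right_diff_distrib sum_distrib_left mult.assoc)
  have rem: "integrable M (\<lambda>\<omega>. (c * ito_remainder Z K s r \<omega>)\<^sup>2) \<and>
      expectation (\<lambda>\<omega>. (c * ito_remainder Z K s r \<omega>)\<^sup>2) \<le> (c\<^sup>2 * D) * (r - s)\<^sup>2"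
    if sr: "0 \<le> s" "s \<le> r" "r \<le> T" for s r
    using D(1)[OF sr] mult_left_mono[OF D(2)[OF sr], of "c\<^sup>2"] by (simp add: power_mult_distrib mult.assoc)
  have mart: "expectation (\<lambda>\<omega>. Y \<omega> * (c * Z r \<omega> - c * Z s \<omega>)) = 0"
    if sr: "0 \<le> s" "s \<le> r" "r \<le> T" and Y: "Y \<in> borel_measurable (F s)" "\<exists>C. \<forall>\<omega>\<in>space M. \<bar>Y \<omega>\<bar> \<le> C" for s r Y
  proof -
    obtain E where E: "\<And>\<omega>. \<omega> \<in> space M \<Longrightarrow> \<bar>Y \<omega>\<bar> \<le> E" using Y(2) by auto
    have "expectation (\<lambda>\<omega>. Y \<omega> * (c * Z r \<omega> - c * Z s \<omega>)) = expectation (\<lambda>\<omega>. c * (Y \<omega> * (Z r \<omega> - Z s \<omega>)))"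
      by (simp add: algebra_simps)
    also have "\<dots> = 0" using ito_expansion_martingale[OF Z sr Y(1) E] by simp
    finally show ?thesis .
  qed
  have bd: "\<bar>c * K n t \<omega>\<bar> \<le> \<bar>c\<bar> * C" if "t \<in> {0..T}" "\<omega> \<in> space M" for n t \<omega>
    using mult_left_mono[OF C[OF that, of n], of "\<bar>c\<bar>"] by (simp add: abs_mult)
  show ?thesis unfolding ito_expansion_def R
    using ito_expansion_measurable(1,2)[OF Z] bd rem mart
    by (intro conjI ballI allI impI borel_measurable_times borel_measurable_const) blast+
qed

text \<open>A placeholder for the second process when the two-process formula is applied to a single
  one.\<close>

lemma ito_expansion_zero: "ito_expansion (\<lambda>t \<omega>. 0) (\<lambda>n t \<omega>. 0)"
proof -
  have "(\<exists>C::real. \<forall>n::'n. \<forall>t\<in>{0..T}. \<forall>\<omega>\<in>space M. \<bar>0::real\<bar> \<le> C)" by auto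
  moreover have "\<exists>C::real. \<forall>s r. 0 \<le> s \<longrightarrow> s \<le> r \<longrightarrow> r \<le> T \<longrightarrow> 0 \<le> C * (r - s)\<^sup>2" by (rule exI[of _ 0]) simp
  ultimately show ?thesis by (simp add: ito_expansion_def ito_remainder_def)
qed

lemma nn_integral_sum_square_le:
  fixes G :: "'n \<Rightarrow> 'w \<Rightarrow> real"
  assumes "\<And>n. G n \<in> borel_measurable M" and "\<And>n. (\<integral>\<^sup>+\<omega>. ennreal ((G n \<omega>)\<^sup>2) \<partial>M) \<le> ennreal B" and "0 \<le> B"
  shows "(\<integral>\<^sup>+\<omega>. ennreal ((\<Sum>n\<in>UNIV. G n \<omega>)\<^sup>2) \<partial>M) \<le> ennreal ((real CARD('n))\<^sup>2 * B)"
proof -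
  have "(\<integral>\<^sup>+\<omega>. ennreal ((\<Sum>n\<in>UNIV. G n \<omega>)\<^sup>2) \<partial>M)
      \<le> (\<integral>\<^sup>+\<omega>. ennreal (real CARD('n)) * (\<Sum>n\<in>UNIV. ennreal ((G n \<omega>)\<^sup>2)) \<partial>M)"
  proof (rule nn_integral_mono)
    fix \<omega>
    have "ennreal ((\<Sum>n\<in>UNIV. G n \<omega>)\<^sup>2) \<le> ennreal (real CARD('n) * (\<Sum>n\<in>UNIV. (G n \<omega>)\<^sup>2))"
      using sum_squared_le_sum_of_squares[of "\<lambda>n. G n \<omega>" UNIV] by (intro ennreal_leI) (simp add: mult.commute)
    then show "ennreal ((\<Sum>n\<in>UNIV. G n \<omega>)\<^sup>2) \<le> ennreal (real CARD('n)) * (\<Sum>n\<in>UNIV. ennreal ((G n \<omega>)\<^sup>2))"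
      by (simp add: ennreal_mult sum_nonneg)
  qed
  also have "\<dots> = ennreal (real CARD('n)) * (\<Sum>n\<in>UNIV. \<integral>\<^sup>+\<omega>. ennreal ((G n \<omega>)\<^sup>2) \<partial>M)"
    using assms(1) by (subst nn_integral_cmult) (auto simp: nn_integral_sum simp del: sum_ennreal)
  also have "\<dots> \<le> ennreal (real CARD('n)) * (\<Sum>n\<in>(UNIV::'n set). ennreal B)"
    by (intro mult_left_mono sum_mono assms(2)) auto
  also have "\<dots> = ennreal ((real CARD('n))\<^sup>2 * B)"
    using assms(3) by (simp add: power2_eq_square mult.assoc ennreal_mult ennreal_of_nat_eq_real_of_nat)
  finally show ?thesis .
qed

text \<open>A Lipschitz \<beta> transfers the bound O(u - s) for the second moment of X u - X s to
  the integrand; integrating it over [s, r] produces the order (r - s)^2 required of the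
  remainder.\<close>

lemma ito_expansion_sde:
  fixes X :: "real \<Rightarrow> 'w \<Rightarrow> real" and \<beta> :: "'n \<Rightarrow> real \<Rightarrow> real"
  assumes X: "\<And>t. t \<in> {0..T} \<Longrightarrow> X t \<in> borel_measurable (F t)"
    and I: "\<And>n. ito_integral M T F (w n) (\<lambda>t \<omega>. \<beta> n (X t \<omega>)) (I n)"
    and eq: "AE \<omega> in M. \<forall>t\<in>{0..T}. X t \<omega> = x - (\<Sum>n\<in>UNIV. I n t \<omega>)"
    and \<beta>: "\<And>n z. \<bar>\<beta> n z\<bar> \<le> 1" "\<And>n z z'. \<bar>\<beta> n z - \<beta> n z'\<bar> \<le> L * \<bar>z - z'\<bar>"
      "\<And>n. \<beta> n \<in> borel_measurable borel"
  shows "ito_expansion X (\<lambda>n t \<omega>. - \<beta> n (X t \<omega>))" "AE \<omega> in M. X 0 \<omega> = x"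
proof -
  note \<beta>(3)[measurable]
  define N where "N = (real CARD('n))\<^sup>2"
  have N0: "0 \<le> N" by (simp add: N_def)
  have XM: "X t \<in> borel_measurable M" if "t \<in> {0..T}" for t using measurable_F[OF X] that by auto
  have IM: "I n t \<in> borel_measurable M" if "t \<in> {0..T}" for n t
    using measurable_F[OF ito_integral_measurable[OF I that] that] .
  have bX: "(\<lambda>\<omega>. \<beta> n (X t \<omega>)) \<in> borel_measurable (F t)" if "t \<in> {0..T}" for n t
    using X[OF that] by measurable
  have b1: "\<exists>C. \<forall>\<omega>\<in>space M. \<bar>\<beta> n (X s \<omega>)\<bar> \<le> C" for n s using \<beta>(1) by blast
  have L0: "0 \<le> L"
  proof -
    have "\<bar>\<beta> undefined 1 - \<beta> undefined 0\<bar> \<le> L * \<bar>1 - 0\<bar>" by (rule \<beta>(2))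
    then show ?thesis by simp
  qed
  note L2 = ito_integral_L2[where C = 1, OF brownian I \<beta>(1)]
  show X0: "AE \<omega> in M. X 0 \<omega> = x"
  proof -
    have "AE \<omega> in M. \<forall>n. I n 0 \<omega> = 0"
      using L2(3)[of 0 0 "\<lambda>_. 0"] T_pos by (intro AE_all_countable[THEN iffD2]) auto
    with eq show ?thesis by eventually_elim (use T_pos in auto)
  qed
  \<comment> \<open>Freezing the integrand at 0 and using |\<beta>| \<le> 1 bounds the second moment
    of each integral by 2 (u - s); summing over the motions costs N, the square of their
    number.\<close>
  have inc: "(\<integral>\<^sup>+\<omega>. ennreal ((X u \<omega> - X s \<omega>)\<^sup>2) \<partial>M) \<le> ennreal (N * (2 * (u - s)))"
    if su: "0 \<le> s" "s \<le> u" "u \<le> T" for s u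
  proof -
    have in0: "s \<in> {0..T}" "u \<in> {0..T}" using su by auto
    have "(\<integral>\<^sup>+\<omega>. ennreal ((I n u \<omega> - I n s \<omega>)\<^sup>2) \<partial>M) \<le> ennreal (2 * (u - s))" for n
    proof -
      have "(\<integral>\<^sup>+\<omega>. ennreal ((I n u \<omega> - I n s \<omega>)\<^sup>2) \<partial>M)
          \<le> 2 * (\<integral>\<^sup>+\<omega>. (\<integral>\<^sup>+t\<in>{s..u}. ennreal ((\<beta> n (X t \<omega>))\<^sup>2) \<partial>lborel) \<partial>M)"
        using L2(1)[OF su, of "\<lambda>_. 0" n] by auto
      also have "\<dots> \<le> 2 * (\<integral>\<^sup>+\<omega>. (\<integral>\<^sup>+t. indicator {s..u} t \<partial>lborel) \<partial>M)"
      proof (intro mult_left_mono nn_integral_mono)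
        fix \<omega> t
        have "(\<beta> n (X t \<omega>))\<^sup>2 \<le> 1" using \<beta>(1)[of n "X t \<omega>"] by (simp add: abs_square_le_1)
        then show "ennreal ((\<beta> n (X t \<omega>))\<^sup>2) * indicator {s..u} t \<le> indicator {s..u} t"
          by (auto simp: indicator_def)
      qed simp
      also have "\<dots> = ennreal (2 * (u - s))" using su by (simp add: emeasure_space_1 ennreal_mult del: right_diff_distrib_numeral)
      finally show ?thesis .
    qed
    then have "(\<integral>\<^sup>+\<omega>. ennreal ((\<Sum>n\<in>UNIV. I n u \<omega> - I n s \<omega>)\<^sup>2) \<partial>M) \<le> ennreal (N * (2 * (u - s)))"
      unfolding N_def using IM in0 su by (intro nn_integral_sum_square_le borel_measurable_diff) auto
    moreover have "(\<integral>\<^sup>+\<omega>. ennreal ((X u \<omega> - X s \<omega>)\<^sup>2) \<partial>M) = (\<integral>\<^sup>+\<omega>. ennreal ((\<Sum>n\<in>UNIV. I n u \<omega> - I n s \<omega>)\<^sup>2) \<partial>M)"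
    proof (rule nn_integral_cong_AE)
      show "AE \<omega> in M. ennreal ((X u \<omega> - X s \<omega>)\<^sup>2) = ennreal ((\<Sum>n\<in>UNIV. I n u \<omega> - I n s \<omega>)\<^sup>2)"
        using eq
      proof eventually_elim
        case (elim \<omega>)
        then have "X u \<omega> - X s \<omega> = - (\<Sum>n\<in>UNIV. I n u \<omega> - I n s \<omega>)" using in0 by (simp add: sum_subtractf)
        then show ?case by simp
      qed
    qed
    ultimately show ?thesis by simp
  qed
  have rem_n: "(\<integral>\<^sup>+\<omega>. ennreal ((I n r \<omega> - I n s \<omega> - \<beta> n (X s \<omega>) * (w n r \<omega> - w n s \<omega>))\<^sup>2) \<partial>M)
      \<le> ennreal (2 * L\<^sup>2 * (N * (2 * (r - s))) * (r - s))" if sr: "0 \<le> s" "s \<le> r" "r \<le> T" for n s r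
  proof -
    have in0: "s \<in> {0..T}" "r \<in> {0..T}" using sr by auto
    interpret pair_sigma_finite lborel M
      by (intro pair_sigma_finite.intro sigma_finite_measure_axioms lborel.sigma_finite_measure_axioms)
    let ?f = "\<lambda>t \<omega>. ennreal ((\<beta> n (X (clip 0 T t) \<omega>) - \<beta> n (X s \<omega>))\<^sup>2) * indicator {s..r} t"
    note [measurable] = ito_integral_joint_measurable[OF I[of n]] XM[OF in0(1)]
    have "(\<lambda>(t, \<omega>). ?f t \<omega>) \<in> borel_measurable (borel \<Otimes>\<^sub>M M)" by measurable
    then have fm: "(\<lambda>(t, \<omega>). ?f t \<omega>) \<in> borel_measurable (lborel \<Otimes>\<^sub>M M)"
      by (simp cong: measurable_cong_sets sets_pair_measure_cong)
    have "(\<integral>\<^sup>+\<omega>. ennreal ((I n r \<omega> - I n s \<omega> - \<beta> n (X s \<omega>) * (w n r \<omega> - w n s \<omega>))\<^sup>2) \<partial>M)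
      \<le> 2 * (\<integral>\<^sup>+\<omega>. (\<integral>\<^sup>+t\<in>{s..r}. ennreal ((\<beta> n (X t \<omega>) - \<beta> n (X s \<omega>))\<^sup>2) \<partial>lborel) \<partial>M)"
      by (rule L2(1)[OF sr bX[OF in0(1)] b1])
    also have "(\<integral>\<^sup>+\<omega>. (\<integral>\<^sup>+t\<in>{s..r}. ennreal ((\<beta> n (X t \<omega>) - \<beta> n (X s \<omega>))\<^sup>2) \<partial>lborel) \<partial>M)
        = (\<integral>\<^sup>+\<omega>. (\<integral>\<^sup>+t. ?f t \<omega> \<partial>lborel) \<partial>M)"
      using sr by (intro nn_integral_cong) (auto simp: indicator_def clip_eq)
    \<comment> \<open>After the exchange the moment estimate \<open>inc\<close> can be used at each
      fixed time t.\<close>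
    also have "\<dots> = (\<integral>\<^sup>+t. (\<integral>\<^sup>+\<omega>. ?f t \<omega> \<partial>M) \<partial>lborel)"
      by (rule Fubini'[OF fm])
    also have "\<dots> \<le> (\<integral>\<^sup>+t. ennreal (L\<^sup>2 * (N * (2 * (r - s)))) * indicator {s..r} t \<partial>lborel)"
    proof (rule nn_integral_mono)
      fix t
      show "(\<integral>\<^sup>+\<omega>. ?f t \<omega> \<partial>M) \<le> ennreal (L\<^sup>2 * (N * (2 * (r - s)))) * indicator {s..r} t"
      proof (cases "t \<in> {s..r}")
        case True
        then have t: "0 \<le> s" "s \<le> t" "t \<le> T" and t0: "t \<in> {0..T}" using sr by auto
        have "(\<integral>\<^sup>+\<omega>. ?f t \<omega> \<partial>M) \<le> (\<integral>\<^sup>+\<omega>. ennreal (L\<^sup>2) * ennreal ((X t \<omega> - X s \<omega>)\<^sup>2) \<partial>M)"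
        proof (rule nn_integral_mono)
          fix \<omega>
          have "(\<beta> n (X t \<omega>) - \<beta> n (X s \<omega>))\<^sup>2 \<le> (L * \<bar>X t \<omega> - X s \<omega>\<bar>)\<^sup>2"
            using \<beta>(2)[of n "X t \<omega>" "X s \<omega>"] L0 by (intro abs_le_square_iff[THEN iffD1]) simp
          then show "?f t \<omega> \<le> ennreal (L\<^sup>2) * ennreal ((X t \<omega> - X s \<omega>)\<^sup>2)"
            using True t0 by (simp add: clip_eq power_mult_distrib ennreal_mult[symmetric] ennreal_leI)
        qed
        also have "\<dots> = ennreal (L\<^sup>2) * (\<integral>\<^sup>+\<omega>. ennreal ((X t \<omega> - X s \<omega>)\<^sup>2) \<partial>M)"
          using XM[OF t0] XM[OF in0(1)] by (intro nn_integral_cmult) measurable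
        also have "\<dots> \<le> ennreal (L\<^sup>2) * ennreal (N * (2 * (t - s)))" by (intro mult_left_mono inc[OF t]) auto
        also have "\<dots> = ennreal (L\<^sup>2 * (N * (2 * (t - s))))" using N0 t by (simp add: ennreal_mult)
        also have "\<dots> \<le> ennreal (L\<^sup>2 * (N * (2 * (r - s))))"
          using True N0 by (intro ennreal_leI mult_left_mono) auto
        finally show ?thesis using True by simp
      qed simp
    qed
    also have "\<dots> = ennreal (L\<^sup>2 * (N * (2 * (r - s))) * (r - s))"
      using sr N0 by (simp add: nn_integral_cmult_indicator ennreal_mult)
    finally have "(\<integral>\<^sup>+\<omega>. ennreal ((I n r \<omega> - I n s \<omega> - \<beta> n (X s \<omega>) * (w n r \<omega> - w n s \<omega>))\<^sup>2) \<partial>M)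
      \<le> 2 * ennreal (L\<^sup>2 * (N * (2 * (r - s))) * (r - s))" by (simp add: mult_left_mono)
    also have "\<dots> = ennreal (2 * (L\<^sup>2 * (N * (2 * (r - s))) * (r - s)))"
      using sr N0 by (subst ennreal_mult) auto
    also have "2 * (L\<^sup>2 * (N * (2 * (r - s))) * (r - s)) = 2 * L\<^sup>2 * (N * (2 * (r - s))) * (r - s)" by simp
    finally show ?thesis .
  qed
  let ?K = "\<lambda>n t \<omega>. - \<beta> n (X t \<omega>)"
  have rem: "integrable M (\<lambda>\<omega>. (ito_remainder X ?K s r \<omega>)\<^sup>2) \<and>
      expectation (\<lambda>\<omega>. (ito_remainder X ?K s r \<omega>)\<^sup>2) \<le> (N * (4 * L\<^sup>2 * N)) * (r - s)\<^sup>2"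
    if sr: "0 \<le> s" "s \<le> r" "r \<le> T" for s r
  proof -
    have in0: "s \<in> {0..T}" "r \<in> {0..T}" using sr by auto
    let ?G = "\<lambda>n \<omega>. I n r \<omega> - I n s \<omega> - \<beta> n (X s \<omega>) * (w n r \<omega> - w n s \<omega>)"
    note [measurable] = XM[OF in0(1)] XM[OF in0(2)] IM[OF in0(1)] IM[OF in0(2)]
      measurable_F[OF w_measurable[OF in0(1)] in0(1)] measurable_F[OF w_measurable[OF in0(2)] in0(2)]
    have Rm: "(\<lambda>\<omega>. (ito_remainder X ?K s r \<omega>)\<^sup>2) \<in> borel_measurable M"
      unfolding ito_remainder_def by measurable
    have "(\<integral>\<^sup>+\<omega>. ennreal ((ito_remainder X ?K s r \<omega>)\<^sup>2) \<partial>M) = (\<integral>\<^sup>+\<omega>. ennreal ((\<Sum>n\<in>UNIV. ?G n \<omega>)\<^sup>2) \<partial>M)"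
    proof (rule nn_integral_cong_AE)
      show "AE \<omega> in M. ennreal ((ito_remainder X ?K s r \<omega>)\<^sup>2) = ennreal ((\<Sum>n\<in>UNIV. ?G n \<omega>)\<^sup>2)"
        using eq
      proof eventually_elim
        case (elim \<omega>)
        then have "ito_remainder X ?K s r \<omega> = - (\<Sum>n\<in>UNIV. ?G n \<omega>)"
          using in0 by (simp add: ito_remainder_def sum_subtractf sum_negf)
        then show ?case by (simp only: power2_minus)
      qed
    qed
    also have "\<dots> \<le> ennreal (N * (2 * L\<^sup>2 * (N * (2 * (r - s))) * (r - s)))"
      unfolding N_def by (rule nn_integral_sum_square_le, measurable)
        (use rem_n[OF sr] sr N0 in \<open>auto simp: N_def\<close>)
    also have "N * (2 * L\<^sup>2 * (N * (2 * (r - s))) * (r - s)) = (N * (4 * L\<^sup>2 * N)) * (r - s)\<^sup>2"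
      by (simp add: power2_eq_square)
    finally have le: "(\<integral>\<^sup>+\<omega>. ennreal ((ito_remainder X ?K s r \<omega>)\<^sup>2) \<partial>M) \<le> ennreal ((N * (4 * L\<^sup>2 * N)) * (r - s)\<^sup>2)" .
    have i: "integrable M (\<lambda>\<omega>. (ito_remainder X ?K s r \<omega>)\<^sup>2)"
      by (rule integrableI_bounded[OF Rm]) (use le in \<open>auto intro: le_less_trans\<close>)
    with le show ?thesis using N0 by (subst (asm) nn_integral_eq_integral[OF i]) auto
  qed
  have mart: "expectation (\<lambda>\<omega>. Y \<omega> * (X r \<omega> - X s \<omega>)) = 0"
    if sr: "0 \<le> s" "s \<le> r" "r \<le> T" and Y: "Y \<in> borel_measurable (F s)" "\<exists>C. \<forall>\<omega>\<in>space M. \<bar>Y \<omega>\<bar> \<le> C" for s r Y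
  proof -
    have in0: "s \<in> {0..T}" "r \<in> {0..T}" using sr by auto
    obtain E where E: "\<And>\<omega>. \<omega> \<in> space M \<Longrightarrow> \<bar>Y \<omega>\<bar> \<le> E" using Y(2) by auto
    have YM[measurable]: "Y \<in> borel_measurable M" using measurable_F[OF Y(1) in0(1)] .
    note [measurable] = XM[OF in0(1)] XM[OF in0(2)] IM[OF in0(1)] IM[OF in0(2)]
    have iI: "integrable M (\<lambda>\<omega>. I n r \<omega> - I n s \<omega>)" for n
    proof -
      have "(\<integral>\<^sup>+\<omega>. ennreal ((I n r \<omega> - I n s \<omega>)\<^sup>2) \<partial>M) < \<infinity>"
      proof -
        have "(\<integral>\<^sup>+\<omega>. ennreal ((I n r \<omega> - I n s \<omega>)\<^sup>2) \<partial>M)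
            \<le> 2 * (\<integral>\<^sup>+\<omega>. (\<integral>\<^sup>+t\<in>{s..r}. ennreal ((\<beta> n (X t \<omega>))\<^sup>2) \<partial>lborel) \<partial>M)"
          using L2(1)[OF sr, of "\<lambda>_. 0" n] by auto
        also have "\<dots> \<le> 2 * (\<integral>\<^sup>+\<omega>. (\<integral>\<^sup>+t. indicator {s..r} t \<partial>lborel) \<partial>M)"
        proof (intro mult_left_mono nn_integral_mono)
          fix \<omega> t
          have "(\<beta> n (X t \<omega>))\<^sup>2 \<le> 1" using \<beta>(1)[of n "X t \<omega>"] by (simp add: abs_square_le_1)
          then show "ennreal ((\<beta> n (X t \<omega>))\<^sup>2) * indicator {s..r} t \<le> indicator {s..r} t"
            by (auto simp: indicator_def)
        qed simp
        also have "\<dots> < \<infinity>" using sr by (simp add: emeasure_space_1 ennreal_mult_less_top)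
        finally show ?thesis .
      qed
      then have "integrable M (\<lambda>\<omega>. (I n r \<omega> - I n s \<omega>)\<^sup>2)" by (intro integrableI_bounded) auto
      then show ?thesis by (rule integrable_L2_imp_L1) measurable
    qed
    have "expectation (\<lambda>\<omega>. Y \<omega> * (X r \<omega> - X s \<omega>)) = expectation (\<lambda>\<omega>. - (\<Sum>n\<in>UNIV. Y \<omega> * (I n r \<omega> - I n s \<omega>)))"
    proof (rule integral_cong_AE)
      show "AE \<omega> in M. Y \<omega> * (X r \<omega> - X s \<omega>) = - (\<Sum>n\<in>UNIV. Y \<omega> * (I n r \<omega> - I n s \<omega>))"
        using eq
      proof eventually_elim
        case (elim \<omega>)
        then have "X r \<omega> - X s \<omega> = - (\<Sum>n\<in>UNIV. I n r \<omega> - I n s \<omega>)" using in0 by (simp add: sum_subtractf)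
        then show ?case by (simp only: sum_distrib_left[symmetric] mult_minus_right)
      qed
    qed measurable
    also have "\<dots> = - (\<Sum>n\<in>UNIV. expectation (\<lambda>\<omega>. Y \<omega> * (I n r \<omega> - I n s \<omega>)))"
      by (simp add: integrable_mult_bounded[OF iI YM E])
    also have "\<dots> = 0" using L2(2)[OF sr Y] by simp
    finally show ?thesis .
  qed
  have "\<exists>C. \<forall>n. \<forall>t\<in>{0..T}. \<forall>\<omega>\<in>space M. \<bar>?K n t \<omega>\<bar> \<le> C" using \<beta>(1) by auto
  moreover have "\<forall>n. \<forall>t\<in>{0..T}. ?K n t \<in> borel_measurable (F t)" using bX by auto
  ultimately show "ito_expansion X ?K"
    unfolding ito_expansion_def using X rem mart by blast
qed

end

section \<open>Dynkin's formula\<close>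

lemma abs_quadratic_form_le:
  fixes a b c1 c2 c3 D :: real
  assumes "\<bar>c1\<bar> \<le> D" "\<bar>c2\<bar> \<le> D" "\<bar>c3\<bar> \<le> D"
  shows "\<bar>c1 * a\<^sup>2 + 2 * c2 * a * b + c3 * b\<^sup>2\<bar> \<le> D * (\<bar>a\<bar> + \<bar>b\<bar>)\<^sup>2"
proof -
  have "\<bar>c1 * a\<^sup>2 + 2 * c2 * a * b + c3 * b\<^sup>2\<bar> \<le> \<bar>c1\<bar> * \<bar>a\<bar>\<^sup>2 + 2 * (\<bar>c2\<bar> * (\<bar>a\<bar> * \<bar>b\<bar>)) + \<bar>c3\<bar> * \<bar>b\<bar>\<^sup>2"
    by (rule order.trans[OF abs_triangle_ineq add_mono[OF order.trans[OF abs_triangle_ineq add_mono]]])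
       (simp_all add: abs_mult)
  also have "\<dots> \<le> D * \<bar>a\<bar>\<^sup>2 + 2 * (D * (\<bar>a\<bar> * \<bar>b\<bar>)) + D * \<bar>b\<bar>\<^sup>2"
    using assms by (intro add_mono mult_left_mono mult_right_mono) auto
  also have "\<dots> = D * (\<bar>a\<bar> + \<bar>b\<bar>)\<^sup>2" by (simp add: power2_eq_square algebra_simps)
  finally show ?thesis .
qed

lemma abs_cubic_form_le:
  fixes a b c1 c2 c3 c4 D :: real
  assumes "\<bar>c1\<bar> \<le> D" "\<bar>c2\<bar> \<le> D" "\<bar>c3\<bar> \<le> D" "\<bar>c4\<bar> \<le> D"
  shows "\<bar>c1 * a^3 + 3 * c2 * a\<^sup>2 * b + 3 * c3 * a * b\<^sup>2 + c4 * b^3\<bar> \<le> D * (\<bar>a\<bar> + \<bar>b\<bar>)^3"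
proof -
  have "\<bar>c1 * a^3 + 3 * c2 * a\<^sup>2 * b + 3 * c3 * a * b\<^sup>2 + c4 * b^3\<bar>
      \<le> \<bar>c1\<bar> * \<bar>a\<bar>^3 + 3 * (\<bar>c2\<bar> * (\<bar>a\<bar>\<^sup>2 * \<bar>b\<bar>)) + 3 * (\<bar>c3\<bar> * (\<bar>a\<bar> * \<bar>b\<bar>\<^sup>2)) + \<bar>c4\<bar> * \<bar>b\<bar>^3"
  proof -
    have "\<bar>p + q + r + s\<bar> \<le> \<bar>p\<bar> + \<bar>q\<bar> + \<bar>r\<bar> + \<bar>s\<bar>" for p q r s :: real by linarith
    from this[of "c1 * a^3" "3 * c2 * a\<^sup>2 * b" "3 * c3 * a * b\<^sup>2" "c4 * b^3"] show ?thesis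
      by (simp add: abs_mult power_abs mult.assoc)
  qed
  also have "\<dots> \<le> D * \<bar>a\<bar>^3 + 3 * (D * (\<bar>a\<bar>\<^sup>2 * \<bar>b\<bar>)) + 3 * (D * (\<bar>a\<bar> * \<bar>b\<bar>\<^sup>2)) + D * \<bar>b\<bar>^3"
    using assms by (intro add_mono mult_left_mono mult_right_mono) auto
  also have "\<dots> = D * (\<bar>a\<bar> + \<bar>b\<bar>)^3"
  proof -
    have "D * p^3 + 3 * (D * (p\<^sup>2 * q)) + 3 * (D * (p * q\<^sup>2)) + D * q^3 = D * (p + q)^3" for p q
      by (simp add: power2_eq_square power3_eq_cube algebra_simps)
    then show ?thesis .
  qed
  finally show ?thesis .
qed

text \<open>Both bounds in the minimum are used: the main part of an increment over time h has size
  sqrt h and calls for the cubic one, while for the remainder only second moments are controlled,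
  which calls for the quadratic one. Product test functions keep all derivatives
  one-dimensional.\<close>

lemma taylor_product:
  fixes u u1 u2 u3 v v1 v2 v3 :: "real \<Rightarrow> real"
  assumes u: "\<And>z. (u has_real_derivative u1 z) (at z)" "\<And>z. (u1 has_real_derivative u2 z) (at z)"
      "\<And>z. (u2 has_real_derivative u3 z) (at z)"
    and v: "\<And>z. (v has_real_derivative v1 z) (at z)" "\<And>z. (v1 has_real_derivative v2 z) (at z)"
      "\<And>z. (v2 has_real_derivative v3 z) (at z)"
    and ub: "\<And>z. \<bar>u z\<bar> \<le> C" "\<And>z. \<bar>u1 z\<bar> \<le> C" "\<And>z. \<bar>u2 z\<bar> \<le> C" "\<And>z. \<bar>u3 z\<bar> \<le> C"
    and vb: "\<And>z. \<bar>v z\<bar> \<le> C" "\<And>z. \<bar>v1 z\<bar> \<le> C" "\<And>z. \<bar>v2 z\<bar> \<le> C" "\<And>z. \<bar>v3 z\<bar> \<le> C"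
  shows "\<bar>u (x + a) * v (y + b) - u x * v y - (u1 x * v y * a + u x * v1 y * b)
      - (u2 x * v y * a\<^sup>2 + 2 * (u1 x * v1 y) * a * b + u x * v2 y * b\<^sup>2) / 2\<bar>
    \<le> C\<^sup>2 * min ((\<bar>a\<bar> + \<bar>b\<bar>)\<^sup>2) ((\<bar>a\<bar> + \<bar>b\<bar>)^3)"
proof -
  let ?U = "\<lambda>f \<tau>. f (x + \<tau> * a)" and ?V = "\<lambda>f \<tau>. f (y + \<tau> * b)"
  \<comment> \<open>The product along the segment from (x, y) to (x + a, y + b); \<open>p1\<close>,
    \<open>p2\<close> and \<open>p3\<close> are its successive derivatives in the parameter, with
    binomial coefficients.\<close>
  define p0 where "p0 \<tau> = ?U u \<tau> * ?V v \<tau>" for \<tau>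
  define p1 where "p1 \<tau> = ?U u1 \<tau> * ?V v \<tau> * a + ?U u \<tau> * ?V v1 \<tau> * b" for \<tau>
  define p2 where "p2 \<tau> = ?U u2 \<tau> * ?V v \<tau> * a\<^sup>2 + 2 * (?U u1 \<tau> * ?V v1 \<tau>) * a * b + ?U u \<tau> * ?V v2 \<tau> * b\<^sup>2" for \<tau>
  define p3 where "p3 \<tau> = ?U u3 \<tau> * ?V v \<tau> * a^3 + 3 * (?U u2 \<tau> * ?V v1 \<tau>) * a\<^sup>2 * b
    + 3 * (?U u1 \<tau> * ?V v2 \<tau>) * a * b\<^sup>2 + ?U u \<tau> * ?V v3 \<tau> * b^3" for \<tau>
  have U: "(?U f has_real_derivative f' (x + t * a) * a) (at t)" if "\<And>z. (f has_real_derivative f' z) (at z)" for f f' t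
    by (rule DERIV_chain2[OF that]) (auto intro!: derivative_eq_intros)
  have V: "(?V f has_real_derivative f' (y + t * b) * b) (at t)" if "\<And>z. (f has_real_derivative f' z) (at z)" for f f' t
    by (rule DERIV_chain2[OF that]) (auto intro!: derivative_eq_intros)
  note UV = U[OF u(1)] U[OF u(2)] U[OF u(3)] V[OF v(1)] V[OF v(2)] V[OF v(3)]
  have d0: "(p0 has_real_derivative p1 t) (at t)" for t
    unfolding p0_def[abs_def] p1_def
    by (rule derivative_eq_intros UV refl | simp)+
  have d1: "(p1 has_real_derivative p2 t) (at t)" for t
    unfolding p1_def[abs_def] p2_def
    by (rule derivative_eq_intros UV refl)+ (simp add: power2_eq_square algebra_simps)
  have d2: "(p2 has_real_derivative p3 t) (at t)" for t
    unfolding p2_def[abs_def] p3_def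
    by (rule derivative_eq_intros UV refl)+ (simp add: power2_eq_square power3_eq_cube algebra_simps)
  have prod: "\<bar>f * g\<bar> \<le> C\<^sup>2" if "\<bar>f\<bar> \<le> C" "\<bar>g\<bar> \<le> C" for f g
    using that by (simp add: abs_mult power2_eq_square) (intro mult_mono, auto)
  have b2: "\<bar>p2 t\<bar> \<le> C\<^sup>2 * (\<bar>a\<bar> + \<bar>b\<bar>)\<^sup>2" for t
    unfolding p2_def by (intro abs_quadratic_form_le prod ub vb)
  have b3: "\<bar>p3 t\<bar> \<le> C\<^sup>2 * (\<bar>a\<bar> + \<bar>b\<bar>)^3" for t
    unfolding p3_def by (intro abs_cubic_form_le prod ub vb)
  let ?d = "\<lambda>m::nat. if m = 0 then p0 else if m = 1 then p1 else if m = 2 then p2 else p3"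
  have dS: "\<forall>m t. m < 3 \<and> 0 \<le> t \<and> t \<le> 1 \<longrightarrow> DERIV (?d m) t :> ?d (Suc m) t"
  proof (intro allI impI)
    fix m :: nat and t :: real assume "m < 3 \<and> 0 \<le> t \<and> t \<le> 1"
    then have "m = 0 \<or> m = 1 \<or> m = 2" by auto
    then show "DERIV (?d m) t :> ?d (Suc m) t" using d0 d1 d2 by auto
  qed
  \<comment> \<open>The third-order formula yields the cubic bound. The second-order one below
    yields the quadratic bound: after subtracting half of \<open>p2 0\<close> the error is half a
    difference of two values of \<open>p2\<close>.\<close>
  obtain t where t: "p0 1 = (\<Sum>m<3. ?d m 0 / fact m * 1 ^ m) + ?d 3 t / fact 3 * 1 ^ 3"
    using Maclaurin[of 1 3 ?d p0, OF _ _ _ dS] by auto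
  obtain t' where t': "p0 1 = (\<Sum>m<2. ?d m 0 / fact m * 1 ^ m) + ?d 2 t' / fact 2 * 1 ^ 2"
    using Maclaurin[of 1 2 ?d p0] dS by auto
  have e3: "p0 1 - p0 0 - p1 0 - p2 0 / 2 = p3 t / 6"
    using t by (simp add: numeral_3_eq_3 fact_numeral)
  have e2: "p0 1 - p0 0 - p1 0 - p2 0 / 2 = (p2 t' - p2 0) / 2"
    using t' by (simp add: numeral_2_eq_2 field_simps)
  have "\<bar>p0 1 - p0 0 - p1 0 - p2 0 / 2\<bar> \<le> C\<^sup>2 * (\<bar>a\<bar> + \<bar>b\<bar>)^3"
    unfolding e3 using b3[of t] by (auto simp: abs_le_iff)
  moreover have "\<bar>p0 1 - p0 0 - p1 0 - p2 0 / 2\<bar> \<le> C\<^sup>2 * (\<bar>a\<bar> + \<bar>b\<bar>)\<^sup>2"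
  proof -
    have "\<bar>(x - y) / 2\<bar> \<le> B" if "\<bar>x\<bar> \<le> B" "\<bar>y\<bar> \<le> B" for x y B :: real using that by (auto simp: abs_le_iff)
    from this[OF b2 b2] show ?thesis unfolding e2 .
  qed
  ultimately have "\<bar>p0 1 - p0 0 - p1 0 - p2 0 / 2\<bar> \<le> C\<^sup>2 * min ((\<bar>a\<bar> + \<bar>b\<bar>)\<^sup>2) ((\<bar>a\<bar> + \<bar>b\<bar>)^3)"
    by (simp add: min_def)
  then show ?thesis by (simp add: p0_def p1_def p2_def)
qed

text \<open>N and R are main part and remainder of the two increments, and q stands for sqrt h.
  Since n has size q and R has size q^2, each of the three terms on the right has expectation of
  order h q; the weights come from Young's inequality with parameter q. S is an upper bound for q
  that absorbs R^2 into R^2 / q.\<close>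

lemma taylor_error_bound:
  fixes C q S c1 c2 c3 A N1 R1 N2 R2 :: real
  assumes A: "\<bar>A - (c1 * (N1 + R1)\<^sup>2 + 2 * c2 * (N1 + R1) * (N2 + R2) + c3 * (N2 + R2)\<^sup>2) / 2\<bar>
      \<le> C * min ((\<bar>N1 + R1\<bar> + \<bar>N2 + R2\<bar>)\<^sup>2) ((\<bar>N1 + R1\<bar> + \<bar>N2 + R2\<bar>)^3)"
    and c: "\<bar>c1\<bar> \<le> C" "\<bar>c2\<bar> \<le> C" "\<bar>c3\<bar> \<le> C" and q: "0 < q" "q \<le> S" and n: "\<bar>N1\<bar> + \<bar>N2\<bar> \<le> n"
  shows "\<bar>A - (c1 * N1\<^sup>2 + 2 * c2 * N1 * N2 + c3 * N2\<^sup>2) / 2\<bar>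
    \<le> C * (5 * q * n\<^sup>2 + 4 * n ^ 4 / q + 2 * (1 + 5 * S) * (R1\<^sup>2 + R2\<^sup>2) / q)"
proof -
  define \<rho> where "\<rho> = \<bar>R1\<bar> + \<bar>R2\<bar>"
  define m where "m = \<bar>N1 + R1\<bar> + \<bar>N2 + R2\<bar>"
  have C0: "0 \<le> C" using c(1) by linarith
  have n0: "0 \<le> n" and \<rho>0: "0 \<le> \<rho>" and m0: "0 \<le> m" using n by (auto simp: \<rho>_def m_def)
  have mn: "m \<le> n + \<rho>" using n unfolding m_def \<rho>_def by linarith
  \<comment> \<open>If \<rho> is at most n, the total is at most 2 n and the cube is used; otherwise
    it is at most 2 \<rho> and the square is used. No moment of R beyond the second appears.\<close>
  have min: "min (m\<^sup>2) (m^3) \<le> 8 * n^3 + 4 * \<rho>\<^sup>2"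
  proof (cases "\<rho> \<le> n")
    case True
    then have "m^3 \<le> (2 * n)^3" using mn m0 by (intro power_mono) auto
    then have "m^3 \<le> 8 * n^3" by (simp add: power_mult_distrib)
    moreover have "0 \<le> 4 * \<rho>\<^sup>2" by simp
    ultimately show ?thesis by (intro min.coboundedI2) linarith
  next
    case False
    then have "m\<^sup>2 \<le> (2 * \<rho>)\<^sup>2" using mn m0 by (intro power_mono) auto
    then have "m\<^sup>2 \<le> 4 * \<rho>\<^sup>2" by (simp add: power_mult_distrib)
    then show ?thesis using zero_le_power[OF n0, of 3] by (intro min.coboundedI1) linarith
  qed
  let ?q1 = "c1 * (N1 + R1)\<^sup>2 + 2 * c2 * (N1 + R1) * (N2 + R2) + c3 * (N2 + R2)\<^sup>2"
  let ?q0 = "c1 * N1\<^sup>2 + 2 * c2 * N1 * N2 + c3 * N2\<^sup>2"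
  have "?q1 - ?q0 = c1 * (2 * N1 * R1 + R1\<^sup>2) + 2 * c2 * (N1 * R2 + R1 * N2 + R1 * R2) + c3 * (2 * N2 * R2 + R2\<^sup>2)"
    by (simp add: power2_eq_square algebra_simps)
  also have "\<bar>\<dots>\<bar> \<le> C * (2 * (\<bar>N1\<bar> * \<bar>R1\<bar>) + \<bar>R1\<bar>\<^sup>2) + 2 * (C * (\<bar>N1\<bar> * \<bar>R2\<bar> + \<bar>R1\<bar> * \<bar>N2\<bar> + \<bar>R1\<bar> * \<bar>R2\<bar>)) + C * (2 * (\<bar>N2\<bar> * \<bar>R2\<bar>) + \<bar>R2\<bar>\<^sup>2)"
  proof -
    have t: "\<bar>x * y\<bar> \<le> C * z" if "\<bar>x\<bar> \<le> C" "\<bar>y\<bar> \<le> z" for x y z :: real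
      using that C0 by (simp add: abs_mult mult_mono)
    have "\<bar>2 * N1 * R1 + R1\<^sup>2\<bar> \<le> 2 * (\<bar>N1\<bar> * \<bar>R1\<bar>) + \<bar>R1\<bar>\<^sup>2" "\<bar>2 * N2 * R2 + R2\<^sup>2\<bar> \<le> 2 * (\<bar>N2\<bar> * \<bar>R2\<bar>) + \<bar>R2\<bar>\<^sup>2"
      by (rule order.trans[OF abs_triangle_ineq]; simp add: abs_mult)+
    moreover have "\<bar>N1 * R2 + R1 * N2 + R1 * R2\<bar> \<le> \<bar>N1\<bar> * \<bar>R2\<bar> + \<bar>R1\<bar> * \<bar>N2\<bar> + \<bar>R1\<bar> * \<bar>R2\<bar>"
      unfolding abs_mult[symmetric] by linarith
    ultimately have "\<bar>c1 * (2 * N1 * R1 + R1\<^sup>2)\<bar> \<le> C * (2 * (\<bar>N1\<bar> * \<bar>R1\<bar>) + \<bar>R1\<bar>\<^sup>2)"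
      "\<bar>c3 * (2 * N2 * R2 + R2\<^sup>2)\<bar> \<le> C * (2 * (\<bar>N2\<bar> * \<bar>R2\<bar>) + \<bar>R2\<bar>\<^sup>2)"
      "\<bar>c2 * (N1 * R2 + R1 * N2 + R1 * R2)\<bar> \<le> C * (\<bar>N1\<bar> * \<bar>R2\<bar> + \<bar>R1\<bar> * \<bar>N2\<bar> + \<bar>R1\<bar> * \<bar>R2\<bar>)"
      using t c by blast+
    moreover have "\<bar>x + 2 * y + z\<bar> \<le> X + 2 * Y + Z" if "\<bar>x\<bar> \<le> X" "\<bar>z\<bar> \<le> Z" "\<bar>y\<bar> \<le> Y" for x y z X Y Z :: real
      using that by linarith
    ultimately show ?thesis unfolding mult.assoc[of 2 c2] by blast
  qed
  also have "\<dots> = C * (2 * ((\<bar>N1\<bar> + \<bar>N2\<bar>) * \<rho>) + \<rho>\<^sup>2)"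
    unfolding \<rho>_def by (simp add: power2_eq_square algebra_simps)
  also have "\<dots> \<le> C * (2 * (n * \<rho>) + \<rho>\<^sup>2)"
    using n \<rho>0 C0 by (intro mult_left_mono add_mono mult_right_mono) auto
  finally have qd: "\<bar>?q1 - ?q0\<bar> \<le> C * (2 * (n * \<rho>) + \<rho>\<^sup>2)" .
  have "\<bar>A - ?q0 / 2\<bar> \<le> \<bar>A - ?q1 / 2\<bar> + \<bar>?q1 - ?q0\<bar> / 2" by (simp add: abs_if field_simps)
  also have "\<dots> \<le> C * (8 * n^3 + 4 * \<rho>\<^sup>2) + C * (2 * (n * \<rho>) + \<rho>\<^sup>2) / 2"
  proof -
    have "\<bar>x\<bar> + \<bar>y\<bar> / 2 \<le> Q + R / 2" if "\<bar>x\<bar> \<le> P" "P \<le> Q" "\<bar>y\<bar> \<le> R" for x y P Q R :: real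
      using that by simp
    from this[OF A[folded m_def] mult_left_mono[OF min C0] qd] show ?thesis .
  qed
  also have "\<dots> = C * (8 * n^3 + 9/2 * \<rho>\<^sup>2 + n * \<rho>)" by (simp add: field_simps)
  also have "\<dots> \<le> C * (5 * q * n\<^sup>2 + 4 * n ^ 4 / q + 2 * (1 + 5 * S) * (R1\<^sup>2 + R2\<^sup>2) / q)"
  proof (rule mult_left_mono[OF _ C0])
    \<comment> \<open>Weighted AM-GM, used for the pair (n, n^2) to treat the cube and for (n,
      \<rho>) to treat the mixed term.\<close>
    have am: "2 * (x * y) \<le> q * x\<^sup>2 + y\<^sup>2 / q" for x y :: real
    proof -
      have "0 \<le> (q * x - y)\<^sup>2 / q" using q by simp
      also have "\<dots> = q * x\<^sup>2 + y\<^sup>2 / q - 2 * (x * y)"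
        using q by (simp add: power2_eq_square field_simps)
      finally show ?thesis by simp
    qed
    have 1: "2 * n^3 \<le> q * n\<^sup>2 + n^4 / q"
      using am[of n "n\<^sup>2"] by (simp add: power3_eq_cube power2_eq_square power4_eq_xxxx mult.assoc)
    have 2: "2 * (n * \<rho>) \<le> q * n\<^sup>2 + \<rho>\<^sup>2 / q" by (rule am)
    have 3: "\<rho>\<^sup>2 \<le> S * (\<rho>\<^sup>2 / q)"
    proof -
      have "q * (\<rho>\<^sup>2 / q) \<le> S * (\<rho>\<^sup>2 / q)" using q by (intro mult_right_mono) auto
      then show ?thesis using q by simp
    qed
    have 4: "\<rho>\<^sup>2 \<le> 2 * (R1\<^sup>2 + R2\<^sup>2)"
      using zero_le_power2[of "\<bar>R1\<bar> - \<bar>R2\<bar>"] by (simp add: \<rho>_def power2_diff power2_sum)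
    have S0: "0 \<le> S" using q by simp
    have "(1 + 5 * S) * (\<rho>\<^sup>2 / q) \<le> (1 + 5 * S) * (2 * (R1\<^sup>2 + R2\<^sup>2) / q)"
      using 4 q S0 by (intro mult_left_mono divide_right_mono) auto
    moreover have "8 * n^3 + 9/2 * \<rho>\<^sup>2 + n * \<rho> \<le> 5 * (q * n\<^sup>2) + 4 * (n ^ 4 / q) + (1 + 5 * S) * (\<rho>\<^sup>2 / q)"
    proof -
      have "8 * a + 9/2 * b + c \<le> 5 * x + 4 * y + (1 + 5 * S) * z"
        if "2 * a \<le> x + y" "2 * c \<le> x + z" "b \<le> S * z" "0 \<le> x" "0 \<le> z" "0 \<le> S * z" for a b c x y z :: real
        using that unfolding distrib_right by simp
      from this[OF 1 2 3] show ?thesis using q S0 by simp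
    qed
    ultimately have le: "8 * n^3 + 9/2 * \<rho>\<^sup>2 + n * \<rho> \<le> 5 * (q * n\<^sup>2) + 4 * (n ^ 4 / q) + (1 + 5 * S) * (2 * (R1\<^sup>2 + R2\<^sup>2) / q)"
      by linarith
    have "5 * (q * n\<^sup>2) = 5 * q * n\<^sup>2" "4 * (n ^ 4 / q) = 4 * n ^ 4 / q"
      "(1 + 5 * S) * (2 * (R1\<^sup>2 + R2\<^sup>2) / q) = 2 * (1 + 5 * S) * (R1\<^sup>2 + R2\<^sup>2) / q"
      by (simp_all add: algebra_simps)
    with le show "8 * n^3 + 9/2 * \<rho>\<^sup>2 + n * \<rho> \<le> 5 * q * n\<^sup>2 + 4 * n ^ 4 / q + 2 * (1 + 5 * S) * (R1\<^sup>2 + R2\<^sup>2) / q"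
      by (simp only:)
  qed
  finally show ?thesis .
qed

context brownian_system
begin

text \<open>Conditional Ito isometry for coefficients frozen at s. Equal indices contribute r - s
  because squared increments are independent of the past; different indices vanish by
  \<open>expectation_mult_increments\<close>.\<close>

lemma expectation_quadratic:
  assumes sr: "0 \<le> s" "s \<le> r" "r \<le> T"
    and Y: "Y \<in> borel_measurable (F s)" "\<And>\<omega>. \<omega> \<in> space M \<Longrightarrow> \<bar>Y \<omega>\<bar> \<le> C"
    and G: "\<And>n. G n \<in> borel_measurable (F s)" "\<And>n \<omega>. \<omega> \<in> space M \<Longrightarrow> \<bar>G n \<omega>\<bar> \<le> D"
    and H: "\<And>n. H n \<in> borel_measurable (F s)" "\<And>n \<omega>. \<omega> \<in> space M \<Longrightarrow> \<bar>H n \<omega>\<bar> \<le> E"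
  shows "integrable M (\<lambda>\<omega>. Y \<omega> * ((\<Sum>n\<in>UNIV. G n \<omega> * (w n r \<omega> - w n s \<omega>)) * (\<Sum>n\<in>UNIV. H n \<omega> * (w n r \<omega> - w n s \<omega>))))"
    "integrable M (\<lambda>\<omega>. Y \<omega> * (\<Sum>n\<in>UNIV. G n \<omega> * H n \<omega>))"
    "expectation (\<lambda>\<omega>. Y \<omega> * ((\<Sum>n\<in>UNIV. G n \<omega> * (w n r \<omega> - w n s \<omega>)) * (\<Sum>n\<in>UNIV. H n \<omega> * (w n r \<omega> - w n s \<omega>))))
      = (r - s) * expectation (\<lambda>\<omega>. Y \<omega> * (\<Sum>n\<in>UNIV. G n \<omega> * H n \<omega>))"
proof -
  have s: "s \<in> {0..T}" using sr by auto
  let ?D = "\<lambda>n \<omega>. w n r \<omega> - w n s \<omega>"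
  let ?c = "\<lambda>n m \<omega>. Y \<omega> * G n \<omega> * H m \<omega>"
  have cm: "?c n m \<in> borel_measurable (F s)" for n m
    using Y(1) G(1) H(1) by measurable
  have cM: "?c n m \<in> borel_measurable M" for n m using measurable_F[OF cm s] .
  have cb: "\<bar>?c n m \<omega>\<bar> \<le> C * D * E" if "\<omega> \<in> space M" for n m \<omega>
    unfolding abs_mult using Y(2)[OF that] G(2)[OF that, of n] H(2)[OF that, of m]
    by (intro mult_mono mult_nonneg_nonneg) (auto intro: order.trans[OF abs_ge_zero])
  have ci: "integrable M (?c n m)" for n m by (rule integrable_bounded[OF cM cb])
  have nm: "integrable M (\<lambda>\<omega>. ?c n m \<omega> * (?D n \<omega> * ?D m \<omega>)) \<and>
    expectation (\<lambda>\<omega>. ?c n m \<omega> * (?D n \<omega> * ?D m \<omega>)) = (if n = m then (r - s) * expectation (?c n m) else 0)" for n m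
  proof (cases "n = m")
    case True
    then show ?thesis
      using expectation_mult_increment(3,4)[OF brownian sr cm ci, of n n m] by (simp add: power2_eq_square mult.commute)
  next
    case False
    have "integrable M (\<lambda>\<omega>. ?D n \<omega> * ?D m \<omega>)"
      using integrable_increment_products(2)[OF sr False sr] .
    from integrable_mult_bounded[OF this cM cb] expectation_mult_increments[OF sr False cm cb] False
    show ?thesis by simp
  qed
  have eq: "Y \<omega> * ((\<Sum>n\<in>UNIV. G n \<omega> * ?D n \<omega>) * (\<Sum>n\<in>UNIV. H n \<omega> * ?D n \<omega>))
    = (\<Sum>n\<in>UNIV. \<Sum>m\<in>UNIV. ?c n m \<omega> * (?D n \<omega> * ?D m \<omega>))" for \<omega>
    by (subst sum_product) (simp add: sum_distrib_left mult_ac)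
  have eq2: "Y \<omega> * (\<Sum>n\<in>UNIV. G n \<omega> * H n \<omega>) = (\<Sum>n\<in>UNIV. ?c n n \<omega>)" for \<omega>
    unfolding sum_distrib_left by (intro sum.cong refl) (simp add: mult_ac)
  show "integrable M (\<lambda>\<omega>. Y \<omega> * ((\<Sum>n\<in>UNIV. G n \<omega> * ?D n \<omega>) * (\<Sum>n\<in>UNIV. H n \<omega> * ?D n \<omega>)))"
    unfolding eq by (intro Bochner_Integration.integrable_sum) (use nm in blast)
  show "integrable M (\<lambda>\<omega>. Y \<omega> * (\<Sum>n\<in>UNIV. G n \<omega> * H n \<omega>))"
    unfolding eq2 by (intro Bochner_Integration.integrable_sum ci)
  have "expectation (\<lambda>\<omega>. Y \<omega> * ((\<Sum>n\<in>UNIV. G n \<omega> * ?D n \<omega>) * (\<Sum>n\<in>UNIV. H n \<omega> * ?D n \<omega>)))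
    = (\<Sum>n\<in>UNIV. \<Sum>m\<in>UNIV. if n = m then (r - s) * expectation (?c n m) else 0)"
    unfolding eq by (subst integral_sum_sum) (use nm in \<open>auto intro!: sum.cong\<close>)
  also have "\<dots> = (r - s) * (\<Sum>n\<in>UNIV. expectation (?c n n))"
    by (simp add: sum_distrib_left)
  also have "\<dots> = (r - s) * expectation (\<lambda>\<omega>. Y \<omega> * (\<Sum>n\<in>UNIV. G n \<omega> * H n \<omega>))"
    unfolding eq2 by (subst Bochner_Integration.integral_sum) (auto intro: ci)
  finally show "expectation (\<lambda>\<omega>. Y \<omega> * ((\<Sum>n\<in>UNIV. G n \<omega> * ?D n \<omega>) * (\<Sum>n\<in>UNIV. H n \<omega> * ?D n \<omega>)))
    = (r - s) * expectation (\<lambda>\<omega>. Y \<omega> * (\<Sum>n\<in>UNIV. G n \<omega> * H n \<omega>))" .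
qed

text \<open>Cauchy-Schwarz, once for the square and twice for the fourth power.\<close>

lemma abs_increments_power_le:
  fixes d :: "'n \<Rightarrow> real"
  shows "(\<Sum>n\<in>UNIV. \<bar>d n\<bar>)\<^sup>2 \<le> real CARD('n) * (\<Sum>n\<in>UNIV. (d n)\<^sup>2)"
    "(\<Sum>n\<in>UNIV. \<bar>d n\<bar>) ^ 4 \<le> real CARD('n) ^ 3 * (\<Sum>n\<in>UNIV. (d n) ^ 4)"
proof -
  show 1: "(\<Sum>n\<in>UNIV. \<bar>d n\<bar>)\<^sup>2 \<le> real CARD('n) * (\<Sum>n\<in>UNIV. (d n)\<^sup>2)"
    using sum_squared_le_sum_of_squares[of "\<lambda>n. \<bar>d n\<bar>" UNIV] by (simp add: mult.commute)
  have "((\<Sum>n\<in>UNIV. \<bar>d n\<bar>)\<^sup>2)\<^sup>2 \<le> (real CARD('n) * (\<Sum>n\<in>UNIV. (d n)\<^sup>2))\<^sup>2"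
    using 1 by (intro power_mono) auto
  also have "\<dots> = (real CARD('n))\<^sup>2 * (\<Sum>n\<in>UNIV. (d n)\<^sup>2)\<^sup>2" by (simp add: power_mult_distrib)
  also have "\<dots> \<le> (real CARD('n))\<^sup>2 * ((\<Sum>n\<in>UNIV. ((d n)\<^sup>2)\<^sup>2) * real CARD('n))"
    by (intro mult_left_mono sum_squared_le_sum_of_squares) auto
  finally show "(\<Sum>n\<in>UNIV. \<bar>d n\<bar>) ^ 4 \<le> real CARD('n) ^ 3 * (\<Sum>n\<in>UNIV. (d n) ^ 4)"
    by (simp add: power2_eq_square power3_eq_cube power4_eq_xxxx mult_ac)
qed

text \<open>The first-order Taylor terms have mean zero, the mixed second-order term vanishes
  because \<open>orth\<close> separates the motions driving the two processes, and the pure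
  second-order terms give r - s times the generator. The error of order (r - s)^(3/2) is small
  enough to differentiate in time.\<close>

lemma dynkin_step:
  fixes u u1 u2 u3 v v1 v2 v3 :: "real \<Rightarrow> real"
  assumes Z1: "ito_expansion Z1 K1" and Z2: "ito_expansion Z2 K2"
    and orth: "\<And>n t \<omega>. t \<in> {0..T} \<Longrightarrow> \<omega> \<in> space M \<Longrightarrow> K1 n t \<omega> * K2 n t \<omega> = 0"
    and u: "\<And>z. (u has_real_derivative u1 z) (at z)" "\<And>z. (u1 has_real_derivative u2 z) (at z)"
      "\<And>z. (u2 has_real_derivative u3 z) (at z)"
    and v: "\<And>z. (v has_real_derivative v1 z) (at z)" "\<And>z. (v1 has_real_derivative v2 z) (at z)"
      "\<And>z. (v2 has_real_derivative v3 z) (at z)"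
    and ub: "\<And>z. \<bar>u z\<bar> \<le> C" "\<And>z. \<bar>u1 z\<bar> \<le> C" "\<And>z. \<bar>u2 z\<bar> \<le> C" "\<And>z. \<bar>u3 z\<bar> \<le> C"
    and vb: "\<And>z. \<bar>v z\<bar> \<le> C" "\<And>z. \<bar>v1 z\<bar> \<le> C" "\<And>z. \<bar>v2 z\<bar> \<le> C" "\<And>z. \<bar>v3 z\<bar> \<le> C"
  shows "\<exists>B. \<forall>s r. 0 \<le> s \<longrightarrow> s < r \<longrightarrow> r \<le> T \<longrightarrow>
    \<bar>expectation (\<lambda>\<omega>. u (Z1 r \<omega>) * v (Z2 r \<omega>)) - expectation (\<lambda>\<omega>. u (Z1 s \<omega>) * v (Z2 s \<omega>))
      - (r - s) * expectation (\<lambda>\<omega>. (u2 (Z1 s \<omega>) * v (Z2 s \<omega>) * (\<Sum>n\<in>UNIV. (K1 n s \<omega>)\<^sup>2)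
          + u (Z1 s \<omega>) * v2 (Z2 s \<omega>) * (\<Sum>n\<in>UNIV. (K2 n s \<omega>)\<^sup>2)) / 2)\<bar>
    \<le> B * ((r - s) * sqrt (r - s))"
proof -
  have cont: "f \<in> borel_measurable borel" if "\<And>z. (f has_real_derivative f' z) (at z)" for f f' :: "real \<Rightarrow> real"
    using that by (intro borel_measurable_continuous_onI DERIV_continuous_on) (auto intro: has_field_derivative_at_within)
  have u2m: "u2 \<in> borel_measurable borel" "v2 \<in> borel_measurable borel" using cont[OF u(3)] cont[OF v(3)] .
  note [measurable] = cont[OF u(1)] cont[OF u(2)] cont[OF v(1)] cont[OF v(2)] u2m
  obtain D1 where D1: "0 \<le> D1" "\<And>n t \<omega>. t \<in> {0..T} \<Longrightarrow> \<omega> \<in> space M \<Longrightarrow> \<bar>K1 n t \<omega>\<bar> \<le> D1"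
    using ito_expansion_bounded[OF Z1] by blast
  obtain D2 where D2: "0 \<le> D2" "\<And>n t \<omega>. t \<in> {0..T} \<Longrightarrow> \<omega> \<in> space M \<Longrightarrow> \<bar>K2 n t \<omega>\<bar> \<le> D2"
    using ito_expansion_bounded[OF Z2] by blast
  obtain E1 where E1: "0 \<le> E1" "\<And>s r. 0 \<le> s \<Longrightarrow> s \<le> r \<Longrightarrow> r \<le> T \<Longrightarrow> integrable M (\<lambda>\<omega>. (ito_remainder Z1 K1 s r \<omega>)\<^sup>2)"
    "\<And>s r. 0 \<le> s \<Longrightarrow> s \<le> r \<Longrightarrow> r \<le> T \<Longrightarrow> expectation (\<lambda>\<omega>. (ito_remainder Z1 K1 s r \<omega>)\<^sup>2) \<le> E1 * (r - s)\<^sup>2"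
    using ito_expansion_remainder[OF Z1] by blast
  obtain E2 where E2: "0 \<le> E2" "\<And>s r. 0 \<le> s \<Longrightarrow> s \<le> r \<Longrightarrow> r \<le> T \<Longrightarrow> integrable M (\<lambda>\<omega>. (ito_remainder Z2 K2 s r \<omega>)\<^sup>2)"
    "\<And>s r. 0 \<le> s \<Longrightarrow> s \<le> r \<Longrightarrow> r \<le> T \<Longrightarrow> expectation (\<lambda>\<omega>. (ito_remainder Z2 K2 s r \<omega>)\<^sup>2) \<le> E2 * (r - s)\<^sup>2"
    using ito_expansion_remainder[OF Z2] by blast
  define N where "N = real CARD('n)"
  define K where "K = D1 + D2"
  define S where "S = sqrt T"
  \<comment> \<open>Collects the three terms of \<open>taylor_error_bound\<close>, with \<Sum> d^2
    and \<Sum> d^4 having means N h and 3 N h^2; the remaining factors N and N^3 come from bounding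
    powers of \<Sum> |d| by sums of powers.\<close>
  define B where "B = C\<^sup>2 * (5 * (K\<^sup>2 * N * N) + 4 * (K ^ 4 * N ^ 3 * (N * 3)) + 2 * (1 + 5 * S) * (E1 + E2))"
  have C0: "0 \<le> C" using ub(1)[of 0] by linarith
  have "\<bar>expectation (\<lambda>\<omega>. u (Z1 r \<omega>) * v (Z2 r \<omega>)) - expectation (\<lambda>\<omega>. u (Z1 s \<omega>) * v (Z2 s \<omega>))
      - (r - s) * expectation (\<lambda>\<omega>. (u2 (Z1 s \<omega>) * v (Z2 s \<omega>) * (\<Sum>n\<in>UNIV. (K1 n s \<omega>)\<^sup>2)
          + u (Z1 s \<omega>) * v2 (Z2 s \<omega>) * (\<Sum>n\<in>UNIV. (K2 n s \<omega>)\<^sup>2)) / 2)\<bar>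
    \<le> B * ((r - s) * sqrt (r - s))" if s0: "0 \<le> s" and sr': "s < r" and rT: "r \<le> T" for s r
  proof -
    have sr: "0 \<le> s" "s \<le> r" "r \<le> T" and st: "s \<in> {0..T}" and rt: "r \<in> {0..T}" using s0 sr' rT by auto
    define h where "h = r - s"
    define q where "q = sqrt h"
    have h: "0 < h" and q: "0 < q" "q \<le> S" using sr' s0 rT by (auto simp: h_def q_def S_def)
    have qq: "q * q = h" using h by (simp add: q_def)
    let ?N1 = "\<lambda>\<omega>. \<Sum>n\<in>UNIV. K1 n s \<omega> * (w n r \<omega> - w n s \<omega>)" and ?N2 = "\<lambda>\<omega>. \<Sum>n\<in>UNIV. K2 n s \<omega> * (w n r \<omega> - w n s \<omega>)"
    let ?R1 = "ito_remainder Z1 K1 s r" and ?R2 = "ito_remainder Z2 K2 s r"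
    let ?n = "\<lambda>\<omega>. \<Sum>n\<in>UNIV. \<bar>w n r \<omega> - w n s \<omega>\<bar>"
    let ?Y1 = "\<lambda>\<omega>. u1 (Z1 s \<omega>) * v (Z2 s \<omega>)" and ?Y2 = "\<lambda>\<omega>. u (Z1 s \<omega>) * v1 (Z2 s \<omega>)"
    let ?c1 = "\<lambda>\<omega>. u2 (Z1 s \<omega>) * v (Z2 s \<omega>)" and ?c2 = "\<lambda>\<omega>. u1 (Z1 s \<omega>) * v1 (Z2 s \<omega>)"
      and ?c3 = "\<lambda>\<omega>. u (Z1 s \<omega>) * v2 (Z2 s \<omega>)"
    \<comment> \<open>The first-order term keeps the full increments, remainder included: the
      remainder alone is of order h there, and only the martingale property of the whole increment
      disposes of it.\<close>
    let ?A = "\<lambda>\<omega>. u (Z1 r \<omega>) * v (Z2 r \<omega>) - u (Z1 s \<omega>) * v (Z2 s \<omega>)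
      - (?Y1 \<omega> * (Z1 r \<omega> - Z1 s \<omega>) + ?Y2 \<omega> * (Z2 r \<omega> - Z2 s \<omega>))"
    let ?Q = "\<lambda>\<omega>. (?c1 \<omega> * (?N1 \<omega>)\<^sup>2 + 2 * ?c2 \<omega> * ?N1 \<omega> * ?N2 \<omega> + ?c3 \<omega> * (?N2 \<omega>)\<^sup>2) / 2"
    let ?b = "\<lambda>\<omega>. C\<^sup>2 * (5 * q * (K * ?n \<omega>)\<^sup>2 + 4 * (K * ?n \<omega>) ^ 4 / q + 2 * (1 + 5 * S) * ((?R1 \<omega>)\<^sup>2 + (?R2 \<omega>)\<^sup>2) / q)"
    let ?b' = "\<lambda>\<omega>. C\<^sup>2 * (5 * q * (K\<^sup>2 * (N * (\<Sum>n\<in>UNIV. (w n r \<omega> - w n s \<omega>)\<^sup>2)))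
      + 4 * (K ^ 4 * (N ^ 3 * (\<Sum>n\<in>UNIV. (w n r \<omega> - w n s \<omega>) ^ 4))) / q + 2 * (1 + 5 * S) * ((?R1 \<omega>)\<^sup>2 + (?R2 \<omega>)\<^sup>2) / q)"
    have prod: "\<bar>f * g\<bar> \<le> C\<^sup>2" if "\<bar>f\<bar> \<le> C" "\<bar>g\<bar> \<le> C" for f g
      using that by (simp add: abs_mult power2_eq_square) (intro mult_mono, auto)
    have pw: "\<bar>?A \<omega> - ?Q \<omega>\<bar> \<le> ?b' \<omega>" if w: "\<omega> \<in> space M" for \<omega>
    proof -
      have Zr: "Z1 r \<omega> - Z1 s \<omega> = ?N1 \<omega> + ?R1 \<omega>" "Z2 r \<omega> - Z2 s \<omega> = ?N2 \<omega> + ?R2 \<omega>"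
        "Z1 r \<omega> = Z1 s \<omega> + (?N1 \<omega> + ?R1 \<omega>)" "Z2 r \<omega> = Z2 s \<omega> + (?N2 \<omega> + ?R2 \<omega>)"
        by (simp_all add: ito_remainder_def)
      have n1: "\<bar>?N1 \<omega>\<bar> \<le> D1 * ?n \<omega>" unfolding sum_distrib_left
        by (rule order.trans[OF sum_abs]) (auto intro!: sum_mono mult_right_mono simp: abs_mult D1(2)[OF st w])
      have n2: "\<bar>?N2 \<omega>\<bar> \<le> D2 * ?n \<omega>" unfolding sum_distrib_left
        by (rule order.trans[OF sum_abs]) (auto intro!: sum_mono mult_right_mono simp: abs_mult D2(2)[OF st w])
      have n: "\<bar>?N1 \<omega>\<bar> + \<bar>?N2 \<omega>\<bar> \<le> K * ?n \<omega>" using n1 n2 by (simp add: K_def distrib_right)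
      have "\<bar>?A \<omega> - (?c1 \<omega> * (?N1 \<omega> + ?R1 \<omega>)\<^sup>2 + 2 * ?c2 \<omega> * (?N1 \<omega> + ?R1 \<omega>) * (?N2 \<omega> + ?R2 \<omega>) + ?c3 \<omega> * (?N2 \<omega> + ?R2 \<omega>)\<^sup>2) / 2\<bar>
        \<le> C\<^sup>2 * min ((\<bar>?N1 \<omega> + ?R1 \<omega>\<bar> + \<bar>?N2 \<omega> + ?R2 \<omega>\<bar>)\<^sup>2) ((\<bar>?N1 \<omega> + ?R1 \<omega>\<bar> + \<bar>?N2 \<omega> + ?R2 \<omega>\<bar>)^3)"
        using taylor_product[OF u v ub vb, of "Z1 s \<omega>" "?N1 \<omega> + ?R1 \<omega>" "Z2 s \<omega>" "?N2 \<omega> + ?R2 \<omega>"]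
        unfolding Zr(1,2) unfolding Zr(3,4)[symmetric] .
      then have "\<bar>?A \<omega> - ?Q \<omega>\<bar> \<le> ?b \<omega>"
        by (rule taylor_error_bound) (intro prod ub vb q n)+
      also have "\<dots> \<le> ?b' \<omega>"
        unfolding power_mult_distrib N_def
        using abs_increments_power_le[of "\<lambda>n. w n r \<omega> - w n s \<omega>"] q D1(1) D2(1)
        by (intro mult_left_mono add_mono divide_right_mono order.refl) (auto simp: K_def)
      finally show ?thesis .
    qed
    have Zs: "Z1 s \<in> borel_measurable (F s)" "Z2 s \<in> borel_measurable (F s)"
      using ito_expansion_measurable(1)[OF Z1 st] ito_expansion_measurable(1)[OF Z2 st] .
    have Km: "K1 n s \<in> borel_measurable (F s)" "K2 n s \<in> borel_measurable (F s)" for n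
      using ito_expansion_measurable(2)[OF Z1 st] ito_expansion_measurable(2)[OF Z2 st] .
    have Ym: "?Y1 \<in> borel_measurable (F s)" "?Y2 \<in> borel_measurable (F s)" "?c1 \<in> borel_measurable (F s)"
      "?c2 \<in> borel_measurable (F s)" "?c3 \<in> borel_measurable (F s)"
      using Zs by measurable
    have ZM: "Z1 s \<in> borel_measurable M" "Z2 s \<in> borel_measurable M" "Z1 r \<in> borel_measurable M" "Z2 r \<in> borel_measurable M"
      using ito_expansion_measurable(3)[OF Z1] ito_expansion_measurable(3)[OF Z2] st rt by auto
    have Yb: "\<bar>?Y1 \<omega>\<bar> \<le> C\<^sup>2" "\<bar>?Y2 \<omega>\<bar> \<le> C\<^sup>2" "\<bar>?c1 \<omega>\<bar> \<le> C\<^sup>2" "\<bar>?c2 \<omega>\<bar> \<le> C\<^sup>2" "\<bar>?c3 \<omega>\<bar> \<le> C\<^sup>2" for \<omega>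
      by (intro prod ub vb)+
    have iu: "integrable M (\<lambda>\<omega>. u (Z1 r \<omega>) * v (Z2 r \<omega>))" "integrable M (\<lambda>\<omega>. u (Z1 s \<omega>) * v (Z2 s \<omega>))"
      using ZM by (intro integrable_bounded[of _ "C\<^sup>2"] prod ub vb; measurable)+
    have iY: "integrable M (\<lambda>\<omega>. ?Y1 \<omega> * (Z1 r \<omega> - Z1 s \<omega>))" "integrable M (\<lambda>\<omega>. ?Y2 \<omega> * (Z2 r \<omega> - Z2 s \<omega>))"
      using integrable_mult_bounded[OF ito_expansion_increment_integrable[OF Z1 sr] measurable_F[OF Ym(1) st] Yb(1)]
        integrable_mult_bounded[OF ito_expansion_increment_integrable[OF Z2 sr] measurable_F[OF Ym(2) st] Yb(2)] .
    have EY: "expectation (\<lambda>\<omega>. ?Y1 \<omega> * (Z1 r \<omega> - Z1 s \<omega>)) = 0" "expectation (\<lambda>\<omega>. ?Y2 \<omega> * (Z2 r \<omega> - Z2 s \<omega>)) = 0"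
      using ito_expansion_martingale[OF Z1 sr Ym(1) Yb(1)] ito_expansion_martingale[OF Z2 sr Ym(2) Yb(2)] .
    note q1 = expectation_quadratic[OF sr Ym(3) Yb(3) Km(1) D1(2)[OF st] Km(1) D1(2)[OF st]]
    note q2 = expectation_quadratic[OF sr Ym(4) Yb(4) Km(1) D1(2)[OF st] Km(2) D2(2)[OF st]]
    note q3 = expectation_quadratic[OF sr Ym(5) Yb(5) Km(2) D2(2)[OF st] Km(2) D2(2)[OF st]]
    have q20: "expectation (\<lambda>\<omega>. ?c2 \<omega> * (\<Sum>n\<in>UNIV. K1 n s \<omega> * K2 n s \<omega>)) = 0"
      by (rule integral_eq_zero_AE) (auto intro!: AE_I2 simp: orth[OF st])
    have Qeq: "?Q = (\<lambda>\<omega>. (?c1 \<omega> * (?N1 \<omega> * ?N1 \<omega>) + 2 * (?c2 \<omega> * (?N1 \<omega> * ?N2 \<omega>)) + ?c3 \<omega> * (?N2 \<omega> * ?N2 \<omega>)) / 2)"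
      by (simp add: power2_eq_square mult.assoc)
    have iQ: "integrable M ?Q" unfolding Qeq
      using q1(1) q2(1) q3(1) by (intro integrable_divide_zero Bochner_Integration.integrable_add integrable_mult_right)
    have EQ: "expectation ?Q = h * expectation (\<lambda>\<omega>. (?c1 \<omega> * (\<Sum>n\<in>UNIV. (K1 n s \<omega>)\<^sup>2) + ?c3 \<omega> * (\<Sum>n\<in>UNIV. (K2 n s \<omega>)\<^sup>2)) / 2)"
    proof -
      have Q123: "expectation (\<lambda>\<omega>. ?c1 \<omega> * (?N1 \<omega> * ?N1 \<omega>)) = h * expectation (\<lambda>\<omega>. ?c1 \<omega> * (\<Sum>n\<in>UNIV. (K1 n s \<omega>)\<^sup>2))"
        "expectation (\<lambda>\<omega>. ?c2 \<omega> * (?N1 \<omega> * ?N2 \<omega>)) = 0"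
        "expectation (\<lambda>\<omega>. ?c3 \<omega> * (?N2 \<omega> * ?N2 \<omega>)) = h * expectation (\<lambda>\<omega>. ?c3 \<omega> * (\<Sum>n\<in>UNIV. (K2 n s \<omega>)\<^sup>2))"
        using q1(3) q2(3) q3(3) q20 by (simp_all add: h_def power2_eq_square)
      have "expectation ?Q = (expectation (\<lambda>\<omega>. ?c1 \<omega> * (?N1 \<omega> * ?N1 \<omega>)) + 2 * expectation (\<lambda>\<omega>. ?c2 \<omega> * (?N1 \<omega> * ?N2 \<omega>))
          + expectation (\<lambda>\<omega>. ?c3 \<omega> * (?N2 \<omega> * ?N2 \<omega>))) / 2"
        unfolding Qeq using q1(1) q2(1) q3(1) by simp
      also have "\<dots> = h * ((expectation (\<lambda>\<omega>. ?c1 \<omega> * (\<Sum>n\<in>UNIV. (K1 n s \<omega>)\<^sup>2)) + expectation (\<lambda>\<omega>. ?c3 \<omega> * (\<Sum>n\<in>UNIV. (K2 n s \<omega>)\<^sup>2))) / 2)"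
        unfolding Q123 by (simp add: distrib_left add_divide_distrib)
      also have "\<dots> = h * expectation (\<lambda>\<omega>. (?c1 \<omega> * (\<Sum>n\<in>UNIV. (K1 n s \<omega>)\<^sup>2) + ?c3 \<omega> * (\<Sum>n\<in>UNIV. (K2 n s \<omega>)\<^sup>2)) / 2)"
        using q1(2) q3(2) by (simp add: power2_eq_square)
      finally show ?thesis .
    qed
    have iA: "integrable M ?A" using iu iY by (intro Bochner_Integration.integrable_diff Bochner_Integration.integrable_add)
    have EA: "expectation ?A = expectation (\<lambda>\<omega>. u (Z1 r \<omega>) * v (Z2 r \<omega>)) - expectation (\<lambda>\<omega>. u (Z1 s \<omega>) * v (Z2 s \<omega>))"
      using iu iY EY by simp
    note mom = w_increment_moments[OF sr]
    have ib: "integrable M ?b'"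
      using mom(2,3) E1(2)[OF sr] E2(2)[OF sr]
      by (intro integrable_mult_right Bochner_Integration.integrable_add integrable_divide_zero Bochner_Integration.integrable_sum)
    have Eb: "expectation ?b' \<le> B * (h * q)"
    proof -
      have "expectation ?b' = C\<^sup>2 * (5 * q * (K\<^sup>2 * (N * (N * h))) + 4 * (K ^ 4 * (N ^ 3 * (N * (3 * h\<^sup>2)))) / q
          + 2 * (1 + 5 * S) * (expectation (\<lambda>\<omega>. (?R1 \<omega>)\<^sup>2) + expectation (\<lambda>\<omega>. (?R2 \<omega>)\<^sup>2)) / q)"
        using mom E1(2)[OF sr] E2(2)[OF sr] by (simp add: N_def h_def)
      also have "\<dots> \<le> C\<^sup>2 * (5 * q * (K\<^sup>2 * (N * (N * h))) + 4 * (K ^ 4 * (N ^ 3 * (N * (3 * h\<^sup>2)))) / q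
          + 2 * (1 + 5 * S) * (E1 * h\<^sup>2 + E2 * h\<^sup>2) / q)"
        using E1(3)[OF sr] E2(3)[OF sr] q
        by (intro mult_left_mono add_mono order.refl divide_right_mono) (auto simp: h_def)
      also have "\<dots> = B * (h * q)"
      proof -
        have "h\<^sup>2 / q = h * q" using q qq by (simp add: field_simps power2_eq_square)
        then have hq: "x * h\<^sup>2 / q = x * (h * q)" for x by (metis times_divide_eq_right)
        have "4 * (K ^ 4 * (N ^ 3 * (N * (3 * h\<^sup>2)))) / q = 4 * (K ^ 4 * N ^ 3 * (N * 3)) * (h * q)"
          using hq[of "4 * (K ^ 4 * N ^ 3 * (N * 3))"] by (simp add: mult_ac)
        moreover have "2 * (1 + 5 * S) * (E1 * h\<^sup>2 + E2 * h\<^sup>2) / q = 2 * (1 + 5 * S) * (E1 + E2) * (h * q)"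
          using hq[of "2 * (1 + 5 * S) * (E1 + E2)"] by (simp add: algebra_simps)
        ultimately show ?thesis unfolding B_def by (simp add: algebra_simps)
      qed
      finally show ?thesis .
    qed
    have "\<bar>expectation ?A - expectation ?Q\<bar> = \<bar>expectation (\<lambda>\<omega>. ?A \<omega> - ?Q \<omega>)\<bar>"
      using iA iQ by simp
    also have "\<dots> \<le> expectation (\<lambda>\<omega>. \<bar>?A \<omega> - ?Q \<omega>\<bar>)" by (rule integral_abs_bound)
    also have "\<dots> \<le> expectation ?b'"
      by (rule integral_mono[OF integrable_abs[OF Bochner_Integration.integrable_diff[OF iA iQ]] ib pw])
    also note Eb
    finally show ?thesis unfolding EA EQ h_def[symmetric] q_def .
  qed
  then show ?thesis by blast
qed

end

section \<open>From one-step estimates to derivatives\<close>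

lemma (in prob_space) continuous_on_expectation:
  fixes G :: "real \<Rightarrow> 'a \<Rightarrow> real"
  assumes "\<And>t. t \<in> S \<Longrightarrow> G t \<in> borel_measurable M"
    and "\<And>t \<omega>. t \<in> S \<Longrightarrow> \<omega> \<in> space M \<Longrightarrow> \<bar>G t \<omega>\<bar> \<le> C"
    and "AE \<omega> in M. continuous_on S (\<lambda>t. G t \<omega>)"
  shows "continuous_on S (\<lambda>t. expectation (G t))"
  unfolding continuous_on_sequentially
proof (intro allI ballI impI, elim conjE)
  fix x :: "nat \<Rightarrow> real" and a assume a: "a \<in> S" and x: "\<forall>n. x n \<in> S" "x \<longlonglongrightarrow> a"
  have "(\<lambda>n. expectation (G (x n))) \<longlonglongrightarrow> expectation (G a)"
  proof (rule integral_dominated_convergence[where w = "\<lambda>_. C"])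
    show "AE \<omega> in M. (\<lambda>n. G (x n) \<omega>) \<longlonglongrightarrow> G a \<omega>"
      using assms(3)
    proof eventually_elim
      case (elim \<omega>)
      then show ?case using a x unfolding continuous_on_sequentially by (auto simp: comp_def)
    qed
  qed (use assms(1,2) a x in auto)
  then show "((\<lambda>t. expectation (G t)) \<circ> x) \<longlonglongrightarrow> expectation (G a)" by (simp add: comp_def)
qed

text \<open>The estimate always expands from the left end point, so to the left of t it produces m y
  instead of m t. \<open>min t y\<close> is that end point, and continuity of m closes the gap; the
  error divided by |y - t| is at most B sqrt |y - t|.\<close>

lemma deriv_of_one_sided_estimate:
  fixes \<phi> m :: "real \<Rightarrow> real"
  assumes est: "\<And>s r. 0 \<le> s \<Longrightarrow> s < r \<Longrightarrow> r \<le> T \<Longrightarrow> \<bar>\<phi> r - \<phi> s - (r - s) * m s\<bar> \<le> B * ((r - s) * sqrt (r - s))"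
    and m: "continuous_on {0..T} m" and t: "t \<in> {0..T}"
  shows "(\<phi> has_real_derivative m t) (at t within {0..T})"
proof -
  have "((\<lambda>y. m (min t y)) \<longlongrightarrow> m (min t t)) (at t within {0..T})"
  proof -
    have "continuous_on {0..T} (\<lambda>y. m (min t y))"
      by (rule continuous_on_compose2[OF m]) (use t in \<open>auto intro!: continuous_intros\<close>)
    then show ?thesis using t unfolding continuous_on_def by blast
  qed
  then have 1: "((\<lambda>y. m (min t y)) \<longlongrightarrow> m t) (at t within {0..T})" by simp
  have "((\<lambda>y. (\<phi> y - \<phi> t) / (y - t) - m (min t y)) \<longlongrightarrow> 0) (at t within {0..T})"
  proof (rule Lim_null_comparison)
    have "\<bar>(\<phi> y - \<phi> t) / (y - t) - m (min t y)\<bar> \<le> B * sqrt \<bar>y - t\<bar>" if y: "y \<in> {0..T}" "y \<noteq> t" for y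
    proof (cases "t < y")
      case True
      have "\<bar>(\<phi> y - \<phi> t) / (y - t) - m (min t y)\<bar> = \<bar>\<phi> y - \<phi> t - (y - t) * m t\<bar> / (y - t)"
        using True by (simp add: abs_divide[symmetric, of _ "y - t", simplified] field_simps abs_if)
      also have "\<dots> \<le> B * ((y - t) * sqrt (y - t)) / (y - t)"
        using est[of t y] True y t by (intro divide_right_mono) auto
      finally show ?thesis using True by simp
    next
      case False
      then have lt: "y < t" using y by simp
      have "(\<phi> y - \<phi> t) / (y - t) = (\<phi> t - \<phi> y) / (t - y)"
        using lt by (simp add: frac_eq_eq algebra_simps)
      then have "\<bar>(\<phi> y - \<phi> t) / (y - t) - m (min t y)\<bar> = \<bar>\<phi> t - \<phi> y - (t - y) * m y\<bar> / (t - y)"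
        using lt by (simp add: field_simps abs_if)
      also have "\<dots> \<le> B * ((t - y) * sqrt (t - y)) / (t - y)"
        using est[of y t] lt y t by (intro divide_right_mono) auto
      finally show ?thesis using lt by simp
    qed
    then show "\<forall>\<^sub>F y in at t within {0..T}. norm ((\<phi> y - \<phi> t) / (y - t) - m (min t y)) \<le> B * sqrt \<bar>y - t\<bar>"
      unfolding eventually_at_filter by (intro always_eventually) auto
    have "((\<lambda>y. B * sqrt \<bar>y - t\<bar>) \<longlongrightarrow> B * sqrt \<bar>t - t\<bar>) (at t within {0..T})"
      by (intro tendsto_intros)
    then show "((\<lambda>y. B * sqrt \<bar>y - t\<bar>) \<longlongrightarrow> 0) (at t within {0..T})" by simp
  qed
  from tendsto_add[OF this 1] show ?thesis by (simp add: has_field_derivative_iff)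
qed

context brownian_system
begin

text \<open>Bounded coefficients with continuous paths make the expected generator continuous in
  time by dominated convergence, which turns the one-step estimate into a derivative.\<close>

lemma dynkin_deriv:
  fixes u u1 u2 u3 v v1 v2 v3 :: "real \<Rightarrow> real"
  assumes Z1: "ito_expansion Z1 K1" and Z2: "ito_expansion Z2 K2"
    and orth: "\<And>n t \<omega>. t \<in> {0..T} \<Longrightarrow> \<omega> \<in> space M \<Longrightarrow> K1 n t \<omega> * K2 n t \<omega> = 0"
    and cont: "AE \<omega> in M. continuous_on {0..T} (\<lambda>t. Z1 t \<omega>) \<and> continuous_on {0..T} (\<lambda>t. Z2 t \<omega>) \<and>
      (\<forall>n. continuous_on {0..T} (\<lambda>t. K1 n t \<omega>) \<and> continuous_on {0..T} (\<lambda>t. K2 n t \<omega>))"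
    and u: "\<And>z. (u has_real_derivative u1 z) (at z)" "\<And>z. (u1 has_real_derivative u2 z) (at z)"
      "\<And>z. (u2 has_real_derivative u3 z) (at z)"
    and v: "\<And>z. (v has_real_derivative v1 z) (at z)" "\<And>z. (v1 has_real_derivative v2 z) (at z)"
      "\<And>z. (v2 has_real_derivative v3 z) (at z)"
    and ub: "\<And>z. \<bar>u z\<bar> \<le> C" "\<And>z. \<bar>u1 z\<bar> \<le> C" "\<And>z. \<bar>u2 z\<bar> \<le> C" "\<And>z. \<bar>u3 z\<bar> \<le> C"
    and vb: "\<And>z. \<bar>v z\<bar> \<le> C" "\<And>z. \<bar>v1 z\<bar> \<le> C" "\<And>z. \<bar>v2 z\<bar> \<le> C" "\<And>z. \<bar>v3 z\<bar> \<le> C"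
    and t: "t \<in> {0..T}"
  defines "G \<equiv> \<lambda>t \<omega>. (u2 (Z1 t \<omega>) * v (Z2 t \<omega>) * (\<Sum>n\<in>UNIV. (K1 n t \<omega>)\<^sup>2)
          + u (Z1 t \<omega>) * v2 (Z2 t \<omega>) * (\<Sum>n\<in>UNIV. (K2 n t \<omega>)\<^sup>2)) / 2"
  shows "((\<lambda>t. expectation (\<lambda>\<omega>. u (Z1 t \<omega>) * v (Z2 t \<omega>))) has_real_derivative expectation (G t)) (at t within {0..T})"
    "integrable M (G t)" "integrable M (\<lambda>\<omega>. u (Z1 t \<omega>) * v (Z2 t \<omega>))"
proof -
  have c: "continuous_on UNIV f" if "\<And>z. (f has_real_derivative f' z) (at z)" for f f' :: "real \<Rightarrow> real"
    using that by (intro DERIV_continuous_on) (auto intro: has_field_derivative_at_within)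
  note [measurable] = borel_measurable_continuous_onI[OF c[OF u(1)]] borel_measurable_continuous_onI[OF c[OF u(3)]]
    borel_measurable_continuous_onI[OF c[OF v(1)]] borel_measurable_continuous_onI[OF c[OF v(3)]]
  obtain D1 where D1: "0 \<le> D1" "\<And>n t \<omega>. t \<in> {0..T} \<Longrightarrow> \<omega> \<in> space M \<Longrightarrow> \<bar>K1 n t \<omega>\<bar> \<le> D1"
    using ito_expansion_bounded[OF Z1] by blast
  obtain D2 where D2: "0 \<le> D2" "\<And>n t \<omega>. t \<in> {0..T} \<Longrightarrow> \<omega> \<in> space M \<Longrightarrow> \<bar>K2 n t \<omega>\<bar> \<le> D2"
    using ito_expansion_bounded[OF Z2] by blast
  have prod: "\<bar>f * g\<bar> \<le> C\<^sup>2" if "\<bar>f\<bar> \<le> C" "\<bar>g\<bar> \<le> C" for f g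
    using that by (simp add: abs_mult power2_eq_square) (intro mult_mono, auto)
  have sq: "\<bar>\<Sum>n\<in>UNIV. (k n)\<^sup>2\<bar> \<le> real CARD('n) * D\<^sup>2" if "\<And>n. \<bar>k n\<bar> \<le> D" for k :: "'n \<Rightarrow> real" and D
  proof -
    have "(k n)\<^sup>2 \<le> D\<^sup>2" for n using that[of n] by (intro abs_le_square_iff[THEN iffD1]) auto
    then have "(\<Sum>n\<in>UNIV. (k n)\<^sup>2) \<le> (\<Sum>n\<in>(UNIV::'n set). D\<^sup>2)" by (rule sum_mono)
    then show ?thesis by (simp add: sum_nonneg)
  qed
  define E where "E = (C\<^sup>2 * (real CARD('n) * D1\<^sup>2) + C\<^sup>2 * (real CARD('n) * D2\<^sup>2)) / 2"
  have Gb: "\<bar>G t \<omega>\<bar> \<le> E" if t: "t \<in> {0..T}" and w: "\<omega> \<in> space M" for t \<omega>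
  proof -
    have "\<bar>u2 (Z1 t \<omega>) * v (Z2 t \<omega>) * (\<Sum>n\<in>UNIV. (K1 n t \<omega>)\<^sup>2)\<bar> \<le> C\<^sup>2 * (real CARD('n) * D1\<^sup>2)"
      "\<bar>u (Z1 t \<omega>) * v2 (Z2 t \<omega>) * (\<Sum>n\<in>UNIV. (K2 n t \<omega>)\<^sup>2)\<bar> \<le> C\<^sup>2 * (real CARD('n) * D2\<^sup>2)"
      unfolding abs_mult[of "_ * _" "sum _ _"]
      by (intro mult_mono prod ub vb sq D1(2)[OF t w] D2(2)[OF t w]; simp)+
    then show ?thesis unfolding G_def E_def by (simp add: abs_le_iff)
  qed
  have Gm: "G t \<in> borel_measurable M" if t: "t \<in> {0..T}" for t
    unfolding G_def
    using ito_expansion_measurable(3,4)[OF Z1 t] ito_expansion_measurable(3,4)[OF Z2 t] by measurable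
  have Gc: "continuous_on {0..T} (\<lambda>t. expectation (G t))"
  proof (rule continuous_on_expectation[OF Gm Gb])
    show "AE \<omega> in M. continuous_on {0..T} (\<lambda>t. G t \<omega>)"
      using cont
    proof eventually_elim
      case (elim \<omega>)
      then show ?case unfolding G_def
        by (intro continuous_intros continuous_on_compose2[OF c[OF u(3)]] continuous_on_compose2[OF c[OF u(1)]]
            continuous_on_compose2[OF c[OF v(3)]] continuous_on_compose2[OF c[OF v(1)]]) auto
    qed
  qed
  obtain B where B: "\<And>s r. 0 \<le> s \<Longrightarrow> s < r \<Longrightarrow> r \<le> T \<Longrightarrow>
    \<bar>expectation (\<lambda>\<omega>. u (Z1 r \<omega>) * v (Z2 r \<omega>)) - expectation (\<lambda>\<omega>. u (Z1 s \<omega>) * v (Z2 s \<omega>))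
      - (r - s) * expectation (G s)\<bar> \<le> B * ((r - s) * sqrt (r - s))"
    using dynkin_step[OF Z1 Z2 orth u v ub vb, folded G_def] unfolding G_def by blast
  show "((\<lambda>t. expectation (\<lambda>\<omega>. u (Z1 t \<omega>) * v (Z2 t \<omega>))) has_real_derivative expectation (G t)) (at t within {0..T})"
    by (rule deriv_of_one_sided_estimate[OF B Gc t])
  show "integrable M (G t)" by (rule integrable_bounded[OF Gm[OF t] Gb[OF t]])
  show "integrable M (\<lambda>\<omega>. u (Z1 t \<omega>) * v (Z2 t \<omega>))"
  proof (rule integrable_bounded)
    show "(\<lambda>\<omega>. u (Z1 t \<omega>) * v (Z2 t \<omega>)) \<in> borel_measurable M"
      using ito_expansion_measurable(3)[OF Z1 t] ito_expansion_measurable(3)[OF Z2 t] by measurable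
    show "\<bar>u (Z1 t \<omega>) * v (Z2 t \<omega>)\<bar> \<le> C\<^sup>2" for \<omega> by (intro prod ub vb)
  qed
qed

end

section \<open>Logarithmic test functions\<close>

text \<open>This is ln (sqrt (\<epsilon>^2 + z^2)), a replacement for ln |z| that is smooth across z
  = 0; a difference quotient of the flow is not known to stay away from 0. \<open>lg1\<close>,
  \<open>lg2\<close> and \<open>lg3\<close> are its derivatives.\<close>

definition lg :: "real \<Rightarrow> real \<Rightarrow> real" where "lg \<epsilon> z = ln (\<epsilon>\<^sup>2 + z\<^sup>2) / 2"
definition lg1 :: "real \<Rightarrow> real \<Rightarrow> real" where "lg1 \<epsilon> z = z / (\<epsilon>\<^sup>2 + z\<^sup>2)"
definition lg2 :: "real \<Rightarrow> real \<Rightarrow> real" where "lg2 \<epsilon> z = (\<epsilon>\<^sup>2 - z\<^sup>2) / (\<epsilon>\<^sup>2 + z\<^sup>2)\<^sup>2"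
definition lg3 :: "real \<Rightarrow> real \<Rightarrow> real" where "lg3 \<epsilon> z = (2 * z^3 - 6 * z * \<epsilon>\<^sup>2) / (\<epsilon>\<^sup>2 + z\<^sup>2)^3"

lemma sum_squares_pos: "0 < \<epsilon> \<Longrightarrow> 0 < \<epsilon>\<^sup>2 + (z::real)\<^sup>2"
  by (simp add: add_pos_nonneg)

lemma lg_deriv:
  assumes "0 < \<epsilon>"
  shows "(lg \<epsilon> has_real_derivative lg1 \<epsilon> z) (at z)" "(lg1 \<epsilon> has_real_derivative lg2 \<epsilon> z) (at z)"
    "(lg2 \<epsilon> has_real_derivative lg3 \<epsilon> z) (at z)"
proof -
  have pos: "0 < \<epsilon>\<^sup>2 + z\<^sup>2" using sum_squares_pos[OF assms] .
  then have nz: "\<epsilon>\<^sup>2 + z\<^sup>2 \<noteq> 0" by linarith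
  show "(lg \<epsilon> has_real_derivative lg1 \<epsilon> z) (at z)"
  proof -
    have d: "((\<lambda>z. \<epsilon>\<^sup>2 + z\<^sup>2) has_real_derivative 2 * z) (at z)" by (auto intro!: derivative_eq_intros)
    have "inverse q * (2 * z) / 2 = z / q" for q :: real by (simp add: field_simps)
    from DERIV_cong[OF DERIV_cdivide[OF DERIV_chain2[OF DERIV_ln[OF pos] d], of 2] this]
    show ?thesis unfolding lg_def[abs_def] lg1_def .
  qed
  show "(lg1 \<epsilon> has_real_derivative lg2 \<epsilon> z) (at z)"
    unfolding lg1_def[abs_def] lg2_def using nz
    by (auto intro!: derivative_eq_intros simp: power2_eq_square)
  show "(lg2 \<epsilon> has_real_derivative lg3 \<epsilon> z) (at z)"
  proof -
    let ?q = "\<epsilon>\<^sup>2 + z\<^sup>2"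
    have "((\<lambda>z. (\<epsilon>\<^sup>2 - z\<^sup>2) / (\<epsilon>\<^sup>2 + z\<^sup>2)\<^sup>2) has_real_derivative
        ((- 2 * z) * ?q\<^sup>2 - (\<epsilon>\<^sup>2 - z\<^sup>2) * (2 * ?q * (2 * z))) / (?q\<^sup>2 * ?q\<^sup>2)) (at z)"
      using nz by (auto intro!: derivative_eq_intros)
    moreover have "((- 2 * z) * ?q\<^sup>2 - (\<epsilon>\<^sup>2 - z\<^sup>2) * (2 * ?q * (2 * z))) / (?q\<^sup>2 * ?q\<^sup>2) = lg3 \<epsilon> z"
    proof -
      have "(- 2 * z) * q\<^sup>2 - a * (2 * q * (2 * z)) = (2 * z^3 - 6 * z * e) * q"
        if "q = e + z\<^sup>2" "a = e - z\<^sup>2" for q a e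
        unfolding that by (simp add: power2_eq_square power3_eq_cube algebra_simps)
      then have "(- 2 * z) * ?q\<^sup>2 - (\<epsilon>\<^sup>2 - z\<^sup>2) * (2 * ?q * (2 * z)) = (2 * z^3 - 6 * z * \<epsilon>\<^sup>2) * ?q" by blast
      then show ?thesis using nz unfolding lg3_def by (simp add: power2_eq_square power3_eq_cube)
    qed
    ultimately show ?thesis unfolding lg2_def[abs_def] by simp
  qed
qed

text \<open>The first three bounds blow up as \<epsilon> tends to 0 and serve Dynkin's formula at
  fixed \<epsilon>. The last two are uniform in \<epsilon>: the variation rate of a quotient z is at
  most a multiple of z^2, which compensates the singularity of the derivatives and dominates the
  generator in the limit.\<close>

lemma lg_bounds:
  assumes e: "0 < \<epsilon>"
  shows "\<bar>lg1 \<epsilon> z\<bar> \<le> 1 / \<epsilon>" "\<bar>lg2 \<epsilon> z\<bar> \<le> 1 / \<epsilon>\<^sup>2" "\<bar>lg3 \<epsilon> z\<bar> \<le> 6 / \<epsilon>^3"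
    "(lg1 \<epsilon> z)\<^sup>2 * z\<^sup>2 \<le> 1" "\<bar>lg2 \<epsilon> z\<bar> * z\<^sup>2 \<le> 1"
proof -
  define q where "q = \<epsilon>\<^sup>2 + z\<^sup>2"
  have q: "0 < q" using sum_squares_pos[OF e] by (simp add: q_def)
  have qe: "\<epsilon>\<^sup>2 \<le> q" and qz: "z\<^sup>2 \<le> q" by (auto simp: q_def)
  have zq: "\<bar>z\<bar> * \<epsilon> \<le> q"
  proof -
    have "0 \<le> (\<bar>z\<bar> - \<epsilon>)\<^sup>2 + \<bar>z\<bar> * \<epsilon>" using e by simp
    moreover have "\<dots> = z\<^sup>2 + \<epsilon>\<^sup>2 - \<bar>z\<bar> * \<epsilon>" by (simp add: power2_diff)
    ultimately show ?thesis by (simp add: q_def)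
  qed
  show 1: "\<bar>lg1 \<epsilon> z\<bar> \<le> 1 / \<epsilon>"
    using zq q e unfolding lg1_def q_def[symmetric] by (simp add: field_simps)
  have dq: "\<bar>\<epsilon>\<^sup>2 - z\<^sup>2\<bar> \<le> q" by (simp add: q_def abs_le_iff)
  have 2: "\<bar>lg2 \<epsilon> z\<bar> \<le> 1 / q"
    unfolding lg2_def q_def[symmetric] using dq q by (simp add: field_simps power2_eq_square)
  have iq: "1 / q \<le> 1 / \<epsilon>\<^sup>2" using qe e q by (intro divide_left_mono) auto
  show "\<bar>lg2 \<epsilon> z\<bar> \<le> 1 / \<epsilon>\<^sup>2" using 2 iq by linarith
  show "\<bar>lg2 \<epsilon> z\<bar> * z\<^sup>2 \<le> 1"
  proof -
    have "\<bar>lg2 \<epsilon> z\<bar> * z\<^sup>2 \<le> 1 / q * q" using 2 qz q by (intro mult_mono) auto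
    then show ?thesis using q by simp
  qed
  show "(lg1 \<epsilon> z)\<^sup>2 * z\<^sup>2 \<le> 1"
  proof -
    have "\<bar>lg1 \<epsilon> z * z\<bar> \<le> 1"
      unfolding lg1_def q_def[symmetric] using qz q by (simp add: field_simps power2_eq_square abs_mult)
    then show ?thesis by (simp add: power_mult_distrib[symmetric] abs_square_le_1)
  qed
  show "\<bar>lg3 \<epsilon> z\<bar> \<le> 6 / \<epsilon>^3"
  proof -
    \<comment> \<open>The factorisation reduces the third derivative to bounds already shown; the
      middle factor is at most 6 since neither 2 z^2 nor 6 \<epsilon>^2 exceeds 6 q.\<close>
    have "lg3 \<epsilon> z = lg1 \<epsilon> z * ((2 * z\<^sup>2 - 6 * \<epsilon>\<^sup>2) / q) * (1 / q)"
      unfolding lg3_def lg1_def q_def[symmetric] using q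
      by (simp add: power2_eq_square power3_eq_cube field_simps)
    moreover have "\<bar>(2 * z\<^sup>2 - 6 * \<epsilon>\<^sup>2) / q\<bar> \<le> 6"
    proof -
      have "\<bar>2 * z\<^sup>2 - 6 * \<epsilon>\<^sup>2\<bar> \<le> 6 * q" by (auto simp: q_def abs_le_iff)
      then show ?thesis using q by (simp add: field_simps)
    qed
    moreover have "\<bar>1 / q\<bar> \<le> 1 / \<epsilon>\<^sup>2" using iq q by simp
    ultimately have "\<bar>lg3 \<epsilon> z\<bar> \<le> 1 / \<epsilon> * 6 * (1 / \<epsilon>\<^sup>2)"
      using 1 e by (simp only: abs_mult) (intro mult_mono mult_nonneg_nonneg, auto)
    then show ?thesis by (simp add: power2_eq_square power3_eq_cube)
  qed
qed

text \<open>The phase c lets one family cover cosine and sine, as cos (x - pi/2) = sin x.\<close>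

definition wave :: "real \<Rightarrow> real \<Rightarrow> real \<Rightarrow> real \<Rightarrow> real" where
  "wave \<theta> \<epsilon> c z = cos (\<theta> * lg \<epsilon> z + c)"
definition wave1 :: "real \<Rightarrow> real \<Rightarrow> real \<Rightarrow> real \<Rightarrow> real" where
  "wave1 \<theta> \<epsilon> c z = - (\<theta> * lg1 \<epsilon> z) * sin (\<theta> * lg \<epsilon> z + c)"
definition wave2 :: "real \<Rightarrow> real \<Rightarrow> real \<Rightarrow> real \<Rightarrow> real" where
  "wave2 \<theta> \<epsilon> c z = - (\<theta>\<^sup>2 * (lg1 \<epsilon> z)\<^sup>2) * cos (\<theta> * lg \<epsilon> z + c) - \<theta> * lg2 \<epsilon> z * sin (\<theta> * lg \<epsilon> z + c)"
definition wave3 :: "real \<Rightarrow> real \<Rightarrow> real \<Rightarrow> real \<Rightarrow> real" where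
  "wave3 \<theta> \<epsilon> c z = (\<theta>^3 * (lg1 \<epsilon> z)^3 - \<theta> * lg3 \<epsilon> z) * sin (\<theta> * lg \<epsilon> z + c)
    - 3 * \<theta>\<^sup>2 * (lg1 \<epsilon> z * lg2 \<epsilon> z) * cos (\<theta> * lg \<epsilon> z + c)"

lemma wave_deriv:
  assumes "0 < \<epsilon>"
  shows "(wave \<theta> \<epsilon> c has_real_derivative wave1 \<theta> \<epsilon> c z) (at z)"
    "(wave1 \<theta> \<epsilon> c has_real_derivative wave2 \<theta> \<epsilon> c z) (at z)"
    "(wave2 \<theta> \<epsilon> c has_real_derivative wave3 \<theta> \<epsilon> c z) (at z)"
proof -
  note d = lg_deriv[OF assms]
  show "(wave \<theta> \<epsilon> c has_real_derivative wave1 \<theta> \<epsilon> c z) (at z)"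
    unfolding wave_def[abs_def] wave1_def
    by (rule derivative_eq_intros d refl | simp)+
  show "(wave1 \<theta> \<epsilon> c has_real_derivative wave2 \<theta> \<epsilon> c z) (at z)"
    unfolding wave1_def[abs_def] wave2_def
    by (rule derivative_eq_intros d refl)+ (simp add: power2_eq_square algebra_simps)
  show "(wave2 \<theta> \<epsilon> c has_real_derivative wave3 \<theta> \<epsilon> c z) (at z)"
    unfolding wave2_def[abs_def] wave3_def
    by (rule derivative_eq_intros d refl)+ (simp add: power2_eq_square power3_eq_cube algebra_simps)
qed

lemma wave_bounds:
  assumes e: "0 < \<epsilon>"
  shows "\<exists>C. \<forall>c z. \<bar>wave \<theta> \<epsilon> c z\<bar> \<le> C \<and> \<bar>wave1 \<theta> \<epsilon> c z\<bar> \<le> C \<and> \<bar>wave2 \<theta> \<epsilon> c z\<bar> \<le> C \<and> \<bar>wave3 \<theta> \<epsilon> c z\<bar> \<le> C"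
proof -
  define a b d where "a = 1 / \<epsilon>" and "b = 1 / \<epsilon>\<^sup>2" and "d = 6 / \<epsilon>^3"
  have nn: "0 \<le> a" "0 \<le> b" "0 \<le> d" using e by (auto simp: a_def b_def d_def)
  define t where "t = \<bar>\<theta>\<bar>"
  have t0: "0 \<le> t" by (simp add: t_def)
  define C where "C = 1 + t * a + (t\<^sup>2 * a\<^sup>2 + t * b) + ((t^3 * a^3 + t * d) + 3 * t\<^sup>2 * (a * b))"
  have p: "0 \<le> t * a" "0 \<le> t\<^sup>2 * a\<^sup>2" "0 \<le> t * b" "0 \<le> t^3 * a^3" "0 \<le> t * d" "0 \<le> 3 * t\<^sup>2 * (a * b)"
    using nn t0 by auto
  have tr: "\<bar>x * y\<bar> \<le> X" if "\<bar>x\<bar> \<le> X" "\<bar>y\<bar> \<le> 1" for x y X :: real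
  proof -
    have "\<bar>x\<bar> * \<bar>y\<bar> \<le> X * 1" using that by (intro mult_mono) auto
    then show ?thesis by (simp add: abs_mult)
  qed
  have "\<bar>wave \<theta> \<epsilon> c z\<bar> \<le> C \<and> \<bar>wave1 \<theta> \<epsilon> c z\<bar> \<le> C \<and> \<bar>wave2 \<theta> \<epsilon> c z\<bar> \<le> C \<and> \<bar>wave3 \<theta> \<epsilon> c z\<bar> \<le> C" for c z
  proof -
    note l = lg_bounds(1-3)[OF e, of z, folded a_def b_def d_def]
    have m1: "\<bar>\<theta> * lg1 \<epsilon> z\<bar> \<le> t * a" "\<bar>\<theta> * lg2 \<epsilon> z\<bar> \<le> t * b" "\<bar>\<theta> * lg3 \<epsilon> z\<bar> \<le> t * d"
      unfolding abs_mult t_def[symmetric] using l t0 by (auto intro!: mult_left_mono)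
    have m2: "\<bar>\<theta>\<^sup>2 * (lg1 \<epsilon> z)\<^sup>2\<bar> \<le> t\<^sup>2 * a\<^sup>2"
      unfolding abs_mult power_abs t_def[symmetric] by (intro mult_left_mono power_mono l(1)) auto
    have m3: "\<bar>\<theta>^3 * (lg1 \<epsilon> z)^3\<bar> \<le> t^3 * a^3"
      unfolding abs_mult power_abs t_def[symmetric] using t0 by (intro mult_left_mono power_mono l(1)) auto
    have m4: "\<bar>3 * \<theta>\<^sup>2 * (lg1 \<epsilon> z * lg2 \<epsilon> z)\<bar> \<le> 3 * t\<^sup>2 * (a * b)"
      unfolding abs_mult power_abs t_def[symmetric] using l nn by (intro mult_mono) auto
    have m5: "\<bar>\<theta>^3 * (lg1 \<epsilon> z)^3 - \<theta> * lg3 \<epsilon> z\<bar> \<le> t^3 * a^3 + t * d" using m3 m1(3) by linarith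
    let ?s = "sin (\<theta> * lg \<epsilon> z + c)" and ?c = "cos (\<theta> * lg \<epsilon> z + c)"
    have "\<bar>wave \<theta> \<epsilon> c z\<bar> \<le> 1" by (simp add: wave_def)
    moreover have "\<bar>wave1 \<theta> \<epsilon> c z\<bar> \<le> t * a" unfolding wave1_def using m1(1) by (intro tr[of "- (\<theta> * lg1 \<epsilon> z)"]) auto
    moreover have "\<bar>wave2 \<theta> \<epsilon> c z\<bar> \<le> t\<^sup>2 * a\<^sup>2 + t * b"
    proof -
      have "\<bar>- (\<theta>\<^sup>2 * (lg1 \<epsilon> z)\<^sup>2) * ?c\<bar> \<le> t\<^sup>2 * a\<^sup>2"
        by (rule tr) (use m2 in simp_all)
      moreover have "\<bar>\<theta> * lg2 \<epsilon> z * ?s\<bar> \<le> t * b"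
        by (rule tr) (use m1(2) in simp_all)
      ultimately show ?thesis unfolding wave2_def by linarith
    qed
    moreover have "\<bar>wave3 \<theta> \<epsilon> c z\<bar> \<le> (t^3 * a^3 + t * d) + 3 * t\<^sup>2 * (a * b)"
    proof -
      have "\<bar>(\<theta>^3 * (lg1 \<epsilon> z)^3 - \<theta> * lg3 \<epsilon> z) * ?s\<bar> \<le> t^3 * a^3 + t * d"
        by (rule tr) (use m5 in simp_all)
      moreover have "\<bar>3 * \<theta>\<^sup>2 * (lg1 \<epsilon> z * lg2 \<epsilon> z) * ?c\<bar> \<le> 3 * t\<^sup>2 * (a * b)"
        by (rule tr[OF m4]) simp
      ultimately show ?thesis unfolding wave3_def by linarith
    qed
    ultimately show ?thesis using p unfolding C_def by linarith
  qed
  then show ?thesis by blast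
qed

context brownian_system
begin

text \<open>cos (x - y) = cos x cos y + sin x sin y is a sum of two products of one-variable test
  functions, to each of which \<open>dynkin_deriv\<close> applies; the sines come from shifting both
  phases by pi/2. The terms with \<open>lg2\<close> enter with opposite signs, the source of the
  later cancellation of drifts.\<close>

lemma dynkin_log_ratio:
  fixes \<theta> c :: real
  assumes Z1: "ito_expansion Z1 K1" and Z2: "ito_expansion Z2 K2"
    and orth: "\<And>n t \<omega>. t \<in> {0..T} \<Longrightarrow> \<omega> \<in> space M \<Longrightarrow> K1 n t \<omega> * K2 n t \<omega> = 0"
    and cont: "AE \<omega> in M. continuous_on {0..T} (\<lambda>t. Z1 t \<omega>) \<and> continuous_on {0..T} (\<lambda>t. Z2 t \<omega>) \<and>
      (\<forall>n. continuous_on {0..T} (\<lambda>t. K1 n t \<omega>) \<and> continuous_on {0..T} (\<lambda>t. K2 n t \<omega>))"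
    and e: "0 < \<epsilon>" and t: "t \<in> {0..T}"
  defines "\<Phi> \<equiv> \<lambda>t \<omega>. \<theta> * (lg \<epsilon> (Z1 t \<omega>) - lg \<epsilon> (Z2 t \<omega>)) + c"
  defines "G \<equiv> \<lambda>t \<omega>. ((- \<theta>\<^sup>2 * (lg1 \<epsilon> (Z1 t \<omega>))\<^sup>2 * cos (\<Phi> t \<omega>) - \<theta> * lg2 \<epsilon> (Z1 t \<omega>) * sin (\<Phi> t \<omega>)) * (\<Sum>n\<in>UNIV. (K1 n t \<omega>)\<^sup>2)
      + (- \<theta>\<^sup>2 * (lg1 \<epsilon> (Z2 t \<omega>))\<^sup>2 * cos (\<Phi> t \<omega>) + \<theta> * lg2 \<epsilon> (Z2 t \<omega>) * sin (\<Phi> t \<omega>)) * (\<Sum>n\<in>UNIV. (K2 n t \<omega>)\<^sup>2)) / 2"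
  shows "((\<lambda>t. expectation (\<lambda>\<omega>. cos (\<Phi> t \<omega>))) has_real_derivative expectation (G t)) (at t within {0..T})"
    "integrable M (G t)" "integrable M (\<lambda>\<omega>. cos (\<Phi> t \<omega>))"
proof -
  obtain C where C: "\<And>c z. \<bar>wave \<theta> \<epsilon> c z\<bar> \<le> C" "\<And>c z. \<bar>wave1 \<theta> \<epsilon> c z\<bar> \<le> C"
    "\<And>c z. \<bar>wave2 \<theta> \<epsilon> c z\<bar> \<le> C" "\<And>c z. \<bar>wave3 \<theta> \<epsilon> c z\<bar> \<le> C"
    using wave_bounds[OF e, of \<theta>] by blast
  note d = dynkin_deriv[OF Z1 Z2 orth cont wave_deriv[OF e] wave_deriv[OF e] C C]
  let ?p = "\<lambda>c1 c2 t \<omega>. wave \<theta> \<epsilon> c1 (Z1 t \<omega>) * wave \<theta> \<epsilon> c2 (Z2 t \<omega>)"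
  let ?g = "\<lambda>c1 c2 t \<omega>. (wave2 \<theta> \<epsilon> c1 (Z1 t \<omega>) * wave \<theta> \<epsilon> c2 (Z2 t \<omega>) * (\<Sum>n\<in>UNIV. (K1 n t \<omega>)\<^sup>2)
          + wave \<theta> \<epsilon> c1 (Z1 t \<omega>) * wave2 \<theta> \<epsilon> c2 (Z2 t \<omega>) * (\<Sum>n\<in>UNIV. (K2 n t \<omega>)\<^sup>2)) / 2"
  have cos_eq: "cos (\<Phi> t \<omega>) = ?p c 0 t \<omega> + ?p (c - pi/2) (- (pi/2)) t \<omega>" for t \<omega>
  proof -
    have "cos (x - y) = cos x * cos y + cos (x - pi/2) * cos (y - pi/2)" for x y :: real
      by (simp add: cos_diff)
    from this[of "\<theta> * lg \<epsilon> (Z1 t \<omega>) + c" "\<theta> * lg \<epsilon> (Z2 t \<omega>)"] show ?thesis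
      unfolding \<Phi>_def wave_def by (simp add: algebra_simps)
  qed
  have G_eq: "G t \<omega> = ?g c 0 t \<omega> + ?g (c - pi/2) (- (pi/2)) t \<omega>" for t \<omega>
  proof -
    define x where "x = \<theta> * lg \<epsilon> (Z1 t \<omega>) + c"
    define y where "y = \<theta> * lg \<epsilon> (Z2 t \<omega>)"
    define p q p' q' where "p = \<theta>\<^sup>2 * (lg1 \<epsilon> (Z1 t \<omega>))\<^sup>2" and "q = \<theta> * lg2 \<epsilon> (Z1 t \<omega>)"
      and "p' = \<theta>\<^sup>2 * (lg1 \<epsilon> (Z2 t \<omega>))\<^sup>2" and "q' = \<theta> * lg2 \<epsilon> (Z2 t \<omega>)"
    have xy: "\<Phi> t \<omega> = x - y" by (simp add: \<Phi>_def x_def y_def algebra_simps)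
    have sh: "\<theta> * lg \<epsilon> (Z1 t \<omega>) + (c - pi/2) = x - pi/2" "\<theta> * lg \<epsilon> (Z2 t \<omega>) + - (pi/2) = y - pi/2"
      "\<theta> * lg \<epsilon> (Z2 t \<omega>) + 0 = y" by (simp_all add: x_def y_def)
    have tr: "cos (x - pi/2) = sin x" "sin (x - pi/2) = - cos x" "cos (y - pi/2) = sin y" "sin (y - pi/2) = - cos y"
      by (simp_all add: cos_diff sin_diff)
    show ?thesis
      unfolding G_def wave_def wave2_def xy sh tr x_def[symmetric] p_def[symmetric] q_def[symmetric] p'_def[symmetric] q'_def[symmetric]
      by (simp add: cos_diff sin_diff p_def[symmetric] p'_def[symmetric] field_simps)
  qed
  have "((\<lambda>t. expectation (?p c 0 t) + expectation (?p (c - pi/2) (- (pi/2)) t)) has_real_derivative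
      expectation (?g c 0 t) + expectation (?g (c - pi/2) (- (pi/2)) t)) (at t within {0..T})"
    by (intro DERIV_add d(1) t)
  moreover have "expectation (\<lambda>\<omega>. cos (\<Phi> t \<omega>)) = expectation (?p c 0 t) + expectation (?p (c - pi/2) (- (pi/2)) t)"
    if "t \<in> {0..T}" for t
    unfolding cos_eq by (intro Bochner_Integration.integral_add d(3) that)
  moreover have "expectation (G t) = expectation (?g c 0 t) + expectation (?g (c - pi/2) (- (pi/2)) t)"
    unfolding G_eq by (intro Bochner_Integration.integral_add d(2) t)
  ultimately show "((\<lambda>t. expectation (\<lambda>\<omega>. cos (\<Phi> t \<omega>))) has_real_derivative expectation (G t)) (at t within {0..T})"
    using t by (auto intro: has_field_derivative_transform_within[OF _ zero_less_one])
  have "G t = (\<lambda>\<omega>. ?g c 0 t \<omega> + ?g (c - pi/2) (- (pi/2)) t \<omega>)" using G_eq by (rule ext)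
  then show "integrable M (G t)"
    by (simp only:) (intro Bochner_Integration.integrable_add d(2) t)
  show "integrable M (\<lambda>\<omega>. cos (\<Phi> t \<omega>))"
    unfolding cos_eq by (intro Bochner_Integration.integrable_add d(3) t)
qed

text \<open>
  The function \<open>1 - cos (2\<pi>z)\<close> vanishes exactly on the integers, and its square variation rate for
  a difference of two solutions is controlled by itself; so Gronwall applies directly.
\<close>

lemma ito_expansion_integer:
  assumes Z: "ito_expansion Z K"
    and K: "\<And>t \<omega>. t \<in> {0..T} \<Longrightarrow> \<omega> \<in> space M \<Longrightarrow> (\<Sum>n\<in>UNIV. (K n t \<omega>)\<^sup>2) = 2 - 2 * cos (2 * pi * Z t \<omega>)"
    and cont: "AE \<omega> in M. continuous_on {0..T} (\<lambda>t. Z t \<omega>) \<and> (\<forall>n. continuous_on {0..T} (\<lambda>t. K n t \<omega>))"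
    and Z0: "AE \<omega> in M. Z 0 \<omega> = 0" and t: "t \<in> {0..T}"
  shows "AE \<omega> in M. Z t \<omega> \<in> \<int>"
proof -
  let ?u = "\<lambda>z. 1 - cos (2 * pi * z)" and ?u1 = "\<lambda>z. 2 * pi * sin (2 * pi * z)"
    and ?u2 = "\<lambda>z. (2 * pi)\<^sup>2 * cos (2 * pi * z)" and ?u3 = "\<lambda>z. - ((2 * pi)^3 * sin (2 * pi * z))"
  define C where "C = 2 + 2 * pi + (2 * pi)\<^sup>2 + (2 * pi)^3"
  have pp: "0 \<le> 2 * pi" "0 \<le> (2 * pi)\<^sup>2" "0 \<le> (2 * pi)^3" by auto
  have tr: "\<bar>x * y\<bar> \<le> x" if "0 \<le> x" "\<bar>y\<bar> \<le> 1" for x y :: real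
    using that mult_left_le[of "\<bar>y\<bar>" x] by (simp add: abs_mult)
  have du: "(?u has_real_derivative ?u1 z) (at z)" "(?u1 has_real_derivative ?u2 z) (at z)"
    "(?u2 has_real_derivative ?u3 z) (at z)" for z
    by (auto intro!: derivative_eq_intros simp: power2_eq_square power3_eq_cube)
  have bu: "\<bar>?u z\<bar> \<le> C" "\<bar>?u1 z\<bar> \<le> C" "\<bar>?u2 z\<bar> \<le> C" "\<bar>?u3 z\<bar> \<le> C" for z
  proof -
    have "\<bar>?u z\<bar> \<le> 2" using abs_cos_le_one[of "2 * pi * z"] by linarith
    then show "\<bar>?u z\<bar> \<le> C" using pp unfolding C_def by linarith
    show "\<bar>?u1 z\<bar> \<le> C" using tr[OF pp(1) abs_sin_le_one[of "2 * pi * z"]] pp unfolding C_def by linarith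
    show "\<bar>?u2 z\<bar> \<le> C" using tr[OF pp(2) abs_cos_le_one[of "2 * pi * z"]] pp unfolding C_def by linarith
    show "\<bar>?u3 z\<bar> \<le> C" using tr[OF pp(3) abs_sin_le_one[of "2 * pi * z"]] pp unfolding C_def abs_minus_cancel by linarith
  qed
  \<comment> \<open>Taking v = 1 and the zero process as second component reduces the two-process
    formula to Z alone.\<close>
  have dv: "((\<lambda>_. 1::real) has_real_derivative (\<lambda>_. 0) z) (at z)" "((\<lambda>_. 0::real) has_real_derivative (\<lambda>_. 0) z) (at z)" for z
    by auto
  have bv: "\<bar>(\<lambda>_. 1::real) z\<bar> \<le> C" "\<bar>(\<lambda>_. 0::real) z\<bar> \<le> C" for z :: real using pp by (auto simp: C_def)
  have cont': "AE \<omega> in M. continuous_on {0..T} (\<lambda>t. Z t \<omega>) \<and> continuous_on {0..T} (\<lambda>t. 0::real) \<and>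
      (\<forall>n. continuous_on {0..T} (\<lambda>t. K n t \<omega>) \<and> continuous_on {0..T} (\<lambda>t. 0::real))"
    using cont by eventually_elim auto
  let ?\<phi> = "\<lambda>t. expectation (\<lambda>\<omega>. ?u (Z t \<omega>))"
  let ?G = "\<lambda>t \<omega>. (?u2 (Z t \<omega>) * (2 - 2 * cos (2 * pi * Z t \<omega>))) / 2"
  note d = dynkin_deriv[OF Z ito_expansion_zero _ cont' du dv(1) dv(2) dv(2) bu bv(1) bv(2) bv(2) bv(2), simplified]
  have i: "integrable M (\<lambda>\<omega>. ?u (Z t \<omega>))" if "t \<in> {0..T}" for t using d(3) that by simp
  have der: "(?\<phi> has_real_derivative expectation (?G t)) (at t within {0..T})" and iG: "integrable M (?G t)" if t: "t \<in> {0..T}" for t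
  proof -
    have eq: "expectation (\<lambda>\<omega>. ?u2 (Z t \<omega>) * (\<Sum>n\<in>UNIV. (K n t \<omega>)\<^sup>2) / 2) = expectation (?G t)"
      by (intro Bochner_Integration.integral_cong refl) (simp add: K[OF t])
    have eq2: "integrable M (\<lambda>\<omega>. ?u2 (Z t \<omega>) * (\<Sum>n\<in>UNIV. (K n t \<omega>)\<^sup>2) / 2) = integrable M (?G t)"
      by (intro Bochner_Integration.integrable_cong refl) (simp add: K[OF t])
    show "(?\<phi> has_real_derivative expectation (?G t)) (at t within {0..T})"
      using d(1)[of t] t unfolding eq[symmetric] by simp
    show "integrable M (?G t)" using d(2)[of t] t unfolding eq2[symmetric] by simp
  qed
  define \<kappa> where "\<kappa> = (2 * pi)\<^sup>2"
  have \<kappa>: "0 \<le> \<kappa>" by (simp add: \<kappa>_def)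
  have Gle: "expectation (?G t) \<le> \<kappa> * ?\<phi> t" if t: "t \<in> {0..T}" for t
  proof -
    have "expectation (?G t) \<le> expectation (\<lambda>\<omega>. \<kappa> * ?u (Z t \<omega>))"
    proof (rule integral_mono[OF iG[OF t] integrable_mult_right[OF i[OF t]]])
      fix \<omega>
      \<comment> \<open>In terms of the cosine y the generator is \<kappa> y (1 - y), and y \<le> 1
        bounds it by \<kappa> (1 - y), a multiple of the test function itself.\<close>
      define y where "y = cos (2 * pi * Z t \<omega>)"
      have "\<kappa> * (y * (1 - y)) \<le> \<kappa> * (1 * (1 - y))"
        using \<kappa> by (intro mult_left_mono mult_right_mono) (auto simp: y_def)
      moreover have "\<kappa> * y * (2 - 2 * y) / 2 = \<kappa> * (y * (1 - y))" by (simp add: field_simps)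
      ultimately have "\<kappa> * y * (2 - 2 * y) / 2 \<le> \<kappa> * (1 - y)" by (simp only: mult_1)
      then show "?G t \<omega> \<le> \<kappa> * ?u (Z t \<omega>)" unfolding y_def \<kappa>_def .
    qed
    then show ?thesis using i[OF t] by simp
  qed
  have \<phi>0: "?\<phi> 0 = 0"
    by (rule integral_eq_zero_AE) (use Z0 in \<open>auto elim!: eventually_mono\<close>)
  \<comment> \<open>Gronwall by integrating factor: \<open>?f\<close> is nonincreasing and starts at
    0, while the expectation is nonnegative.\<close>
  let ?f = "\<lambda>s. ?\<phi> s * exp (- \<kappa> * s)"
  have fd: "(?f has_real_derivative (expectation (?G s) - \<kappa> * ?\<phi> s) * exp (- \<kappa> * s)) (at s within {0..T})" if "s \<in> {0..T}" for s
    by (rule derivative_eq_intros der[OF that] refl)+ (simp add: algebra_simps)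
  have "?f t \<le> ?f 0"
  proof (rule DERIV_nonpos_imp_decreasing_open[where f = ?f and a = 0 and b = t])
    show "0 \<le> t" using t by simp
    have "continuous_on {0..T} ?f" by (rule DERIV_continuous_on[OF fd])
    then show "continuous_on {0..t} ?f" by (rule continuous_on_subset) (use t in auto)
    fix s assume s: "0 < s" "s < t"
    then have "s \<in> {0<..<T}" and s': "s \<in> {0..T}" using t by auto
    then have "at s within {0..T} = at s" by (intro at_within_interior) (simp add: interior_atLeastAtMost_real)
    then have "(?f has_real_derivative (expectation (?G s) - \<kappa> * ?\<phi> s) * exp (- \<kappa> * s)) (at s)" using fd[OF s'] by simp
    moreover have "(expectation (?G s) - \<kappa> * ?\<phi> s) * exp (- \<kappa> * s) \<le> 0"
      using Gle[OF s'] by (intro mult_nonpos_nonneg) auto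
    ultimately show "\<exists>y. DERIV ?f s :> y \<and> y \<le> 0" by blast
  qed
  then have "?\<phi> t \<le> 0" using \<phi>0 by (simp add: mult_le_0_iff)
  moreover have "0 \<le> ?\<phi> t" by (intro integral_nonneg_AE) auto
  ultimately have "?\<phi> t = 0" by simp
  then have "AE \<omega> in M. ?u (Z t \<omega>) = 0"
    by (subst (asm) integral_nonneg_eq_0_iff_AE[OF i[OF t]]) auto
  then show ?thesis
  proof eventually_elim
    case (elim \<omega>)
    then obtain n :: int where "2 * pi * Z t \<omega> = of_int n * 2 * pi" by (auto simp: cos_one_2pi_int)
    then have "Z t \<omega> = of_int n" by simp
    then show ?case by simp
  qed
qed

end

section \<open>The trigonometric flow\<close>

text \<open>Component i of the n-th field as a function of one variable: it depends on
  \<open>x $ i\<close> alone, so the flow equation decouples into two scalar equations driven by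
  disjoint pairs of motions.\<close>

definition noise_coeff :: "2 \<Rightarrow> 4 \<Rightarrow> real \<Rightarrow> real" where
  "noise_coeff i n z =
     (if i = 1 then (if n = 1 then - sin (2 * pi * z) else if n = 2 then - cos (2 * pi * z) else 0)
      else (if n = 1 \<or> n = 2 then 0 else if n = 3 then - sin (2 * pi * z) else - cos (2 * pi * z)))"

definition noise_coeff_deriv :: "2 \<Rightarrow> 4 \<Rightarrow> real \<Rightarrow> real" where
  "noise_coeff_deriv i n z =
     (if i = 1 then (if n = 1 then - (2 * pi * cos (2 * pi * z)) else if n = 2 then 2 * pi * sin (2 * pi * z) else 0)
      else (if n = 1 \<or> n = 2 then 0 else if n = 3 then - (2 * pi * cos (2 * pi * z)) else 2 * pi * sin (2 * pi * z)))"

lemma trig_noise_component: "trig_noise n t \<omega> x $ i = noise_coeff i n (x $ i)"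
  using exhaust_2[of i] exhaust_4[of n] by (auto simp: trig_noise_def noise_coeff_def)

lemma noise_coeff_has_deriv: "(noise_coeff i n has_real_derivative noise_coeff_deriv i n z) (at z)"
  unfolding noise_coeff_def[abs_def] noise_coeff_deriv_def
  by (auto intro!: derivative_eq_intros)

lemma noise_coeff_le_1: "\<bar>noise_coeff i n z\<bar> \<le> 1"
  by (simp add: noise_coeff_def)

lemma noise_coeff_continuous: "continuous_on UNIV (noise_coeff i n)"
  using noise_coeff_has_deriv by (intro DERIV_continuous_on) (auto intro: has_field_derivative_at_within)

lemma noise_coeff_lipschitz: "\<bar>noise_coeff i n z - noise_coeff i n z'\<bar> \<le> 2 * pi * \<bar>z - z'\<bar>"
proof -
  have "norm (noise_coeff i n z - noise_coeff i n z') \<le> 2 * pi * norm (z - z')"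
  proof (rule field_differentiable_bound[where S = UNIV and f' = "noise_coeff_deriv i n"])
    show "(noise_coeff i n has_field_derivative noise_coeff_deriv i n z) (at z within UNIV)" for z
      using noise_coeff_has_deriv by simp
    show "norm (noise_coeff_deriv i n z) \<le> 2 * pi" for z
      using abs_cos_le_one[of "2 * pi * z"] abs_sin_le_one[of "2 * pi * z"]
      by (auto simp: noise_coeff_deriv_def abs_mult)
  qed auto
  then show ?thesis by simp
qed

lemma noise_coeff_disjoint: "noise_coeff 1 n z * noise_coeff 2 n z' = 0"
  by (simp add: noise_coeff_def)

text \<open>Half the derivative of \<Sum> \<beta>^2, which is constant equal to 1; this is why the
  Ito-Stratonovich correction in the drift vanishes.\<close>

lemma sum_noise_coeff_deriv: "(\<Sum>n\<in>UNIV. noise_coeff i n z * noise_coeff_deriv i n z) = 0"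
  using exhaust_2[of i] by (auto simp: sum_4 noise_coeff_def noise_coeff_deriv_def)

lemma sum_noise_coeff_square: "(\<Sum>n\<in>UNIV. (noise_coeff i n z)\<^sup>2) = 1"
  using exhaust_2[of i] by (auto simp: sum_4 noise_coeff_def)

text \<open>Up to sign the two nonzero coefficients are the coordinates of a point of the unit
  circle at angle 2 pi z, so this is a squared chord length and depends on z - z' only.\<close>

lemma sum_noise_coeff_diff_square:
  "(\<Sum>n\<in>UNIV. (noise_coeff i n z - noise_coeff i n z')\<^sup>2) = 2 - 2 * cos (2 * pi * (z - z'))"
proof -
  have "(- sin x - - sin y)\<^sup>2 + (- cos x - - cos y)\<^sup>2 = 2 - 2 * cos (x - y)" for x y :: real
    by (simp add: power2_diff cos_diff) (use sin_cos_squared_add[of x] sin_cos_squared_add[of y] in linarith)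
  from this[of "2 * pi * z" "2 * pi * z'"] show ?thesis
    using exhaust_2[of i] by (auto simp: sum_4 noise_coeff_def right_diff_distrib)
qed

lemma trig_noise_has_derivative:
  "(trig_noise n t \<omega> has_derivative (\<lambda>h. \<chi> i. h $ i * noise_coeff_deriv i n (x $ i))) (at x)"
proof (subst has_derivative_componentwise_within, intro ballI)
  fix b :: "real^2" assume "b \<in> Basis"
  then obtain i where b: "b = axis i 1" by (auto simp: Basis_vec_def)
  have "((\<lambda>y::real^2. noise_coeff i n (y $ i)) has_derivative (\<lambda>h. h $ i * noise_coeff_deriv i n (x $ i))) (at x)"
    by (rule DERIV_compose_FDERIV[OF noise_coeff_has_deriv])
       (rule bounded_linear_imp_has_derivative[OF bounded_linear_vec_nth])
  then show "((\<lambda>y. trig_noise n t \<omega> y \<bullet> b) has_derivative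
      (\<lambda>h. (\<chi> i. h $ i * noise_coeff_deriv i n (x $ i)) \<bullet> b)) (at x)"
    unfolding b by (simp add: inner_axis trig_noise_component)
qed

text \<open>Each field has a diagonal Jacobian, so the drift collapses to half of
  \<open>sum_noise_coeff_deriv\<close>.\<close>

lemma flow_drift_trig_noise: "flow_drift trig_noise t \<omega> x i = 0"
proof -
  have "jacobian (trig_noise n t \<omega>) (at x) $ i $ j = (axis j 1 :: real^2) $ i * noise_coeff_deriv i n (x $ i)" for n j
    unfolding jacobian_def frechet_derivative_at[OF trig_noise_has_derivative, symmetric] by (simp add: matrix_def)
  then have "flow_drift trig_noise t \<omega> x i
      = 1/2 * (\<Sum>n\<in>UNIV. \<Sum>j\<in>UNIV. noise_coeff j n (x $ j) * ((axis j 1 :: real^2) $ i * noise_coeff_deriv i n (x $ i)))"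
    unfolding flow_drift_def trig_noise_component by simp
  also have "(\<Sum>n\<in>UNIV. \<Sum>j\<in>UNIV. noise_coeff j n (x $ j) * ((axis j 1 :: real^2) $ i * noise_coeff_deriv i n (x $ i)))
      = (\<Sum>n\<in>UNIV. noise_coeff i n (x $ i) * noise_coeff_deriv i n (x $ i))"
  proof (rule sum.cong[OF refl])
    fix n
    have "(\<Sum>j\<in>UNIV. noise_coeff j n (x $ j) * ((axis j 1 :: real^2) $ i * noise_coeff_deriv i n (x $ i)))
      = (\<Sum>j\<in>UNIV. if j = i then noise_coeff i n (x $ i) * noise_coeff_deriv i n (x $ i) else 0)"
      by (rule sum.cong) (auto simp: axis_def)
    then show "(\<Sum>j\<in>UNIV. noise_coeff j n (x $ j) * ((axis j 1 :: real^2) $ i * noise_coeff_deriv i n (x $ i)))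
      = noise_coeff i n (x $ i) * noise_coeff_deriv i n (x $ i)" by simp
  qed
  finally show ?thesis by (simp add: sum_noise_coeff_deriv)
qed

section \<open>Jacobians as limits of quotients, and limits of the logarithmic coefficients\<close>

lemma jacobian_difference_quotient:
  fixes f :: "real^'m::finite \<Rightarrow> real^'d::finite"
  assumes "f differentiable (at x)"
  shows "(\<lambda>k. real (Suc k) * (f (x + (1 / real (Suc k)) *\<^sub>R axis j 1) $ i - f x $ i)) \<longlonglongrightarrow> jacobian f (at x) $ i $ j"
proof -
  let ?J = "jacobian f (at x)"
  have d: "(f has_derivative (\<lambda>h. ?J *v h)) (at x)" using assms by (simp add: jacobian_works)
  have g: "((\<lambda>h::real. x + h *\<^sub>R axis j 1) has_derivative (\<lambda>h. h *\<^sub>R axis j 1)) (at 0)"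
    by (auto intro!: derivative_eq_intros)
  have "((\<lambda>h::real. f (x + h *\<^sub>R axis j 1)) has_derivative (\<lambda>h. ?J *v (h *\<^sub>R axis j 1))) (at 0)"
    using has_derivative_compose[OF g, of f "\<lambda>h. ?J *v h"] d by simp
  then have "((\<lambda>h::real. f (x + h *\<^sub>R axis j 1) $ i) has_derivative (\<lambda>h. (?J *v (h *\<^sub>R axis j 1)) $ i)) (at 0)"
    by (rule bounded_linear.has_derivative[OF bounded_linear_vec_nth])
  moreover have "(?J *v (h *\<^sub>R axis j 1)) $ i = (?J $ i $ j) * h" for h :: real
    by (simp add: matrix_vector_mult_scaleR matrix_vector_mult_basis column_def)
  ultimately have "((\<lambda>h::real. f (x + h *\<^sub>R axis j 1) $ i) has_real_derivative ?J $ i $ j) (at 0)"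
    by (simp add: has_field_derivative_def)
  then have lim: "((\<lambda>h::real. (f (x + h *\<^sub>R axis j 1) $ i - f x $ i) / h) \<longlongrightarrow> ?J $ i $ j) (at 0)"
    by (simp add: has_field_derivative_iff)
  have "filterlim (\<lambda>k. 1 / real (Suc k)) (at 0) sequentially"
    unfolding filterlim_at using LIMSEQ_inverse_real_of_nat by (auto simp: inverse_eq_divide)
  from filterlim_compose[OF lim this] show ?thesis by (simp add: mult.commute)
qed

text \<open>Differentiating \<open>inv f (f y) = y\<close> shows the derivative to be injective.
  Once off-diagonal entries are known to vanish, a nonzero column forces a nonzero diagonal
  entry.\<close>

lemma C1_diffeomorphism_jacobian_column:
  fixes f :: "real^'d::finite \<Rightarrow> real^'d"
  assumes "C1_diffeomorphism f"
  shows "\<exists>i. jacobian f (at x) $ i $ j \<noteq> 0"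
proof (rule ccontr)
  assume "\<not> ?thesis"
  then have z: "jacobian f (at x) *v axis j 1 = 0"
    by (simp add: matrix_vector_mult_basis column_def vec_eq_iff)
  have bij: "bij f" and df: "f differentiable (at x)" and dg: "inv f differentiable (at (f x))"
    using assms by (auto simp: C1_diffeomorphism_def differentiable_on_def)
  have "((\<lambda>y. inv f (f y)) has_derivative (\<lambda>h. jacobian (inv f) (at (f x)) *v (jacobian f (at x) *v h))) (at x)"
    using has_derivative_compose[of f "\<lambda>h. jacobian f (at x) *v h" x UNIV "inv f" "\<lambda>h. jacobian (inv f) (at (f x)) *v h"]
      df dg by (simp add: jacobian_works)
  moreover have "inv f (f y) = y" for y using bij by (simp add: bij_is_inj)
  ultimately have "((\<lambda>y. y) has_derivative (\<lambda>h. jacobian (inv f) (at (f x)) *v (jacobian f (at x) *v h))) (at x)"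
    by simp
  from has_derivative_unique[OF this has_derivative_ident]
  have "jacobian (inv f) (at (f x)) *v (jacobian f (at x) *v axis j 1) = axis j (1::real)" by metis
  then show False unfolding z by (simp add: axis_eq_0_iff)
qed

text \<open>\<open>a k\<close> plays the variation rate of the quotient \<open>z k\<close>,
  asymptotically c J^2. The derivatives 1/J and -1/J^2 of the logarithm turn it into the constants c
  and -c; J \<noteq> 0 keeps the denominators away from 0 as \<epsilon> vanishes.\<close>

lemma log_coefficients_tendsto:
  fixes z a \<epsilon> :: "nat \<Rightarrow> real"
  assumes z: "z \<longlonglongrightarrow> J" and J: "J \<noteq> 0" and e: "\<epsilon> \<longlonglongrightarrow> 0" and a: "a \<longlonglongrightarrow> c * J\<^sup>2"
  shows "(\<lambda>k. lg (\<epsilon> k) (z k)) \<longlonglongrightarrow> ln \<bar>J\<bar>" "(\<lambda>k. (lg1 (\<epsilon> k) (z k))\<^sup>2 * a k) \<longlonglongrightarrow> c"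
    "(\<lambda>k. lg2 (\<epsilon> k) (z k) * a k) \<longlonglongrightarrow> - c"
proof -
  have q: "(\<lambda>k. (\<epsilon> k)\<^sup>2 + (z k)\<^sup>2) \<longlonglongrightarrow> 0\<^sup>2 + J\<^sup>2" by (intro tendsto_intros e z)
  have "(\<lambda>k. ln ((\<epsilon> k)\<^sup>2 + (z k)\<^sup>2) / 2) \<longlonglongrightarrow> ln (0\<^sup>2 + J\<^sup>2) / 2"
    using J by (intro tendsto_divide tendsto_ln q tendsto_const) auto
  moreover have "ln (0\<^sup>2 + J\<^sup>2) / 2 = ln \<bar>J\<bar>"
    using J ln_realpow[of "\<bar>J\<bar>" 2] by simp
  ultimately show "(\<lambda>k. lg (\<epsilon> k) (z k)) \<longlonglongrightarrow> ln \<bar>J\<bar>" unfolding lg_def by simp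
  have "(\<lambda>k. (z k / ((\<epsilon> k)\<^sup>2 + (z k)\<^sup>2))\<^sup>2 * a k) \<longlonglongrightarrow> (J / (0\<^sup>2 + J\<^sup>2))\<^sup>2 * (c * J\<^sup>2)"
    using J by (intro tendsto_intros q z a) auto
  moreover have "(J / (0\<^sup>2 + J\<^sup>2))\<^sup>2 * (c * J\<^sup>2) = c" using J by (simp add: power2_eq_square)
  ultimately show "(\<lambda>k. (lg1 (\<epsilon> k) (z k))\<^sup>2 * a k) \<longlonglongrightarrow> c" unfolding lg1_def by (simp only:)
  have "(\<lambda>k. ((\<epsilon> k)\<^sup>2 - (z k)\<^sup>2) / ((\<epsilon> k)\<^sup>2 + (z k)\<^sup>2)\<^sup>2 * a k) \<longlonglongrightarrow> (0\<^sup>2 - J\<^sup>2) / (0\<^sup>2 + J\<^sup>2)\<^sup>2 * (c * J\<^sup>2)"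
    using J by (intro tendsto_intros q z e a) auto
  moreover have "(0\<^sup>2 - J\<^sup>2) / (0\<^sup>2 + J\<^sup>2)\<^sup>2 * (c * J\<^sup>2) = - c" using J by (simp add: power2_eq_square)
  ultimately show "(\<lambda>k. lg2 (\<epsilon> k) (z k) * a k) \<longlonglongrightarrow> - c" unfolding lg2_def by simp
qed

text \<open>By the double-angle formula the chord term is 4 sin^2 (pi d). Writing the sine through
  \<open>sinc\<close> covers d = 0 and exhibits the rate of the quotient z as (2 pi z)^2 times a
  factor that is at most 1 and tends to 1 with d tending to 0.\<close>

lemma circle_distance_square:
  assumes h: "0 < h" "h * z = d"
  shows "(2 - 2 * cos (2 * pi * d)) / h\<^sup>2 = (2 * pi * z * sinc (pi * d))\<^sup>2"
proof -
  have "2 - 2 * cos (2 * pi * d) = 4 * (sin (pi * d))\<^sup>2"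
    using cos_double_sin[of "pi * d"] by (simp add: mult.assoc)
  moreover have "sin (pi * d) = pi * d * sinc (pi * d)" by simp
  ultimately have "2 - 2 * cos (2 * pi * d) = 4 * (pi * (h * z) * sinc (pi * d))\<^sup>2" unfolding h(2) by simp
  then show ?thesis using h(1) by (simp add: power_mult_distrib power2_eq_square)
qed

lemma sinc_le_1: "\<bar>sinc y\<bar> \<le> 1"
  using abs_sin_x_le_abs_x[of y] by (simp add: abs_divide divide_le_eq)

section \<open>The flow and its difference quotients\<close>

locale trig_flow = brownian_system M T F w for M :: "'w measure" and T and F and w :: "4 \<Rightarrow> real \<Rightarrow> 'w \<Rightarrow> real" +
  fixes \<xi> :: "real \<Rightarrow> 'w \<Rightarrow> real^2 \<Rightarrow> real^2"
  assumes flow: "stochastic_flow M T F w trig_noise \<xi>"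
begin

lemma flow_measurable: "t \<in> {0..T} \<Longrightarrow> (\<lambda>\<omega>. \<xi> t \<omega> y) \<in> borel_measurable (F t)"
  using flow by (auto simp: stochastic_flow_def solves_flow_sde_def)

lemma flow_component_measurable: "t \<in> {0..T} \<Longrightarrow> (\<lambda>\<omega>. \<xi> t \<omega> y $ i) \<in> borel_measurable (F t)"
  using measurable_compose[OF flow_measurable borel_measurable_nth] .

lemma flow_continuous: "AE \<omega> in M. continuous_on {0..T} (\<lambda>t. \<xi> t \<omega> y $ i)"
proof -
  have "AE \<omega> in M. continuous_on {0..T} (\<lambda>t. \<xi> t \<omega> y)"
    using flow by (auto simp: stochastic_flow_def solves_flow_sde_def)
  then show ?thesis by eventually_elim (intro continuous_intros)
qed

lemma flow_expansion:
  "ito_expansion (\<lambda>t \<omega>. \<xi> t \<omega> y $ i) (\<lambda>n t \<omega>. - noise_coeff i n (\<xi> t \<omega> y $ i))"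
  "AE \<omega> in M. \<xi> 0 \<omega> y $ i = y $ i"
proof -
  have "solves_flow_sde M T F w trig_noise (\<lambda>t \<omega>. \<xi> t \<omega> y) y"
    using flow by (simp add: stochastic_flow_def)
  then obtain I where I: "\<And>n. ito_integral M T F (w n) (\<lambda>t \<omega>. trig_noise n t \<omega> (\<xi> t \<omega> y) $ i) (I n)"
    and eq: "AE \<omega> in M. set_integrable lborel {0..T} (\<lambda>s. flow_drift trig_noise s \<omega> (\<xi> s \<omega> y) i) \<and>
           (\<forall>t\<in>{0..T}. \<xi> t \<omega> y $ i = y $ i
                + (LINT s:{0..t}|lborel. flow_drift trig_noise s \<omega> (\<xi> s \<omega> y) i) - (\<Sum>n\<in>UNIV. I n t \<omega>))"
    unfolding solves_flow_sde_def by blast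
  have eq': "AE \<omega> in M. \<forall>t\<in>{0..T}. \<xi> t \<omega> y $ i = y $ i - (\<Sum>n\<in>UNIV. I n t \<omega>)"
    using eq by eventually_elim (simp add: flow_drift_trig_noise)
  note sde = ito_expansion_sde[where \<beta> = "noise_coeff i" and L = "2 * pi" and X = "\<lambda>t \<omega>. \<xi> t \<omega> y $ i" and x = "y $ i",
      OF flow_component_measurable I[unfolded trig_noise_component] eq' noise_coeff_le_1 noise_coeff_lipschitz
        borel_measurable_continuous_onI[OF noise_coeff_continuous]]
  show "ito_expansion (\<lambda>t \<omega>. \<xi> t \<omega> y $ i) (\<lambda>n t \<omega>. - noise_coeff i n (\<xi> t \<omega> y $ i))"
    "AE \<omega> in M. \<xi> 0 \<omega> y $ i = y $ i" using sde by auto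
qed

text \<open>The difference quotient of component i in direction j with step 1/(k + 1). As a multiple
  of a difference of two solutions it inherits an Ito expansion, without differentiating the
  equation in x.\<close>

definition quot :: "2 \<Rightarrow> 2 \<Rightarrow> nat \<Rightarrow> real^2 \<Rightarrow> real \<Rightarrow> 'w \<Rightarrow> real" where
  "quot i j k x t \<omega> = real (Suc k) * (\<xi> t \<omega> (x + (1 / real (Suc k)) *\<^sub>R axis j 1) $ i - \<xi> t \<omega> x $ i)"

text \<open>The double minus is the form in which differences and scalings of expansions deliver the
  coefficient.\<close>

definition quot_noise :: "2 \<Rightarrow> 2 \<Rightarrow> nat \<Rightarrow> real^2 \<Rightarrow> 4 \<Rightarrow> real \<Rightarrow> 'w \<Rightarrow> real" where
  "quot_noise i j k x n t \<omega> = real (Suc k) *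
     (- noise_coeff i n (\<xi> t \<omega> (x + (1 / real (Suc k)) *\<^sub>R axis j 1) $ i) - - noise_coeff i n (\<xi> t \<omega> x $ i))"

lemma quot_expansion: "ito_expansion (quot i j k x) (quot_noise i j k x)"
  unfolding quot_def[abs_def] quot_noise_def[abs_def]
  by (intro ito_expansion_scale ito_expansion_diff flow_expansion(1))

lemma quot_continuous:
  "AE \<omega> in M. continuous_on {0..T} (\<lambda>t. quot i j k x t \<omega>) \<and> (\<forall>n. continuous_on {0..T} (\<lambda>t. quot_noise i j k x n t \<omega>))"
  using flow_continuous[of "x + (1 / real (Suc k)) *\<^sub>R axis j 1" i] flow_continuous[of x i]
proof eventually_elim
  case (elim \<omega>)
  note c = continuous_on_compose2[OF noise_coeff_continuous elim(1)] continuous_on_compose2[OF noise_coeff_continuous elim(2)]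
  show ?case unfolding quot_def quot_noise_def
    by (intro conjI allI continuous_on_mult continuous_on_diff continuous_on_minus continuous_on_const elim c subset_UNIV)
qed

text \<open>Only the quotient enters, not the position of the flow, because chord lengths depend on
  differences of angles alone.\<close>

lemma sum_quot_noise_square:
  "(\<Sum>n\<in>UNIV. (quot_noise i j k x n t \<omega>)\<^sup>2)
    = (2 * pi * quot i j k x t \<omega> * sinc (pi * (quot i j k x t \<omega> / real (Suc k))))\<^sup>2"
proof -
  let ?d = "\<xi> t \<omega> (x + (1 / real (Suc k)) *\<^sub>R axis j 1) $ i - \<xi> t \<omega> x $ i"
  have "(\<Sum>n\<in>UNIV. (quot_noise i j k x n t \<omega>)\<^sup>2) = (real (Suc k))\<^sup>2 *
      (\<Sum>n\<in>UNIV. (noise_coeff i n (\<xi> t \<omega> (x + (1 / real (Suc k)) *\<^sub>R axis j 1) $ i) - noise_coeff i n (\<xi> t \<omega> x $ i))\<^sup>2)"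
    unfolding quot_noise_def power_mult_distrib sum_distrib_left
    by (intro sum.cong refl arg_cong[where f = "\<lambda>x. _ * x"]) (simp add: power2_commute)
  also have "\<dots> = (2 - 2 * cos (2 * pi * ?d)) / (1 / real (Suc k))\<^sup>2"
    unfolding sum_noise_coeff_diff_square by (simp add: power_divide del: of_nat_Suc)
  also have "\<dots> = (2 * pi * quot i j k x t \<omega> * sinc (pi * ?d))\<^sup>2"
    by (rule circle_distance_square) (simp_all add: quot_def del: of_nat_Suc)
  also have "?d = quot i j k x t \<omega> / real (Suc k)" by (simp add: quot_def del: of_nat_Suc)
  finally show ?thesis .
qed

lemma quot_initial: "AE \<omega> in M. quot i j k x 0 \<omega> = (if i = j then 1 else 0)"
  using flow_expansion(2)[of "x + (1 / real (Suc k)) *\<^sub>R axis j 1" i] flow_expansion(2)[of x i]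
  by eventually_elim (auto simp: quot_def axis_def simp del: of_nat_Suc)

text \<open>A shift along axis j leaves coordinate i unchanged, so both components solve the same
  scalar equation from the same starting value. The test function 1 - cos sees the circle only,
  hence an integer rather than 0.\<close>

lemma flow_difference_integer:
  assumes "i \<noteq> j" "t \<in> {0..T}"
  shows "AE \<omega> in M. \<xi> t \<omega> (x + (1 / real (Suc k)) *\<^sub>R axis j 1) $ i - \<xi> t \<omega> x $ i \<in> \<int>"
proof -
  let ?y = "x + (1 / real (Suc k)) *\<^sub>R axis j 1"
  let ?K = "\<lambda>n t \<omega>. - noise_coeff i n (\<xi> t \<omega> ?y $ i) - - noise_coeff i n (\<xi> t \<omega> x $ i)"
  show ?thesis
  proof (rule ito_expansion_integer[of _ ?K])
    show "ito_expansion (\<lambda>t \<omega>. \<xi> t \<omega> ?y $ i - \<xi> t \<omega> x $ i) ?K"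
      by (intro ito_expansion_diff flow_expansion(1))
    show "(\<Sum>n\<in>UNIV. (?K n t \<omega>)\<^sup>2) = 2 - 2 * cos (2 * pi * (\<xi> t \<omega> ?y $ i - \<xi> t \<omega> x $ i))" for t \<omega>
    proof -
      have "(\<Sum>n\<in>UNIV. (?K n t \<omega>)\<^sup>2) = (\<Sum>n\<in>UNIV. (noise_coeff i n (\<xi> t \<omega> ?y $ i) - noise_coeff i n (\<xi> t \<omega> x $ i))\<^sup>2)"
        by (intro sum.cong refl) (simp add: power2_commute)
      then show ?thesis unfolding sum_noise_coeff_diff_square .
    qed
    show "AE \<omega> in M. continuous_on {0..T} (\<lambda>t. \<xi> t \<omega> ?y $ i - \<xi> t \<omega> x $ i) \<and> (\<forall>n. continuous_on {0..T} (\<lambda>t. ?K n t \<omega>))"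
      using flow_continuous[of ?y i] flow_continuous[of x i]
    proof eventually_elim
      case (elim \<omega>)
      note c = continuous_on_compose2[OF noise_coeff_continuous elim(1)] continuous_on_compose2[OF noise_coeff_continuous elim(2)]
      show ?case
        by (intro conjI allI continuous_on_diff continuous_on_minus elim c subset_UNIV)
    qed
    show "AE \<omega> in M. \<xi> 0 \<omega> ?y $ i - \<xi> 0 \<omega> x $ i = 0"
      using flow_expansion(2)[of ?y i] flow_expansion(2)[of x i]
      by eventually_elim (use assms(1) in \<open>auto simp: axis_def\<close>)
  qed (rule assms(2))
qed

text \<open>Integers that tend to 0 are eventually 0, so the off-diagonal quotients vanish from some
  k on; the diagonal entries are then nonzero because no column of the Jacobian vanishes.\<close>

lemma flow_jacobian:
  assumes t: "t \<in> {0..T}"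
  shows "AE \<omega> in M. \<forall>i j. (\<lambda>k. quot i j k x t \<omega>) \<longlonglongrightarrow> jacobian (\<xi> t \<omega>) (at x) $ i $ j"
    "AE \<omega> in M. \<forall>i j. (jacobian (\<xi> t \<omega>) (at x) $ i $ j = 0) \<longleftrightarrow> i \<noteq> j"
proof -
  have diffeo: "AE \<omega> in M. C1_diffeomorphism (\<xi> t \<omega>)"
  proof -
    have "AE \<omega> in M. \<forall>t\<in>{0..T}. C1_diffeomorphism (\<xi> t \<omega>)" using flow unfolding stochastic_flow_def by auto
    then show ?thesis by eventually_elim (use t in auto)
  qed
  then show lim: "AE \<omega> in M. \<forall>i j. (\<lambda>k. quot i j k x t \<omega>) \<longlonglongrightarrow> jacobian (\<xi> t \<omega>) (at x) $ i $ j"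
  proof eventually_elim
    case (elim \<omega>)
    then have "\<xi> t \<omega> differentiable (at x)" by (auto simp: C1_diffeomorphism_def differentiable_on_def)
    from jacobian_difference_quotient[OF this] show ?case unfolding quot_def by blast
  qed
  \<comment> \<open>Only countably many steps 1/(k + 1) occur, so one null set serves for all of
    them.\<close>
  have "AE \<omega> in M. \<forall>i j. i \<noteq> j \<longrightarrow> (\<forall>k. \<xi> t \<omega> (x + (1 / real (Suc k)) *\<^sub>R axis j 1) $ i - \<xi> t \<omega> x $ i \<in> \<int>)"
    using flow_difference_integer[OF _ t]
    by (simp add: AE_all_countable)
  with diffeo lim show "AE \<omega> in M. \<forall>i j. (jacobian (\<xi> t \<omega>) (at x) $ i $ j = 0) \<longleftrightarrow> i \<noteq> j"
  proof eventually_elim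
    case (elim \<omega>)
    let ?J = "jacobian (\<xi> t \<omega>) (at x)"
    have off: "?J $ i $ j = 0" if ij: "i \<noteq> j" for i j
    proof -
      let ?d = "\<lambda>k. \<xi> t \<omega> (x + (1 / real (Suc k)) *\<^sub>R axis j 1) $ i - \<xi> t \<omega> x $ i"
      have q: "(\<lambda>k. quot i j k x t \<omega>) \<longlonglongrightarrow> ?J $ i $ j" using elim(2) by blast
      \<comment> \<open>Quotient times step is the difference itself, so convergence of the
        quotients sends the differences to 0.\<close>
      have "(\<lambda>k. inverse (real (Suc k)) * quot i j k x t \<omega>) \<longlonglongrightarrow> 0 * ?J $ i $ j"
        by (intro tendsto_mult LIMSEQ_inverse_real_of_nat q)
      moreover have "(\<lambda>k. inverse (real (Suc k)) * quot i j k x t \<omega>) = ?d"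
        by (rule ext) (simp add: quot_def del: of_nat_Suc)
      ultimately have "?d \<longlonglongrightarrow> 0" by simp
      then have "eventually (\<lambda>k. norm (?d k) < 1) sequentially"
        by (rule order_tendstoD(2)[OF tendsto_norm_zero]) simp
      then have "eventually (\<lambda>k. quot i j k x t \<omega> = 0) sequentially"
      proof eventually_elim
        case (elim k)
        have "?d k \<in> \<int>" using \<open>\<forall>i j. i \<noteq> j \<longrightarrow> _ i j\<close> ij by blast
        then obtain z :: int where z: "?d k = of_int z" by (auto elim: Ints_cases)
        then have "real_of_int \<bar>z\<bar> < 1" using elim by simp
        then have "\<bar>z\<bar> < 1" by (simp only: of_int_less_1_iff)
        then have "?d k = 0" using z by simp
        then show ?case by (simp add: quot_def)
      qed
      then have "(\<lambda>k. quot i j k x t \<omega>) \<longlonglongrightarrow> 0" by (rule tendsto_eventually)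
      with q show ?thesis by (rule LIMSEQ_unique)
    qed
    show ?case
    proof (intro allI)
      fix i j
      obtain i' where "?J $ i' $ j \<noteq> 0" using C1_diffeomorphism_jacobian_column[OF elim(1)] by blast
      then show "(?J $ i $ j = 0) \<longleftrightarrow> i \<noteq> j" using off by metis
    qed
  qed
qed

text \<open>
  Along \<open>h = \<epsilon> = 1/(k+1)\<close> the generator applied to \<open>cos (\<theta> D + c)\<close> becomes \<open>- (2\<pi>\<theta>)\<^sup>2 cos (\<theta> D + c)\<close> for
  \<open>D = ln \<bar>J1\<bar> - ln \<bar>J2\<bar>\<close>: the first-order terms of the two logarithms cancel.
\<close>

lemma expectation_cos_log_ratio:
  fixes \<theta> c :: real
  assumes t: "t \<in> {0..T}" and D: "D \<in> borel_measurable M"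
    and D_eq: "AE \<omega> in M. D \<omega> = ln \<bar>jacobian (\<xi> t \<omega>) (at x) $ 1 $ 1\<bar> - ln \<bar>jacobian (\<xi> t \<omega>) (at x) $ 2 $ 2\<bar>"
  shows "expectation (\<lambda>\<omega>. cos (\<theta> * D \<omega> + c)) = cos c * exp (- (2 * pi * \<theta>)\<^sup>2 * t)"
proof -
  define \<kappa> where "\<kappa> = (2 * pi * \<theta>)\<^sup>2"
  \<comment> \<open>Regularisation and step shrink together, so that a single limit in k removes
    both.\<close>
  define \<epsilon> where "\<epsilon> k = inverse (real (Suc k))" for k
  have e: "0 < \<epsilon> k" for k by (simp add: \<epsilon>_def)
  have e0: "\<epsilon> \<longlonglongrightarrow> 0" unfolding \<epsilon>_def[abs_def] by (rule LIMSEQ_inverse_real_of_nat)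
  define Z where "Z i k = quot i i k x" for i k
  define A where "A i k t \<omega> = (\<Sum>n\<in>UNIV. (quot_noise i i k x n t \<omega>)\<^sup>2)" for i k t \<omega>
  define \<Phi> where "\<Phi> k t \<omega> = \<theta> * (lg (\<epsilon> k) (Z 1 k t \<omega>) - lg (\<epsilon> k) (Z 2 k t \<omega>)) + c" for k t \<omega>
  define G where "G k t \<omega> = ((- \<theta>\<^sup>2 * (lg1 (\<epsilon> k) (Z 1 k t \<omega>))\<^sup>2 * cos (\<Phi> k t \<omega>) - \<theta> * lg2 (\<epsilon> k) (Z 1 k t \<omega>) * sin (\<Phi> k t \<omega>)) * A 1 k t \<omega>
      + (- \<theta>\<^sup>2 * (lg1 (\<epsilon> k) (Z 2 k t \<omega>))\<^sup>2 * cos (\<Phi> k t \<omega>) + \<theta> * lg2 (\<epsilon> k) (Z 2 k t \<omega>) * sin (\<Phi> k t \<omega>)) * A 2 k t \<omega>) / 2"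
    for k t \<omega>
  have orth: "quot_noise 1 1 k x n t \<omega> * quot_noise 2 2 k x n t \<omega> = 0" for n t \<omega> k
    unfolding quot_noise_def by (auto simp: noise_coeff_def)
  have cont: "AE \<omega> in M. continuous_on {0..T} (\<lambda>t. quot 1 1 k x t \<omega>) \<and> continuous_on {0..T} (\<lambda>t. quot 2 2 k x t \<omega>) \<and>
      (\<forall>n. continuous_on {0..T} (\<lambda>t. quot_noise 1 1 k x n t \<omega>) \<and> continuous_on {0..T} (\<lambda>t. quot_noise 2 2 k x n t \<omega>))" for k
    using quot_continuous[of 1 1 k x] quot_continuous[of 2 2 k x] by eventually_elim auto
  have dyn: "((\<lambda>t. expectation (\<lambda>\<omega>. cos (\<Phi> k t \<omega>))) has_real_derivative expectation (G k t)) (at t within {0..T})"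
    "integrable M (G k t)" "integrable M (\<lambda>\<omega>. cos (\<Phi> k t \<omega>))" if "t \<in> {0..T}" for k t
    using dynkin_log_ratio[OF quot_expansion quot_expansion orth cont e that, where \<theta> = \<theta> and c = c]
    unfolding \<Phi>_def G_def Z_def A_def by blast+
  have Ab: "0 \<le> A i k t \<omega>" "A i k t \<omega> \<le> (2 * pi)\<^sup>2 * (Z i k t \<omega>)\<^sup>2" for i k t \<omega>
  proof -
    let ?s = "sinc (pi * (quot i i k x t \<omega> / real (Suc k)))"
    have "A i k t \<omega> = (2 * pi)\<^sup>2 * (Z i k t \<omega>)\<^sup>2 * ?s\<^sup>2"
      unfolding A_def Z_def sum_quot_noise_square power_mult_distrib ..
    moreover have "?s\<^sup>2 \<le> 1" using sinc_le_1 by (simp only: abs_square_le_1)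
    ultimately show "A i k t \<omega> \<le> (2 * pi)\<^sup>2 * (Z i k t \<omega>)\<^sup>2"
      using mult_left_le[of "?s\<^sup>2" "(2 * pi)\<^sup>2 * (Z i k t \<omega>)\<^sup>2"] by simp
    show "0 \<le> A i k t \<omega>" unfolding A_def by (intro sum_nonneg) auto
  qed
  \<comment> \<open>A bound for each half of G that is uniform in k, as dominated convergence
    requires: the rate is at most (2 pi Z)^2, and Z^2 times the square of \<open>lg1\<close> or
    times |\<open>lg2\<close>| is at most 1.\<close>
  define E where "E = (2 * pi)\<^sup>2 * (\<theta>\<^sup>2 + \<bar>\<theta>\<bar>)"
  have E0: "0 \<le> E" by (simp add: E_def)
  have half: "\<bar>(- \<theta>\<^sup>2 * (lg1 (\<epsilon> k) (Z i k t \<omega>))\<^sup>2 * y + \<theta> * lg2 (\<epsilon> k) (Z i k t \<omega>) * y') * A i k t \<omega>\<bar> \<le> E"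
    if "\<bar>y\<bar> \<le> 1" "\<bar>y'\<bar> \<le> 1" for i k t \<omega> y y'
  proof -
    let ?z = "Z i k t \<omega>"
    let ?p = "(lg1 (\<epsilon> k) ?z)\<^sup>2" and ?r = "lg2 (\<epsilon> k) ?z"
    have "\<bar>- \<theta>\<^sup>2 * ?p * y + \<theta> * ?r * y'\<bar> \<le> \<theta>\<^sup>2 * ?p + \<bar>\<theta>\<bar> * \<bar>?r\<bar>"
    proof -
      have "\<bar>- \<theta>\<^sup>2 * ?p * y\<bar> \<le> \<theta>\<^sup>2 * ?p" using that(1) by (simp add: abs_mult mult_left_le)
      moreover have "\<bar>\<theta> * ?r * y'\<bar> \<le> \<bar>\<theta>\<bar> * \<bar>?r\<bar>" using that(2) by (simp add: abs_mult mult_left_le)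
      ultimately show ?thesis by linarith
    qed
    then have "\<bar>(- \<theta>\<^sup>2 * ?p * y + \<theta> * ?r * y') * A i k t \<omega>\<bar> \<le> (\<theta>\<^sup>2 * ?p + \<bar>\<theta>\<bar> * \<bar>?r\<bar>) * ((2 * pi)\<^sup>2 * ?z\<^sup>2)"
      unfolding abs_mult[of _ "A i k t \<omega>"] using Ab[of i k t \<omega>] by (intro mult_mono) auto
    also have "\<dots> = (2 * pi)\<^sup>2 * (\<theta>\<^sup>2 * (?p * ?z\<^sup>2) + \<bar>\<theta>\<bar> * (\<bar>?r\<bar> * ?z\<^sup>2))" by (simp add: algebra_simps)
    also have "\<dots> \<le> (2 * pi)\<^sup>2 * (\<theta>\<^sup>2 * 1 + \<bar>\<theta>\<bar> * 1)"
      using lg_bounds(4,5)[OF e, of k ?z] by (intro mult_left_mono add_mono) auto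
    finally show ?thesis by (simp add: E_def)
  qed
  have Gb: "\<bar>G k t \<omega> + \<kappa> * cos (\<Phi> k t \<omega>)\<bar> \<le> E + \<kappa>" for k t \<omega>
  proof -
    have "\<bar>(- \<theta>\<^sup>2 * (lg1 (\<epsilon> k) (Z 1 k t \<omega>))\<^sup>2 * cos (\<Phi> k t \<omega>) - \<theta> * lg2 (\<epsilon> k) (Z 1 k t \<omega>) * sin (\<Phi> k t \<omega>)) * A 1 k t \<omega>\<bar> \<le> E"
      using half[of "cos (\<Phi> k t \<omega>)" "- sin (\<Phi> k t \<omega>)" k 1 t \<omega>] by simp
    moreover have "\<bar>(- \<theta>\<^sup>2 * (lg1 (\<epsilon> k) (Z 2 k t \<omega>))\<^sup>2 * cos (\<Phi> k t \<omega>) + \<theta> * lg2 (\<epsilon> k) (Z 2 k t \<omega>) * sin (\<Phi> k t \<omega>)) * A 2 k t \<omega>\<bar> \<le> E"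
      using half[of "cos (\<Phi> k t \<omega>)" "sin (\<Phi> k t \<omega>)" k 2 t \<omega>] by simp
    moreover have "\<bar>\<kappa> * cos (\<Phi> k t \<omega>)\<bar> \<le> \<kappa>" by (simp add: abs_mult \<kappa>_def mult_left_le)
    moreover have "\<bar>(a + b) / 2 + d\<bar> \<le> E + \<kappa>" if "\<bar>a\<bar> \<le> E" "\<bar>b\<bar> \<le> E" "\<bar>d\<bar> \<le> \<kappa>" for a b d :: real
      using that by (auto simp: abs_le_iff field_simps)
    ultimately show ?thesis unfolding G_def by blast
  qed
  let ?\<Phi> = "\<lambda>t \<omega>. \<theta> * (ln \<bar>jacobian (\<xi> t \<omega>) (at x) $ 1 $ 1\<bar> - ln \<bar>jacobian (\<xi> t \<omega>) (at x) $ 2 $ 2\<bar>) + c"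
  have lim: "AE \<omega> in M. (\<lambda>k. \<Phi> k t \<omega>) \<longlonglongrightarrow> ?\<Phi> t \<omega> \<and> (\<lambda>k. G k t \<omega> + \<kappa> * cos (\<Phi> k t \<omega>)) \<longlonglongrightarrow> 0"
    if t: "t \<in> {0..T}" for t
    using flow_jacobian[OF t, of x]
  proof eventually_elim
    case (elim \<omega>)
    let ?J = "\<lambda>i. jacobian (\<xi> t \<omega>) (at x) $ i $ i"
    have z: "(\<lambda>k. Z i k t \<omega>) \<longlonglongrightarrow> ?J i" and J: "?J i \<noteq> 0" for i using elim by (auto simp: Z_def)
    have a: "(\<lambda>k. A i k t \<omega>) \<longlonglongrightarrow> (2 * pi)\<^sup>2 * (?J i)\<^sup>2" for i
    proof -
      have "(\<lambda>k. Z i k t \<omega> * \<epsilon> k) \<longlonglongrightarrow> ?J i * 0" by (intro tendsto_mult z e0)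
      then have "(\<lambda>k. pi * (Z i k t \<omega> * \<epsilon> k)) \<longlonglongrightarrow> pi * 0" by (intro tendsto_mult tendsto_const) simp
      then have "(\<lambda>k. sinc (pi * (Z i k t \<omega> * \<epsilon> k))) \<longlonglongrightarrow> sinc (pi * 0)" by (rule isCont_tendsto_compose[OF isCont_sinc])
      then have "(\<lambda>k. (2 * pi * Z i k t \<omega> * sinc (pi * (Z i k t \<omega> * \<epsilon> k)))\<^sup>2) \<longlonglongrightarrow> (2 * pi * ?J i * sinc (pi * 0))\<^sup>2"
        by (intro tendsto_power tendsto_mult tendsto_const z)
      then show ?thesis
        unfolding A_def sum_quot_noise_square Z_def[symmetric] \<epsilon>_def divide_inverse[symmetric] by (simp add: power_mult_distrib)
    qed
    note l = log_coefficients_tendsto[OF z J e0 a]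
    have p: "(\<lambda>k. \<Phi> k t \<omega>) \<longlonglongrightarrow> ?\<Phi> t \<omega>"
      unfolding \<Phi>_def by (intro tendsto_intros l(1))
    let ?c = "cos (?\<Phi> t \<omega>)" and ?s = "sin (?\<Phi> t \<omega>)"
    \<comment> \<open>Both rates have the constant c = (2 pi)^2 in
      \<open>log_coefficients_tendsto\<close>. The sine terms of the two logarithms cancel, and the
      cosine terms average to -\<kappa> cos, which the added \<kappa> cos removes.\<close>
    have "(\<lambda>k. (- \<theta>\<^sup>2 * ((lg1 (\<epsilon> k) (Z 1 k t \<omega>))\<^sup>2 * A 1 k t \<omega>) * cos (\<Phi> k t \<omega>) - \<theta> * (lg2 (\<epsilon> k) (Z 1 k t \<omega>) * A 1 k t \<omega>) * sin (\<Phi> k t \<omega>)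
      + (- \<theta>\<^sup>2 * ((lg1 (\<epsilon> k) (Z 2 k t \<omega>))\<^sup>2 * A 2 k t \<omega>) * cos (\<Phi> k t \<omega>) + \<theta> * (lg2 (\<epsilon> k) (Z 2 k t \<omega>) * A 2 k t \<omega>) * sin (\<Phi> k t \<omega>))) / 2
        + \<kappa> * cos (\<Phi> k t \<omega>))
      \<longlonglongrightarrow> (- \<theta>\<^sup>2 * (2 * pi)\<^sup>2 * ?c - \<theta> * (- (2 * pi)\<^sup>2) * ?s + (- \<theta>\<^sup>2 * (2 * pi)\<^sup>2 * ?c + \<theta> * (- (2 * pi)\<^sup>2) * ?s)) / 2 + \<kappa> * ?c"
      by (intro tendsto_add tendsto_diff tendsto_mult tendsto_divide tendsto_const l(2,3) tendsto_cos tendsto_sin p) simp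
    also have "(- \<theta>\<^sup>2 * (2 * pi)\<^sup>2 * ?c - \<theta> * (- (2 * pi)\<^sup>2) * ?s + (- \<theta>\<^sup>2 * (2 * pi)\<^sup>2 * ?c + \<theta> * (- (2 * pi)\<^sup>2) * ?s)) / 2 + \<kappa> * ?c = 0"
      unfolding \<kappa>_def by (simp add: power_mult_distrib)
    finally have "(\<lambda>k. G k t \<omega> + \<kappa> * cos (\<Phi> k t \<omega>)) \<longlonglongrightarrow> 0"
      unfolding G_def by (simp add: algebra_simps)
    with p show ?case by blast
  qed
  \<comment> \<open>\<open>f k\<close> is the time derivative of \<open>\<phi> k\<close> times exp
    (\<kappa> s) and tends to 0 pointwise. The limit is taken in the integrated identity, since
    convergence of derivatives is not what is wanted: the values at time t are.\<close>
  define f where "f k s = expectation (\<lambda>\<omega>. G k s \<omega> + \<kappa> * cos (\<Phi> k s \<omega>)) * exp (\<kappa> * s)" for k s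
  define \<phi> where "\<phi> k s = expectation (\<lambda>\<omega>. cos (\<Phi> k s \<omega>))" for k s
  have sub: "s \<in> {0..T}" if "s \<in> {0..t}" for s using that t by auto
  have fi: "(f k has_integral \<phi> k t * exp (\<kappa> * t) - \<phi> k 0 * exp (\<kappa> * 0)) {0..t}" for k
  proof (rule fundamental_theorem_of_calculus)
    show "0 \<le> t" using t by simp
    fix s assume s: "s \<in> {0..t}"
    have "((\<lambda>s. \<phi> k s * exp (\<kappa> * s)) has_real_derivative expectation (G k s) * exp (\<kappa> * s) + \<phi> k s * (exp (\<kappa> * s) * \<kappa>)) (at s within {0..T})"
      unfolding \<phi>_def by (rule derivative_eq_intros dyn(1)[OF sub[OF s]] refl | simp)+
    moreover have "expectation (G k s) * exp (\<kappa> * s) + \<phi> k s * (exp (\<kappa> * s) * \<kappa>) = f k s"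
      using dyn(2,3)[OF sub[OF s], of k] unfolding f_def \<phi>_def by (simp add: algebra_simps)
    ultimately have "((\<lambda>s. \<phi> k s * exp (\<kappa> * s)) has_real_derivative f k s) (at s within {0..T})" by simp
    then have "((\<lambda>s. \<phi> k s * exp (\<kappa> * s)) has_real_derivative f k s) (at s within {0..t})"
      by (rule DERIV_subset) (use t in auto)
    then show "((\<lambda>s. \<phi> k s * exp (\<kappa> * s)) has_vector_derivative f k s) (at s within {0..t})"
      by (simp add: has_real_derivative_iff_has_vector_derivative)
  qed
  have f0: "(\<lambda>k. f k s) \<longlonglongrightarrow> 0" if s: "s \<in> {0..t}" for s
  proof -
    have "(\<lambda>k. expectation (\<lambda>\<omega>. G k s \<omega> + \<kappa> * cos (\<Phi> k s \<omega>))) \<longlonglongrightarrow> expectation (\<lambda>\<omega>. 0)"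
    proof (rule integral_dominated_convergence[where w = "\<lambda>_. E + \<kappa>"])
      show "(\<lambda>\<omega>. G k s \<omega> + \<kappa> * cos (\<Phi> k s \<omega>)) \<in> borel_measurable M" for k
        using borel_measurable_integrable[OF dyn(2)[OF sub[OF s]]] borel_measurable_integrable[OF dyn(3)[OF sub[OF s]]]
        by measurable
      show "AE \<omega> in M. (\<lambda>k. G k s \<omega> + \<kappa> * cos (\<Phi> k s \<omega>)) \<longlonglongrightarrow> 0"
        using lim[OF sub[OF s]] by eventually_elim blast
    qed (use Gb in auto)
    then have "(\<lambda>k. f k s) \<longlonglongrightarrow> expectation (\<lambda>\<omega>. 0) * exp (\<kappa> * s)"
      unfolding f_def by (intro tendsto_mult tendsto_const)
    then show ?thesis by simp
  qed
  have fb: "norm (f k s) \<le> (E + \<kappa>) * exp (\<kappa> * t)" if s: "s \<in> {0..t}" for k s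
  proof -
    have "\<bar>expectation (\<lambda>\<omega>. G k s \<omega> + \<kappa> * cos (\<Phi> k s \<omega>))\<bar> \<le> expectation (\<lambda>\<omega>. \<bar>G k s \<omega> + \<kappa> * cos (\<Phi> k s \<omega>)\<bar>)"
      by (rule integral_abs_bound)
    also have "\<dots> \<le> expectation (\<lambda>\<omega>. E + \<kappa>)"
      using dyn(2,3)[OF sub[OF s], of k] Gb by (intro integral_mono) auto
    finally have "\<bar>expectation (\<lambda>\<omega>. G k s \<omega> + \<kappa> * cos (\<Phi> k s \<omega>))\<bar> \<le> E + \<kappa>" by (simp add: prob_space)
    moreover have "exp (\<kappa> * s) \<le> exp (\<kappa> * t)" using s by (simp add: \<kappa>_def mult_left_mono)
    ultimately show ?thesis unfolding f_def real_norm_def abs_mult using E0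
      by (intro mult_mono) (auto simp: \<kappa>_def)
  qed
  have "(\<lambda>k. integral {0..t} (f k)) \<longlonglongrightarrow> integral {0..t} (\<lambda>s. 0)"
    by (rule dominated_convergence(2)[where h = "\<lambda>_. (E + \<kappa>) * exp (\<kappa> * t)"])
       (use fi fb f0 in \<open>auto intro: has_integral_integrable\<close>)
  moreover have "integral {0..t} (f k) = \<phi> k t * exp (\<kappa> * t) - cos c" for k
  proof -
    \<comment> \<open>At time 0 both diagonal quotients equal 1 almost surely, so the two
      regularised logarithms cancel for every k.\<close>
    have "\<phi> k 0 = expectation (\<lambda>\<omega>. cos c)"
      unfolding \<phi>_def
    proof (rule integral_cong_AE)
      show "(\<lambda>\<omega>. cos (\<Phi> k 0 \<omega>)) \<in> borel_measurable M"
        using borel_measurable_integrable[OF dyn(3)] T_pos by auto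
      show "AE \<omega> in M. cos (\<Phi> k 0 \<omega>) = cos c"
        using quot_initial[of 1 1 k x] quot_initial[of 2 2 k x]
        by eventually_elim (simp add: \<Phi>_def Z_def)
    qed simp
    then show ?thesis using integral_unique[OF fi[of k]] by (simp add: prob_space)
  qed
  ultimately have "(\<lambda>k. \<phi> k t * exp (\<kappa> * t) - cos c) \<longlonglongrightarrow> 0" by simp
  moreover have "(\<lambda>k. \<phi> k t * exp (\<kappa> * t) - cos c) \<longlonglongrightarrow> expectation (\<lambda>\<omega>. cos (\<theta> * D \<omega> + c)) * exp (\<kappa> * t) - cos c"
  proof (intro tendsto_diff tendsto_mult tendsto_const)
    show "(\<lambda>k. \<phi> k t) \<longlonglongrightarrow> expectation (\<lambda>\<omega>. cos (\<theta> * D \<omega> + c))"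
      unfolding \<phi>_def
    proof (rule integral_dominated_convergence[where w = "\<lambda>_. 1"])
      show "(\<lambda>\<omega>. cos (\<theta> * D \<omega> + c)) \<in> borel_measurable M" using D by measurable
      show "(\<lambda>\<omega>. cos (\<Phi> k t \<omega>)) \<in> borel_measurable M" for k using borel_measurable_integrable[OF dyn(3)[OF t]] .
      show "AE \<omega> in M. (\<lambda>k. cos (\<Phi> k t \<omega>)) \<longlonglongrightarrow> cos (\<theta> * D \<omega> + c)"
        using lim[OF t] D_eq by eventually_elim (auto intro!: tendsto_cos)
    qed auto
  qed
  ultimately have "expectation (\<lambda>\<omega>. cos (\<theta> * D \<omega> + c)) * exp (\<kappa> * t) - cos c = 0"
    using LIMSEQ_unique by blast
  then have "expectation (\<lambda>\<omega>. cos (\<theta> * D \<omega> + c)) = cos c / exp (\<kappa> * t)" by (simp add: field_simps)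
  then show ?thesis by (simp add: exp_minus \<kappa>_def field_simps)
qed

end

section \<open>The ellipticity ratio\<close>

lemma matrix_inv_eqI:
  fixes A B :: "real^'n::finite^'n"
  assumes "A ** B = mat 1" "B ** A = mat 1"
  shows "matrix_inv A = B"
proof -
  have "A ** matrix_inv A = mat 1 \<and> matrix_inv A ** A = mat 1"
    unfolding matrix_inv_def by (rule someI[of _ B]) (use assms in simp)
  then have "matrix_inv A = matrix_inv A ** (A ** B)" using assms by simp
  also have "\<dots> = B" using \<open>A ** matrix_inv A = mat 1 \<and> matrix_inv A ** A = mat 1\<close> by (simp add: matrix_mul_assoc)
  finally show ?thesis .
qed

lemma matrix_inv_diagonal:
  fixes A :: "real^2^2"
  assumes "A $ 1 $ 2 = 0" "A $ 2 $ 1 = 0" "A $ 1 $ 1 \<noteq> 0" "A $ 2 $ 2 \<noteq> 0"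
  shows "matrix_inv A = (\<chi> i j. if i = j then 1 / A $ i $ i else 0)"
  by (rule matrix_inv_eqI)
     (use assms in \<open>simp_all add: matrix_matrix_mult_def mat_def vec_eq_iff forall_2 sum_2\<close>)

text \<open>On the unit circle the form is a convex combination of the two diagonal entries, so both
  extrema are attained at coordinate vectors.\<close>

lemma ellipticity_ratio_diagonal:
  fixes A :: "real^2^2"
  assumes A: "A $ 1 $ 2 = 0" "A $ 2 $ 1 = 0" "0 < A $ 1 $ 1" "0 < A $ 2 $ 2"
  shows "ellipticity_ratio A = max (A $ 1 $ 1) (A $ 2 $ 2) / min (A $ 1 $ 1) (A $ 2 $ 2)"
proof -
  let ?p = "A $ 1 $ 1" and ?q = "A $ 2 $ 2"
  let ?f = "\<lambda>\<eta>::real^2. \<bar>\<Sum>i\<in>UNIV. \<Sum>j\<in>UNIV. \<eta> $ i * A $ i $ j * \<eta> $ j\<bar>"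
  have f: "?f \<eta> = ?p * (\<eta> $ 1)\<^sup>2 + ?q * (\<eta> $ 2)\<^sup>2" for \<eta>
  proof -
    have "(\<Sum>i\<in>UNIV. \<Sum>j\<in>UNIV. \<eta> $ i * A $ i $ j * \<eta> $ j) = ?p * (\<eta> $ 1)\<^sup>2 + ?q * (\<eta> $ 2)\<^sup>2"
      using A(1,2) by (simp add: sum_2 power2_eq_square mult_ac)
    then show ?thesis using A(3,4) by simp
  qed
  have n: "(\<eta> $ 1)\<^sup>2 + (\<eta> $ 2)\<^sup>2 = 1" if "norm \<eta> = 1" for \<eta> :: "real^2"
    using that by (simp add: norm_vec_def L2_set_def sum_2)
  have ax: "?f (axis 1 1) = ?p" "?f (axis 2 1) = ?q" unfolding f by (simp_all add: axis_def)
  have na: "norm (axis i (1::real) :: real^2) = 1" for i by simp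
  have "?p \<in> ?f ` {\<eta>. norm \<eta> = 1}"
    by (rule image_eqI[where x = "axis 1 1"]) (simp_all only: ax na mem_Collect_eq)
  moreover have "?q \<in> ?f ` {\<eta>. norm \<eta> = 1}"
    by (rule image_eqI[where x = "axis 2 1"]) (simp_all only: ax na mem_Collect_eq)
  ultimately have "max ?p ?q \<in> ?f ` {\<eta>. norm \<eta> = 1}" "min ?p ?q \<in> ?f ` {\<eta>. norm \<eta> = 1}"
    by (simp_all add: max_def min_def)
  moreover have "?f \<eta> \<le> max ?p ?q \<and> min ?p ?q \<le> ?f \<eta>" if "norm \<eta> = 1" for \<eta>
  proof -
    have "?f \<eta> \<le> max ?p ?q * (\<eta> $ 1)\<^sup>2 + max ?p ?q * (\<eta> $ 2)\<^sup>2"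
      unfolding f by (intro add_mono mult_right_mono) auto
    moreover have "min ?p ?q * (\<eta> $ 1)\<^sup>2 + min ?p ?q * (\<eta> $ 2)\<^sup>2 \<le> ?f \<eta>"
      unfolding f by (intro add_mono mult_right_mono) auto
    ultimately show ?thesis unfolding distrib_left[symmetric] n[OF that] by simp
  qed
  ultimately have "(SUP \<eta>\<in>{\<eta>. norm \<eta> = 1}. ?f \<eta>) = max ?p ?q" "(INF \<eta>\<in>{\<eta>. norm \<eta> = 1}. ?f \<eta>) = min ?p ?q"
    by (auto intro!: cSup_eq_maximum cInf_eq_minimum)
  then show ?thesis unfolding ellipticity_ratio_def by simp
qed

text \<open>The density is positive everywhere, so a half-line of mass zero would be Lebesgue null,
  although it contains an interval of length 1.\<close>

lemma std_normal_tail_pos: "0 < measure std_normal_distribution {a<..}"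
proof -
  interpret real_distribution std_normal_distribution by (rule real_dist_normal_dist)
  have "emeasure std_normal_distribution {a<..} \<noteq> 0"
  proof
    assume "emeasure std_normal_distribution {a<..} = 0"
    then have "(\<integral>\<^sup>+x. ennreal (std_normal_density x) * indicator {a<..} x \<partial>lborel) = 0"
      by (simp add: emeasure_density)
    then have "AE x in lborel. ennreal (std_normal_density x) * indicator {a<..} x = 0"
      by (subst (asm) nn_integral_0_iff_AE) auto
    then have "AE x in lborel. x \<notin> {a<..}"
    proof eventually_elim
      case (elim x)
      have "0 < std_normal_density x" by (rule normal_density_pos) simp
      then show ?case using elim by (auto simp: indicator_def split: if_splits)
    qed
    then have "emeasure lborel {a<..} = 0"
      by (subst (asm) AE_iff_measurable[of "{a<..}"]) auto
    moreover have "emeasure lborel {a<..<a+1} \<le> emeasure lborel {a<..}" by (intro emeasure_mono) auto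
    ultimately show False by simp
  qed
  then show ?thesis by (simp add: emeasure_eq_measure less_le)
qed

section \<open>Measurability of the final event\<close>

context filtered_prob_space
begin

lemma measurable_progressive_slice:
  assumes t: "t \<in> {0..T}"
  shows "(\<lambda>\<omega>. (t, \<omega>)) \<in> measurable M (progressive_sigma (space M) T F)"
proof -
  have "(\<lambda>\<omega>. (t, \<omega>)) \<in> measurable M (restrict_space borel {0..T} \<Otimes>\<^sub>M F T)"
    using t by (intro measurable_Pair measurable_const measurable_identity_F) (simp add: space_restrict_space)
  then show ?thesis
    using sets_progressive_sigma by (auto simp: measurable_def)
qed

text \<open>Completeness puts every subset of a null set into \<open>F 0\<close>, so agreeing almost
  surely with a measurable set suffices. It is meant for the event of the theorem, whose description
  by a Jacobian and by extrema over unit vectors does not make measurability evident.\<close>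

lemma AE_eq_measurable:
  assumes B: "B \<in> sets M" and AE: "AE \<omega> in M. P \<omega> \<longleftrightarrow> \<omega> \<in> B"
  shows "{\<omega>\<in>space M. P \<omega>} \<in> sets M" "prob {\<omega>\<in>space M. P \<omega>} = prob B"
proof -
  have null: "A \<in> sets M" if "A \<subseteq> N" "N \<in> null_sets M" for A N
  proof -
    have "A \<in> sets (F 0)" using complete_filtration that unfolding complete_filtration_def by blast
    then show ?thesis using sets_F_subset[of 0] T_pos by auto
  qed
  obtain N where N: "N \<in> null_sets M" "{\<omega>\<in>space M. \<not> (P \<omega> \<longleftrightarrow> \<omega> \<in> B)} \<subseteq> N"
    using AE unfolding eventually_ae_filter by auto
  have "{\<omega>\<in>space M. P \<omega> \<and> \<omega> \<notin> B} \<in> sets M" "{\<omega>\<in>space M. \<not> P \<omega> \<and> \<omega> \<in> B} \<in> sets M"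
    using N by (auto intro: null)
  moreover have "{\<omega>\<in>space M. P \<omega>} = (B - {\<omega>\<in>space M. \<not> P \<omega> \<and> \<omega> \<in> B}) \<union> {\<omega>\<in>space M. P \<omega> \<and> \<omega> \<notin> B}"
    using sets.sets_into_space[OF B] by auto
  ultimately show S: "{\<omega>\<in>space M. P \<omega>} \<in> sets M" using B by auto
  show "prob {\<omega>\<in>space M. P \<omega>} = prob B"
    using AE by (intro finite_measure_eq_AE S B) (auto elim!: eventually_mono)
qed

end

context trig_flow
begin

text \<open>After rescaling, D has the characteristic function of the standard normal law; Levy's
  uniqueness theorem identifies the law, under which every half-line has positive mass.\<close>

lemma log_ratio_tail_pos:
  assumes t: "0 < t" "t \<le> T" and D: "D \<in> borel_measurable M"
    and D_eq: "AE \<omega> in M. D \<omega> = ln \<bar>jacobian (\<xi> t \<omega>) (at x) $ 1 $ 1\<bar> - ln \<bar>jacobian (\<xi> t \<omega>) (at x) $ 2 $ 2\<bar>"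
  shows "0 < prob {\<omega>\<in>space M. D \<omega> > K}"
proof -
  note [measurable] = D
  have t': "t \<in> {0..T}" using t by auto
  \<comment> \<open>The standard deviation of D, with square 8 pi^2 t, so that (2 pi \<theta> /
    \<sigma>)^2 t = \<theta>^2 / 2.\<close>
  define \<sigma> where "\<sigma> = 2 * pi * sqrt (2 * t)"
  have \<sigma>: "0 < \<sigma>" using t by (simp add: \<sigma>_def)
  have \<sigma>2: "\<sigma>\<^sup>2 = (2 * pi)\<^sup>2 * (2 * t)" using t by (simp add: \<sigma>_def power_mult_distrib)
  let ?N = "distr M borel (\<lambda>\<omega>. D \<omega> / \<sigma>)"
  have "char ?N = char std_normal_distribution"
  proof
    fix \<theta> :: real
    have E: "expectation (\<lambda>\<omega>. cos (\<theta> * (D \<omega> / \<sigma>) + c)) = cos c * exp (- (\<theta>\<^sup>2) / 2)" for c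
    proof -
      have "(2 * pi * (\<theta> / \<sigma>))\<^sup>2 * t = \<theta>\<^sup>2 / 2"
        using t unfolding power_mult_distrib power_divide \<sigma>2 by (simp add: field_simps)
      then show ?thesis using expectation_cos_log_ratio[OF t' D D_eq, of "\<theta> / \<sigma>" c] by simp
    qed
    have int: "integrable M (\<lambda>\<omega>. iexp (\<theta> * (D \<omega> / \<sigma>)))"
      by (intro integrable_const_bound[of _ 1]) auto
    have "char ?N \<theta> = expectation (\<lambda>\<omega>. iexp (\<theta> * (D \<omega> / \<sigma>)))"
      unfolding char_def by (subst integral_distr) auto
    also have "\<dots> = of_real (exp (- (\<theta>\<^sup>2) / 2))"
    proof (rule complex_eqI)
      have "Re (expectation (\<lambda>\<omega>. iexp (\<theta> * (D \<omega> / \<sigma>)))) = expectation (\<lambda>\<omega>. cos (\<theta> * (D \<omega> / \<sigma>) + 0))"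
        using integral_bounded_linear[OF bounded_linear_Re int] by (simp add: Re_exp)
      then show "Re (expectation (\<lambda>\<omega>. iexp (\<theta> * (D \<omega> / \<sigma>)))) = Re (complex_of_real (exp (- (\<theta>\<^sup>2) / 2)))"
        unfolding E by simp
      \<comment> \<open>The phase -pi/2 turns the cosine into a sine, and the factor cos (-pi/2) = 0
        makes the imaginary part vanish.\<close>
      have "Im (expectation (\<lambda>\<omega>. iexp (\<theta> * (D \<omega> / \<sigma>)))) = expectation (\<lambda>\<omega>. cos (\<theta> * (D \<omega> / \<sigma>) + (- (pi/2))))"
        using integral_bounded_linear[OF bounded_linear_Im int] by (simp add: Im_exp cos_diff)
      then show "Im (expectation (\<lambda>\<omega>. iexp (\<theta> * (D \<omega> / \<sigma>)))) = Im (complex_of_real (exp (- (\<theta>\<^sup>2) / 2)))"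
        unfolding E by simp
    qed
    finally show "char ?N \<theta> = char std_normal_distribution \<theta>"
      by (simp add: char_std_normal_distribution)
  qed
  then have eq: "?N = std_normal_distribution"
    by (intro Levy_uniqueness real_distribution_distr real_dist_normal_dist) measurable
  have "prob {\<omega>\<in>space M. D \<omega> > K} = prob ((\<lambda>\<omega>. D \<omega> / \<sigma>) -` {K / \<sigma><..} \<inter> space M)"
    using \<sigma> by (intro arg_cong[where f = prob]) (auto simp: divide_less_cancel)
  also have "\<dots> = measure ?N {K / \<sigma><..}" by (subst measure_distr) auto
  finally show ?thesis unfolding eq using std_normal_tail_pos by simp
qed

text \<open>The coefficients of the two components never act through the same motion and their
  squares sum to 1, so the noise subtracts 1/2 on the diagonal and nothing off it; the diagonal
  inverse Jacobian then divides by squares.\<close>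

lemma transformed_diffusion_diagonal:
  assumes a: "a 1 2 = (\<lambda>t \<omega> x. 0)" "a 2 1 = (\<lambda>t \<omega> x. 0)"
    and J: "\<And>i j. (jacobian (\<xi> t \<omega>) (at x) $ i $ j = 0) \<longleftrightarrow> i \<noteq> j"
  shows "transformed_diffusion a trig_noise \<xi> t \<omega> x $ i $ j
    = (if i = j then (a i i t \<omega> (\<xi> t \<omega> x) - 1/2) / (jacobian (\<xi> t \<omega>) (at x) $ i $ i)\<^sup>2 else 0)"
proof -
  let ?J = "jacobian (\<xi> t \<omega>) (at x)" and ?y = "\<xi> t \<omega> x"
  have inv: "matrix_inv ?J = (\<chi> i j. if i = j then 1 / ?J $ i $ i else 0)"
    by (rule matrix_inv_diagonal) (simp_all add: J)
  have s: "(\<Sum>n\<in>UNIV. noise_coeff k n z * noise_coeff k n z) = 1" for k z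
    using sum_noise_coeff_square[of k z] by (simp add: power2_eq_square)
  have s0: "(\<Sum>n\<in>UNIV. noise_coeff 1 n z * noise_coeff 2 n z') = 0" "(\<Sum>n\<in>UNIV. noise_coeff 2 n z' * noise_coeff 1 n z) = 0" for z z'
    by (simp_all add: noise_coeff_disjoint mult.commute[of "noise_coeff 2 _ _"])
  show ?thesis
    unfolding transformed_diffusion_def Let_def inv trig_noise_component
    using exhaust_2[of i] exhaust_2[of j]
    by (auto simp: sum_2 a s s0 power2_eq_square)
qed

end

theorem proposition4p2:
  fixes M :: "'w measure" and T :: real and F :: "real \<Rightarrow> 'w measure"
    and w :: "4 \<Rightarrow> real \<Rightarrow> 'w \<Rightarrow> real"
    and a :: "2 \<Rightarrow> 2 \<Rightarrow> real \<Rightarrow> 'w \<Rightarrow> real^2 \<Rightarrow> real"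
    and \<xi> :: "real \<Rightarrow> 'w \<Rightarrow> real^2 \<Rightarrow> real^2"
    and \<delta> :: real
  assumes "prob_space M" and "0 < T"
    and "complete_filtration M T F"
    and "independent_brownian_motions M T F w"
    and "a 1 2 = (\<lambda>t \<omega> x. 0)" and "a 2 1 = (\<lambda>t \<omega> x. 0)"
    and "\<forall>i. \<forall>t\<in>{0..T}. \<forall>\<omega>\<in>space M. torus_periodic (a i i t \<omega>)"
    and "\<forall>i. (\<lambda>((t, \<omega>), x). a i i t \<omega> x)
               \<in> borel_measurable (progressive_sigma (space M) T F \<Otimes>\<^sub>M borel)"
    and "0 < \<delta>" and "\<delta> < 1"
    and "AE \<omega> in M. \<forall>i. \<forall>t\<in>{0..T}. \<forall>x. 1/2 + \<delta> \<le> a i i t \<omega> x \<and> a i i t \<omega> x \<le> 1/2 + 1/\<delta>"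
    and "stochastic_flow M T F w trig_noise \<xi>"
  shows "\<forall>t\<in>{0<..T}. \<forall>x. \<forall>k>0.
    measure M {\<omega>\<in>space M. ellipticity_ratio (transformed_diffusion a trig_noise \<xi> t \<omega> x) > k} > 0"
proof (intro ballI allI impI)
  interpret prob_space M by (rule assms(1))
  interpret trig_flow M T F w \<xi>
    by unfold_locales (use assms in auto)
  fix t :: real and x :: "real^2" and k :: real
  assume t: "t \<in> {0<..T}" and k: "0 < k"
  then have t': "t \<in> {0..T}" by auto
  \<comment> \<open>A limit of quotients is measurable in \<omega> by construction, and it agrees
    with the Jacobian entry almost surely.\<close>
  define J where "J i \<omega> = lim (\<lambda>k. quot i i k x t \<omega>)" for i \<omega>
  define b where "b i \<omega> = a i i t \<omega> (\<xi> t \<omega> x)" for i \<omega>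
  define \<alpha> where "\<alpha> i \<omega> = (b i \<omega> - 1/2) / (J i \<omega>)\<^sup>2" for i \<omega>
  define R where "R \<omega> = max (\<alpha> 1 \<omega>) (\<alpha> 2 \<omega>) / min (\<alpha> 1 \<omega>) (\<alpha> 2 \<omega>)" for \<omega>
  define D where "D \<omega> = ln \<bar>J 1 \<omega>\<bar> - ln \<bar>J 2 \<omega>\<bar>" for \<omega>
  \<comment> \<open>Chosen so that exp (2 L) = k / \<delta>^2: on D > L the squared Jacobian ratio
    outweighs the factor \<open>\<delta>\<^sup>2\<close> that the coefficients may cost.\<close>
  define L where "L = ln (k / \<delta>\<^sup>2) / 2"
  note [measurable] = ito_expansion_measurable(3)[OF quot_expansion t']
  have Jm[measurable]: "J i \<in> borel_measurable M" for i unfolding J_def by measurable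
  have bm[measurable]: "b i \<in> borel_measurable M" for i
  proof -
    have "(\<lambda>\<omega>. ((t, \<omega>), \<xi> t \<omega> x)) \<in> measurable M (progressive_sigma (space M) T F \<Otimes>\<^sub>M borel)"
      by (intro measurable_Pair measurable_progressive_slice[OF t'] measurable_F[OF flow_measurable t'] t')
    from measurable_compose[OF this assms(8)[rule_format, of i]] show ?thesis by (simp add: b_def[abs_def])
  qed
  have Rm[measurable]: "R \<in> borel_measurable M" unfolding R_def \<alpha>_def by measurable
  have Dm[measurable]: "D \<in> borel_measurable M" unfolding D_def by measurable
  have J: "AE \<omega> in M. \<forall>i. J i \<omega> = jacobian (\<xi> t \<omega>) (at x) $ i $ i"
    using flow_jacobian(1)[OF t', of x] by eventually_elim (auto simp: J_def intro: limI)
  have "0 < prob {\<omega>\<in>space M. D \<omega> > L}"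
    by (rule log_ratio_tail_pos[OF _ _ Dm, where x = x and t = t])
       (use t J in \<open>auto simp: D_def elim!: eventually_mono\<close>)
  also have "\<dots> \<le> prob {\<omega>\<in>space M. R \<omega> > k}"
  proof (rule finite_measure_mono_AE)
    show "AE \<omega> in M. \<omega> \<in> {\<omega>\<in>space M. D \<omega> > L} \<longrightarrow> \<omega> \<in> {\<omega>\<in>space M. R \<omega> > k}"
      using J flow_jacobian(2)[OF t', of x] assms(11)
    proof eventually_elim
      case (elim \<omega>)
      have nz: "J i \<omega> \<noteq> 0" for i using elim(1,2) by auto
      have lo: "\<delta> \<le> b i \<omega> - 1/2" and hi: "b i \<omega> - 1/2 \<le> 1/\<delta>" for i
        using elim(3)[rule_format, OF t', of i "\<xi> t \<omega> x"] by (auto simp: b_def)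
      have pos: "0 < b i \<omega> - 1/2" for i using lo[of i] assms(9) by linarith
      then have \<alpha>: "0 < \<alpha> i \<omega>" for i using nz by (simp add: \<alpha>_def)
      have "k < R \<omega>" if "L < D \<omega>"
      proof -
        have "k / \<delta>\<^sup>2 = exp (2 * L)" using k assms(9) by (simp add: L_def)
        also have "\<dots> < exp (2 * D \<omega>)" using that by simp
        also have "exp (2 * D \<omega>) = (J 1 \<omega>)\<^sup>2 / (J 2 \<omega>)\<^sup>2"
          using nz exp_of_nat_mult[of 2 "D \<omega>"] by (simp add: D_def exp_diff power_divide)
        finally have "k < \<delta>\<^sup>2 * ((J 1 \<omega>)\<^sup>2 / (J 2 \<omega>)\<^sup>2)" using assms(9) by (simp add: field_simps)
        \<comment> \<open>The lower bound for b 2 and the upper bound for b 1 make this coefficient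
          ratio at least \<delta> / (1/\<delta>).\<close>
        also have "\<dots> \<le> ((b 2 \<omega> - 1/2) / (b 1 \<omega> - 1/2)) * ((J 1 \<omega>)\<^sup>2 / (J 2 \<omega>)\<^sup>2)"
        proof (rule mult_right_mono)
          have "\<delta>\<^sup>2 * (b 1 \<omega> - 1/2) \<le> \<delta>\<^sup>2 * (1/\<delta>)" using hi by (intro mult_left_mono) auto
          also have "\<dots> = \<delta>" using assms(9) by (simp add: power2_eq_square)
          also have "\<dots> \<le> b 2 \<omega> - 1/2" by (rule lo)
          finally show "\<delta>\<^sup>2 \<le> (b 2 \<omega> - 1/2) / (b 1 \<omega> - 1/2)" using pos[of 1] by (simp add: le_divide_eq)
        qed simp
        also have "\<dots> = \<alpha> 2 \<omega> / \<alpha> 1 \<omega>" by (simp add: \<alpha>_def)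
        \<comment> \<open>Whichever entry is larger, the quotient of maximum and minimum dominates
          this one.\<close>
        also have "\<dots> \<le> R \<omega>" unfolding R_def using \<alpha>[of 1] \<alpha>[of 2] by (intro frac_le) auto
        finally show ?thesis .
      qed
      then show ?case by auto
    qed
  qed measurable
  \<comment> \<open>R is measurable and equals the ellipticity ratio almost surely, which carries
    the probability over to the event of the statement.\<close>
  also have "prob {\<omega>\<in>space M. R \<omega> > k}
    = prob {\<omega>\<in>space M. ellipticity_ratio (transformed_diffusion a trig_noise \<xi> t \<omega> x) > k}"
  proof (rule AE_eq_measurable(2)[symmetric])
    show "{\<omega>\<in>space M. R \<omega> > k} \<in> sets M" by measurable
    show "AE \<omega> in M. (k < ellipticity_ratio (transformed_diffusion a trig_noise \<xi> t \<omega> x)) \<longleftrightarrow> \<omega> \<in> {\<omega>\<in>space M. R \<omega> > k}"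
      using J flow_jacobian(2)[OF t', of x] assms(11) AE_space
    proof eventually_elim
      case (elim \<omega>)
      let ?A = "transformed_diffusion a trig_noise \<xi> t \<omega> x"
      note A = transformed_diffusion_diagonal[where a = a, OF assms(5,6), of t \<omega> x]
      have A: "?A $ i $ j = (if i = j then \<alpha> i \<omega> else 0)" for i j
        using A[of i j] elim(1,2) by (simp add: \<alpha>_def b_def)
      have "0 < \<alpha> i \<omega>" for i
      proof -
        have "0 < b i \<omega> - 1/2"
          using elim(3)[rule_format, OF t', of i "\<xi> t \<omega> x"] assms(9) by (auto simp: b_def)
        then show ?thesis using elim(1,2) by (simp add: \<alpha>_def)
      qed
      then have "ellipticity_ratio ?A = R \<omega>"
        unfolding R_def by (subst ellipticity_ratio_diagonal) (simp_all add: A)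
      then show ?case using elim(4) by simp
    qed
  qed
  finally show "0 < measure M {\<omega>\<in>space M. k < ellipticity_ratio (transformed_diffusion a trig_noise \<xi> t \<omega> x)}" .
qed

end
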